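(* Let $\kappa_n$ be the support size of the almost surely unique global minimizer of $\min\{x^\top Qx:x\in\Delta^{n-1}\}$ with $Q$ drawn from the Gaussian Orthogonal Ensemble. Then $$\lim_{n\to\infty}\frac{n}{\sqrt{\log n}}\,\mathbb P(\kappa_n>1)=\lim_{n\to\infty}\frac{n}{\sqrt{\log n}}\,\mathbb P(\kappa_n=2)=2\sqrt{2\pi}.$$
   Context: $\Delta^{n-1}=\{x\in\mathbb R^n: x_i\ge 0\ \forall i,\ \sum_i x_i=1\}$. $Q$ is a random symmetric $n\times n$ matrix with $Q_{ii}\sim N(0,1)$ and $Q_{ij}=Q_{ji}\sim N(0,1/2)$ (variance $1/2$) for $i<j$, all upper-triangular entries (including the diagonal) being independent. The program has almost surely a unique global minimizer $x^\star$; $\kappa_n:=|\{i:x^\star_i>0\}|$. *)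

theory Defs
  imports "HOL-Probability.Probability"
begin

text \<open>
  The dimension \<open>n\<close> tends to infinity, so vectors in \<open>\<real>\<^sup>n\<close> and real \<open>n \<times> n\<close> matrices are
  functions on \<open>nat\<close>, indexed by \<open>0, \<dots>, n - 1\<close>. Points of the simplex vanish outside that
  range, so that they correspond bijectively to points of the simplex in \<open>\<real>\<^sup>n\<close>; in
  particular uniqueness of a point of the simplex means what it should.
\<close>

definition std_simplex :: "nat \<Rightarrow> (nat \<Rightarrow> real) set" where
  "std_simplex n =
     {x. (\<forall>i<n. 0 \<le> x i) \<and> (\<forall>i\<ge>n. x i = 0) \<and> (\<Sum>i<n. x i) = 1}"

definition quad_form :: "nat \<Rightarrow> (nat \<Rightarrow> nat \<Rightarrow> real) \<Rightarrow> (nat \<Rightarrow> real) \<Rightarrow> real" where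
  "quad_form n A x = (\<Sum>i<n. \<Sum>j<n. x i * A i j * x j)"

definition global_minimizer :: "nat \<Rightarrow> (nat \<Rightarrow> nat \<Rightarrow> real) \<Rightarrow> (nat \<Rightarrow> real) \<Rightarrow> bool" where
  "global_minimizer n A x \<longleftrightarrow>
     x \<in> std_simplex n \<and> (\<forall>y\<in>std_simplex n. quad_form n A x \<le> quad_form n A y)"

text \<open>
  The value \<open>0\<close> for matrices without a unique minimizer is a convention. It concerns only a null
  set of matrices, and it makes the level sets of \<open>minimizer_support_size n\<close> independent of
  the unspecified value of a description without a unique witness.
\<close>

definition minimizer_support_size :: "nat \<Rightarrow> (nat \<Rightarrow> nat \<Rightarrow> real) \<Rightarrow> nat" where
  "minimizer_support_size n A =
     (if \<exists>!x. global_minimizer n A x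
      then card {i. i < n \<and> (THE x. global_minimizer n A x) i > 0} else 0)"

text \<open>
  \<open>Q i j\<close> is the random \<open>(i, j)\<close> entry. The second parameter of \<^const>\<open>normal_density\<close> is the
  standard deviation, so \<open>sqrt (1 / 2)\<close> stands for variance \<open>1 / 2\<close>.
\<close>

definition GOE :: "'a measure \<Rightarrow> nat \<Rightarrow> (nat \<Rightarrow> nat \<Rightarrow> 'a \<Rightarrow> real) \<Rightarrow> bool" where
  "GOE M n Q \<longleftrightarrow>
     prob_space M \<and>
     (\<forall>i<n. distributed M lborel (Q i i) (normal_density 0 1)) \<and>
     (\<forall>j<n. \<forall>i<j. distributed M lborel (Q i j) (normal_density 0 (sqrt (1 / 2)))) \<and>
     (\<forall>i<n. \<forall>j<n. \<forall>\<omega>\<in>space M. Q i j \<omega> = Q j i \<omega>) \<and>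
     prob_space.indep_vars M (\<lambda>_. borel) (\<lambda>(i, j). Q i j) {(i, j). i \<le> j \<and> j < n}"

end

theory Submission
  imports Defs "HOL-Real_Asymp.Real_Asymp"
begin

text \<open>
  Put \<open>Z = - Q\<close>, let \<open>t\<close> be the largest diagonal entry of \<open>Z\<close> and \<open>l\<close> its position, and write
  \<open>\<phi>\<close> and \<open>\<Psi>\<close> for the standard normal density and upper tail. The vertex \<open>l\<close> has the value
  \<open>- t\<close>, and \<open>t\<close> is close to \<open>sqrt (2 ln n)\<close>. To leading order the minimizer fails to be a
  vertex exactly when some off-diagonal entry \<open>Z l j\<close> in the row of \<open>l\<close> exceeds \<open>t\<close>. If this
  happens, then the value decreases from the vertex \<open>l\<close> towards the vertex \<open>j\<close>, so no vertex is
  a minimizer (\<open>minimizer_not_vertex\<close>). Off-diagonal entries have variance \<open>1 / 2\<close>, hence the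
  probability is about
  \<open>n\<^sup>2 \<integral> \<phi>(t) (1 - \<Psi>(t))\<^bsup>n - 1\<^esup> \<Psi>(sqrt 2 t) dt\<close>.
  The Mills bounds give \<open>\<Psi>(sqrt 2 t) \<sim> sqrt \<pi> t \<Psi>(t)\<^sup>2\<close>, and \<open>u = \<Psi>(t)\<close> turns the integral into the Beta
  integral of \<open>u\<^sup>2 (1 - u)\<^bsup>n - 1\<^esup>\<close>, which is \<open>2 / (n (n + 1) (n + 2))\<close>. The result is
  \<open>n\<^sup>2 sqrt \<pi> sqrt (2 ln n) 2 / n\<^sup>3 = 2 sqrt (2 \<pi>) sqrt (ln n) / n\<close>. The two sides of this computation are
  \<open>nn_integral_argmax_below_row_le\<close> and \<open>nn_integral_strict_argmax_below_row_ge\<close>.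

  Everything else has to be of smaller order.

  \<^item> All diagonal entries of \<open>Z\<close> lie below a level \<open>t0\<close> with \<open>t0\<^sup>2 = 2 ln n - 4 ln (ln n)\<close>. The
    expected number of entries above this level is of the order of a power of \<open>ln n\<close> greater
    than one, so this probability decays faster than every power of \<open>n\<close>.

  \<^item> The support \<open>S\<close> has \<open>k \<ge> 3\<close> points. The gradient of a minimizer is constant on its support, so
    the column sums of \<open>Z\<close> over \<open>S \<times> S\<close> have a weighted mean of at least \<open>k t\<close>, and one of them is
    at least \<open>k t\<close> (\<open>minimizer_small_column_sum\<close>). A column sum is normal with variance
    \<open>(k + 1) / 2\<close>; up to powers of \<open>ln n\<close> the probability is at most \<open>n\<close> to the power \<open>- 3 k / 2\<close>,
    which beats the at most \<open>n\<^sup>k\<close> choices of \<open>S\<close> and of the column (\<open>prob_heavy_column_le\<close>).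

  \<^item> The support is \<open>{i, j}\<close> with \<open>l \<notin> {i, j}\<close>. Its value is at most \<open>- t\<close>, which forces \<open>Z i j \<ge> t\<close> and
    places the larger one of \<open>Z i i\<close> and \<open>Z j j\<close> just below \<open>t\<close> (\<open>edge_minimum_below\<close>). The
    gap is at most \<open>2 h\<^sup>2 / t\<close>, unless both entries are large, where the excess \<open>h = Z i j - t\<close> is typically
    of order \<open>1 / t\<close>. Such a small gap costs a factor of order \<open>1 / t\<^sup>2\<close> against the main term
    (\<open>prob_stray_edge_le\<close>).

  Uniqueness is a concavity argument. As a function of \<open>Q i i\<close> alone the minimum is concave, and
  two minimizers with different \<open>i\<close>-th coordinates give it two different slopes; this can happen
  for countably many values of \<open>Q i i\<close> only (\<open>countable_ties_in_diagonal_entry\<close>).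
\<close>

section \<open>Minimizers of a quadratic form on the simplex\<close>

lemma quad_form_eq_sum_gradient:
  "quad_form n A x = (\<Sum>i<n. x i * (\<Sum>j<n. A i j * x j))"
  by (simp add: quad_form_def sum_distrib_left mult.assoc)

lemma std_simplex_unit_vector: "l < n \<Longrightarrow> (\<lambda>i. if i = l then 1 else 0) \<in> std_simplex n"
  by (auto simp: std_simplex_def)

lemma quad_form_unit_vector:
  assumes "l < n" shows "quad_form n A (\<lambda>i. if i = l then 1 else 0) = A l l"
proof -
  have "(\<Sum>j<n. (if i = l then 1 else 0) * A i j * (if j = l then 1 else 0)) =
      (if i = l then (\<Sum>j<n. if j = l then A i j else 0) else 0)" for i
    by (simp add: if_distrib cong: if_cong)
  then have "quad_form n A (\<lambda>i. if i = l then 1 else 0) = (\<Sum>i<n. if i = l then (\<Sum>j<n. if j = l then A i j else 0) else 0)"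
    unfolding quad_form_def by simp
  also have "\<dots> = A l l" using assms by simp
  finally show ?thesis .
qed

lemma quad_form_towards_vertex:
  assumes sym: "\<And>i j. i < n \<Longrightarrow> j < n \<Longrightarrow> A i j = A j i" and l: "l < n"
  shows "quad_form n A (\<lambda>i. (1 - e) * x i + (if i = l then e else 0)) =
    (1 - e)\<^sup>2 * quad_form n A x + 2 * e * (1 - e) * (\<Sum>j<n. A l j * x j) + e\<^sup>2 * A l l"
proof -
  have *: "((1 - e) * x i + (if i = l then e else 0)) * A i j * ((1 - e) * x j + (if j = l then e else 0))
    = (1 - e)\<^sup>2 * (x i * A i j * x j) + (if i = l then e * (1 - e) * (A i j * x j) else 0)
      + (if j = l then e * (1 - e) * (x i * A i j) else 0)
      + (if i = l then (if j = l then e\<^sup>2 * A i j else 0) else 0)" for i j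
    by (auto simp: power2_eq_square algebra_simps)
  have 1: "(\<Sum>i<n. \<Sum>j<n. if i = l then e * (1 - e) * (A i j * x j) else 0) = e * (1 - e) * (\<Sum>j<n. A l j * x j)"
  proof -
    have "(\<Sum>i<n. \<Sum>j<n. if i = l then e * (1 - e) * (A i j * x j) else 0) =
       (\<Sum>i<n. if i = l then (\<Sum>j<n. e * (1 - e) * (A i j * x j)) else 0)"
      by (intro sum.cong) auto
    then show ?thesis using l by (simp add: sum_distrib_left)
  qed
  have 2: "(\<Sum>i<n. \<Sum>j<n. if j = l then e * (1 - e) * (x i * A i j) else 0) = e * (1 - e) * (\<Sum>j<n. A l j * x j)"
    using l sym by (simp add: sum_distrib_left mult.commute mult.left_commute)
  have 3: "(\<Sum>i<n. \<Sum>j<n. if i = l then (if j = l then e\<^sup>2 * A i j else 0) else 0) = e\<^sup>2 * A l l"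
  proof -
    have "(\<Sum>i<n. \<Sum>j<n. if i = l then (if j = l then e\<^sup>2 * A i j else 0) else 0)
       = (\<Sum>i<n. if i = l then (\<Sum>j<n. if j = l then e\<^sup>2 * A i j else 0) else 0)"
      by (intro sum.cong) auto
    then show ?thesis using l by simp
  qed
  show ?thesis
    unfolding quad_form_def * sum.distrib 1 2 3
    by (simp add: sum_distrib_left[symmetric])
qed

text \<open>
  Half of the directional derivative towards the vertex \<open>l\<close> is the difference of the two sides.
\<close>

lemma minimizer_gradient_ge:
  assumes sym: "\<And>i j. i < n \<Longrightarrow> j < n \<Longrightarrow> A i j = A j i" and min: "global_minimizer n A x" and l: "l < n"
  shows "quad_form n A x \<le> (\<Sum>j<n. A l j * x j)"
proof (rule ccontr)
  define q g where "q = quad_form n A x" and "g = (\<Sum>j<n. A l j * x j)"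
  assume "\<not> ?thesis"
  then have gq: "g < q" by (simp add: q_def g_def)
  define c where "c = \<bar>q - 2 * g + A l l\<bar>"
  \<comment> \<open>Small enough for the linear term in \<open>e\<close> to dominate the quadratic one.\<close>
  define e where "e = min 1 ((q - g) / (c + 1))"
  have c: "0 < c + 1" by (simp add: c_def)
  have "e * (c + 1) \<le> (q - g) / (c + 1) * (c + 1)"
    using c by (intro mult_right_mono) (auto simp: e_def)
  then have e: "0 < e" "e \<le> 1" "e * (c + 1) \<le> q - g"
    using gq c by (auto simp: e_def)
  have x: "x \<in> std_simplex n" using min by (simp add: global_minimizer_def)
  have "(\<Sum>i<n. (1 - e) * x i + (if i = l then e else 0)) = (1 - e) * (\<Sum>i<n. x i) + e"
    using l by (simp add: sum.distrib sum_distrib_left)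
  then have "(\<lambda>i. (1 - e) * x i + (if i = l then e else 0)) \<in> std_simplex n"
    using x e l by (auto simp: std_simplex_def)
  then have "q \<le> (1 - e)\<^sup>2 * q + 2 * e * (1 - e) * g + e\<^sup>2 * A l l"
    using min quad_form_towards_vertex[where A=A and e=e and x=x, OF sym l]
    by (auto simp: global_minimizer_def q_def g_def)
  then have "0 \<le> e * (2 * (g - q) + e * (q - 2 * g + A l l))"
    by (simp add: power2_eq_square algebra_simps)
  then have "0 \<le> 2 * (g - q) + e * (q - 2 * g + A l l)"
    using e by (simp add: zero_le_mult_iff)
  also have "e * (q - 2 * g + A l l) \<le> e * (c + 1)"
    using e by (intro mult_left_mono) (auto simp: c_def)
  finally show False using e gq by simp
qed

text \<open>
  The mean of the gradient with weights \<open>x\<close> is the value itself, and no coordinate of the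
  gradient is smaller.
\<close>

lemma minimizer_gradient_eq:
  assumes sym: "\<And>i j. i < n \<Longrightarrow> j < n \<Longrightarrow> A i j = A j i" and min: "global_minimizer n A x" and l: "l < n" "x l > 0"
  shows "(\<Sum>j<n. A l j * x j) = quad_form n A x"
proof -
  define q where "q = quad_form n A x"
  define g where "g l = (\<Sum>j<n. A l j * x j)" for l
  have x: "\<And>i. i < n \<Longrightarrow> 0 \<le> x i" "(\<Sum>i<n. x i) = 1"
    using min by (auto simp: global_minimizer_def std_simplex_def)
  have "(\<Sum>i<n. x i * (g i - q)) = 0"
    using x(2) quad_form_eq_sum_gradient[of n A x]
    by (simp add: right_diff_distrib sum_subtractf sum_distrib_right[symmetric] q_def g_def)
  moreover have "0 \<le> x i * (g i - q)" if "i < n" for i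
    using x(1)[OF that] minimizer_gradient_ge[OF sym min that] by (simp add: g_def q_def)
  ultimately have "\<forall>i\<in>{..<n}. x i * (g i - q) = 0"
    using sum_nonneg_eq_0_iff[of "{..<n}" "\<lambda>i. x i * (g i - q)"] by simp
  then have "x l * (g l - q) = 0" using l by blast
  then show ?thesis using l by (simp add: g_def q_def)
qed

lemma minimizer_value_le_diagonal:
  assumes "global_minimizer n A x" "l < n" shows "quad_form n A x \<le> A l l"
  using assms std_simplex_unit_vector[of l n] quad_form_unit_vector[of l n A] unfolding global_minimizer_def by metis

definition supp :: "nat \<Rightarrow> (nat \<Rightarrow> real) \<Rightarrow> nat set" where
  "supp n x = {i. i < n \<and> x i > 0}"

lemma finite_supp [simp]: "finite (supp n x)" by (simp add: supp_def)

lemma sum_over_supp: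
  assumes "x \<in> std_simplex n"
  shows "(\<Sum>j<n. f j * x j) = (\<Sum>j\<in>supp n x. f j * x j)"
  using assms by (intro sum.mono_neutral_right) (auto simp: supp_def std_simplex_def less_le)

lemma sum_supp_1:
  assumes "x \<in> std_simplex n" shows "(\<Sum>j\<in>supp n x. x j) = 1"
  using sum_over_supp[OF assms, of "\<lambda>_. 1"] assms by (simp add: std_simplex_def)

lemma supp_nonempty: "x \<in> std_simplex n \<Longrightarrow> supp n x \<noteq> {}"
  using sum_supp_1 by fastforce

text \<open>
  Summed over the support, the constant gradient gives \<open>card (supp n x)\<close> times the value. The same
  number is the mean of the column sums with weights \<open>x\<close>, so not all of them can exceed it. Only
  linear information about the matrix enters, which makes a union bound over supports of all sizes
  affordable.
\<close>

lemma minimizer_small_column_sum: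
  assumes sym: "\<And>i j. i < n \<Longrightarrow> j < n \<Longrightarrow> A i j = A j i" and min: "global_minimizer n A x"
  shows "\<exists>j\<in>supp n x. (\<Sum>i\<in>supp n x. A i j) \<le> card (supp n x) * quad_form n A x"
proof (rule ccontr)
  define S q where "S = supp n x" and "q = quad_form n A x"
  assume "\<not> ?thesis"
  then have *: "\<And>j. j \<in> S \<Longrightarrow> card S * q < (\<Sum>i\<in>S. A i j)" by (auto simp: S_def q_def not_le)
  have x: "x \<in> std_simplex n" using min by (simp add: global_minimizer_def)
  have S: "S \<noteq> {}" "finite S" using supp_nonempty[OF x] by (auto simp: S_def)
  have "card S * q = (\<Sum>i\<in>S. \<Sum>j\<in>S. A i j * x j)"
    using minimizer_gradient_eq[OF sym min] sum_over_supp[OF x] by (simp add: S_def q_def supp_def)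
  also have "\<dots> = (\<Sum>j\<in>S. x j * (\<Sum>i\<in>S. A i j))"
    by (subst sum.swap) (simp add: sum_distrib_left mult.commute)
  also have "\<dots> > (\<Sum>j\<in>S. x j * (card S * q))"
    using S * by (intro sum_strict_mono mult_strict_left_mono) (auto simp: S_def supp_def)
  also have "(\<Sum>j\<in>S. x j * (card S * q)) = card S * q"
    using sum_supp_1[OF x] by (simp add: sum_distrib_right[symmetric] S_def)
  finally show False by simp
qed

lemma minimizer_on_edge:
  assumes sym: "\<And>i j. i < n \<Longrightarrow> j < n \<Longrightarrow> A i j = A j i" and min: "global_minimizer n A x"
    and S: "supp n x = {i, j}" "i \<noteq> j"
  obtains y z where "0 < y" "0 < z" "y + z = 1" "A i i * y + A i j * z = quad_form n A x"
    "A i j * y + A j j * z = quad_form n A x"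
proof -
  have x: "x \<in> std_simplex n" using min by (simp add: global_minimizer_def)
  have ij: "i < n" "j < n" "x i > 0" "x j > 0" using S by (auto simp: supp_def)
  have "A j i = A i j" using sym ij by auto
  then show ?thesis
    using that[of "x i" "x j"] ij minimizer_gradient_eq[OF sym min, of i] minimizer_gradient_eq[OF sym min, of j]
      sum_over_supp[OF x] sum_supp_1[OF x] S by simp
qed

text \<open>
  The critical point equations on an edge give \<open>(a - q) (c - q) = (q - b)\<^sup>2\<close>. If \<open>m\<close> is the
  smallest diagonal entry of the matrix, then a global minimum \<open>q\<close> inside the edge satisfies
  \<open>q \<le> m\<close>. As \<open>a - m \<le> a - q\<close>, a small \<open>q - b\<close> forces \<open>a\<close> to be close to \<open>m\<close>, and quadratically
  close when \<open>c - q\<close> is of the order of \<open>- m\<close>.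
\<close>

lemma edge_minimum_below:
  fixes a b c y z q m :: real
  assumes yz: "0 < y" "0 < z" "y + z = 1" and eq: "a * y + b * z = q" "b * y + c * z = q"
    and le: "q \<le> m" "m \<le> a" "a \<le> c" "m < 0"
  shows "b \<le> m" "a - m \<le> m - b" "m / 2 \<le> c \<Longrightarrow> a - m \<le> 2 * (m - b)\<^sup>2 / (-m)"
proof -
  have 1: "(a - q) * y = (q - b) * z" "(q - b) * y = (c - q) * z"
  proof -
    have "q = q * y + q * z" using yz by (simp add: distrib_left[symmetric])
    then show "(a - q) * y = (q - b) * z" "(q - b) * y = (c - q) * z" using eq by (simp_all add: left_diff_distrib)
  qed
  have b: "b \<le> q"
  proof (rule ccontr)
    assume "\<not> ?thesis" then have "(q - b) * z < 0" using yz by (simp add: mult_neg_pos)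
    moreover have "0 \<le> (a - q) * y" using yz le by (intro mult_nonneg_nonneg) auto
    ultimately show False using 1 by simp
  qed
  then show "b \<le> m" using le by simp
  have "((a - q) * (c - q)) * (y * z) = ((a - q) * y) * ((c - q) * z)" by (simp add: mult_ac)
  also have "\<dots> = ((q - b) * z) * ((q - b) * y)" using 1 by simp
  also have "\<dots> = ((q - b) * (q - b)) * (y * z)" by (simp add: mult_ac)
  finally have "((a - q) * (c - q)) * (y * z) = ((q - b) * (q - b)) * (y * z)" .
  then have prod: "(a - q) * (c - q) = (q - b)\<^sup>2" using yz by (simp add: power2_eq_square)
  have "(a - q)\<^sup>2 \<le> (q - b)\<^sup>2"
    unfolding prod[symmetric] power2_eq_square[of "a - q"] using le by (intro mult_left_mono) auto
  then have "a - q \<le> q - b" by (rule power2_le_imp_le) (use b in simp)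
  then show "a - m \<le> m - b" using le by simp
  show "a - m \<le> 2 * (m - b)\<^sup>2 / (-m)" if "m / 2 \<le> c"
  proof -
    have "(a - m) * (- m / 2) \<le> (a - q) * (c - q)"
      using le that by (intro mult_mono) auto
    also have "\<dots> \<le> (m - b)\<^sup>2" unfolding prod using b le by (intro power_mono) auto
    finally show ?thesis using le by (simp add: field_simps)
  qed
qed

text \<open>
  Only the vertex with the smallest diagonal entry could be a minimizer, but the value decreases
  from there towards the vertex \<open>j\<close>.
\<close>

lemma minimizer_not_vertex:
  assumes sym: "\<And>i j. i < n \<Longrightarrow> j < n \<Longrightarrow> A i j = A j i" and min: "global_minimizer n A x"
    and l: "l < n" "\<And>p. p < n \<Longrightarrow> p \<noteq> l \<Longrightarrow> A l l < A p p" and j: "j < n" "A l j < A l l"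
  shows "card (supp n x) > 1"
proof (rule ccontr)
  assume "\<not> ?thesis"
  have x: "x \<in> std_simplex n" using min by (simp add: global_minimizer_def)
  from \<open>\<not> ?thesis\<close> supp_nonempty[OF x] have "card (supp n x) = 1"
    by (metis One_nat_def card_0_eq finite_supp less_one linorder_neqE_nat)
  then obtain p where p: "supp n x = {p}" by (rule card_1_singletonE)
  then have pn: "p < n" by (auto simp: supp_def)
  have xp: "x p = 1" using sum_supp_1[OF x] p by simp
  have g: "(\<Sum>j<n. A k j * x j) = A k p" for k
    using sum_over_supp[OF x] p xp by simp
  have q: "quad_form n A x = A p p"
    using minimizer_gradient_eq[OF sym min pn] g xp by simp
  have pl: "p = l"
  proof (rule ccontr)
    assume "p \<noteq> l"
    then show False using minimizer_value_le_diagonal[OF min l(1)] l(2)[OF pn] q by simp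
  qed
  have "quad_form n A x \<le> A j p" using minimizer_gradient_ge[OF sym min j(1)] unfolding g .
  moreover have "A j p = A l j" using sym[OF j(1) l(1)] pl by simp
  ultimately show False using q pl j by simp
qed

section \<open>Ties between minimizers and measurability of the support size\<close>

lemma continuous_quad_form:
  "continuous_on UNIV (\<lambda>p :: (nat \<Rightarrow> nat \<Rightarrow> real) \<times> (nat \<Rightarrow> real). quad_form n (fst p) (snd p))"
proof -
  have A: "continuous_on UNIV (\<lambda>p :: (nat \<Rightarrow> nat \<Rightarrow> real) \<times> (nat \<Rightarrow> real). fst p i j)" for i j
  proof -
    have "continuous_on UNIV (\<lambda>p :: (nat \<Rightarrow> nat \<Rightarrow> real) \<times> (nat \<Rightarrow> real). fst p)"
      by (intro continuous_intros)
    from continuous_on_product_then_coordinatewise[OF this, of i]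
    show ?thesis by (rule continuous_on_product_then_coordinatewise)
  qed
  have x: "continuous_on UNIV (\<lambda>p :: (nat \<Rightarrow> nat \<Rightarrow> real) \<times> (nat \<Rightarrow> real). snd p i)" for i
    by (rule continuous_on_product_then_coordinatewise) (intro continuous_intros)
  show ?thesis unfolding quad_form_def by (intro continuous_intros A x)
qed

lemma continuous_quad_form_snd: "continuous_on UNIV (quad_form n A)"
proof -
  have "continuous_on UNIV ((\<lambda>p. quad_form n (fst p) (snd p)) \<circ> (\<lambda>x. (A, x)))"
    by (rule continuous_on_compose) (auto intro!: continuous_intros continuous_on_subset[OF continuous_quad_form])
  then show ?thesis by (simp add: comp_def)
qed

lemma continuous_coordinate: "continuous_on UNIV (\<lambda>x :: nat \<Rightarrow> real. x i)"
  by (rule continuous_on_product_then_coordinatewise) (rule continuous_on_id)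

lemma closed_std_simplex: "closed (std_simplex n)"
proof -
  have "std_simplex n = (\<Inter>i\<in>{..<n}. {x. 0 \<le> x i}) \<inter> (\<Inter>i\<in>{n..}. {x. x i = 0}) \<inter> {x. (\<Sum>i<n. x i) = 1}"
    by (auto simp: std_simplex_def)
  also have "closed \<dots>"
    by (intro closed_Int closed_INT ballI closed_Collect_le closed_Collect_eq continuous_intros continuous_coordinate)
  finally show ?thesis .
qed

lemma compact_std_simplex: "compact (std_simplex n)"
proof -
  define B :: "nat \<Rightarrow> real set" where "B i = (if i < n then {0..1} else {0})" for i
  have "compactin (product_topology (\<lambda>_. euclidean) UNIV) (PiE UNIV B)"
    by (auto simp: compactin_PiE B_def)
  then have "compact (PiE UNIV B)"
    by (simp add: euclidean_product_topology)
  moreover have "x i \<le> 1" if "x \<in> std_simplex n" "i < n" for x i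
    using that member_le_sum[of i "{..<n}" x] by (auto simp: std_simplex_def)
  then have "std_simplex n \<subseteq> PiE UNIV B"
    by (auto simp: B_def PiE_def Pi_def) (auto simp: std_simplex_def)
  ultimately show ?thesis
    using compact_Int_closed[OF _ closed_std_simplex, of "PiE UNIV B" n] by (simp add: Int_absorb1)
qed

lemma global_minimizer_exists: "n \<ge> 1 \<Longrightarrow> \<exists>x. global_minimizer n A x"
  using continuous_attains_inf[OF compact_std_simplex _ continuous_on_subset[OF continuous_quad_form_snd], of n n A]
    std_simplex_unit_vector[of 0 n] unfolding global_minimizer_def by (metis empty_iff less_eq_Suc_le One_nat_def subset_UNIV)

text \<open>
  The set of pairs of a matrix and one of its minimizers is closed, and projecting along a
  compact set preserves this. Measurability of all sets that describe minimizers rests on it.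
\<close>

lemma closed_matrices_with_minimizer_in:
  assumes C: "closed C"
  shows "closed {A. \<exists>x\<in>C. global_minimizer n A x}"
  unfolding closed_sequential_limits
proof (intro allI impI, elim conjE)
  fix A :: "nat \<Rightarrow> nat \<Rightarrow> nat \<Rightarrow> real" and L
  assume A: "\<forall>k. A k \<in> {A. \<exists>x\<in>C. global_minimizer n A x}" and L: "A \<longlonglongrightarrow> L"
  from A obtain x where x: "\<And>k. x k \<in> C" "\<And>k. global_minimizer n (A k) (x k)" by simp metis
  have "compact (std_simplex n \<inter> C)" using compact_std_simplex C by (rule compact_Int_closed)
  moreover have "\<And>k. x k \<in> std_simplex n \<inter> C" using x by (auto simp: global_minimizer_def)
  ultimately obtain y r where y: "y \<in> std_simplex n \<inter> C" and r: "strict_mono r" and lim: "(x \<circ> r) \<longlonglongrightarrow> y"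
    unfolding compact_def by meson
  have lim': "(\<lambda>k. quad_form n (A (r k)) (z k)) \<longlonglongrightarrow> quad_form n L w" if "z \<longlonglongrightarrow> w" for z w
  proof -
    have "(\<lambda>k. (A (r k), z k)) \<longlonglongrightarrow> (L, w)"
      using LIMSEQ_subseq_LIMSEQ[OF L r] that by (intro tendsto_Pair) (auto simp: comp_def)
    from continuous_on_tendsto_compose[OF continuous_quad_form this] show ?thesis by simp
  qed
  have "quad_form n L y \<le> quad_form n L w" if "w \<in> std_simplex n" for w
    using x(2) that
    by (intro LIMSEQ_le[OF lim'[OF lim] lim'[OF tendsto_const]]) (auto simp: global_minimizer_def comp_def)
  then show "L \<in> {A. \<exists>x\<in>C. global_minimizer n A x}"
    using y by (auto simp: global_minimizer_def)
qed

text \<open>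
  The strict inequality between the \<open>i\<close>-th coordinates loses nothing, as \<open>x\<close> and \<open>y\<close> can be
  exchanged.
\<close>

definition tie :: "nat \<Rightarrow> nat \<Rightarrow> (nat \<Rightarrow> nat \<Rightarrow> real) set" where
  "tie n i = {A. \<exists>x y. global_minimizer n A x \<and> global_minimizer n A y \<and> x i < y i}"

text \<open>
  Two different coordinates are separated by two rational numbers, which reduces a tie to
  countably many pairs of closed conditions.
\<close>

lemma borel_tie: "tie n i \<in> sets borel"
proof -
  have "tie n i = (\<Union>p\<in>{p. fst p < (snd p :: rat)}.
      {A. \<exists>x\<in>{x. x i \<le> of_rat (fst p)}. global_minimizer n A x} \<inter> {A. \<exists>x\<in>{x. x i \<ge> of_rat (snd p)}. global_minimizer n A x})"
    (is "_ = ?R")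
  proof
    show "tie n i \<subseteq> ?R"
    proof
      fix A assume "A \<in> tie n i"
      then obtain x y where xy: "global_minimizer n A x" "global_minimizer n A y" "x i < y i" by (auto simp: tie_def)
      obtain s where s: "x i < of_rat s" "of_rat s < y i" using of_rat_dense[OF xy(3)] by auto
      obtain t where t: "of_rat s < real_of_rat t" "of_rat t < y i" using of_rat_dense[OF s(2)] by auto
      have "(s, t) \<in> {p. fst p < (snd p :: rat)}" using t by (simp add: of_rat_less)
      moreover have "\<exists>x\<in>{x. x i \<le> of_rat (fst (s, t))}. global_minimizer n A x" using xy s by (intro bexI[of _ x]) auto
      moreover have "\<exists>x\<in>{x. x i \<ge> of_rat (snd (s, t))}. global_minimizer n A x" using xy t by (intro bexI[of _ y]) auto
      ultimately show "A \<in> ?R" by blast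
    qed
    show "?R \<subseteq> tie n i"
    proof (clarsimp)
      fix s t :: rat and A x y assume "s < t" "x i \<le> real_of_rat s" "global_minimizer n A x" "real_of_rat t \<le> y i" "global_minimizer n A y"
      moreover from \<open>s < t\<close> have "real_of_rat s < real_of_rat t" by (simp add: of_rat_less)
      ultimately show "A \<in> tie n i" unfolding tie_def by force
    qed
  qed
  also have "\<dots> \<in> sets borel"
    by (intro sets.countable_UN'' sets.Int borel_closed closed_matrices_with_minimizer_in closed_Collect_le continuous_intros continuous_coordinate) auto
  finally show ?thesis .
qed

lemma quad_form_change_diagonal:
  assumes i: "i < n"
  shows "quad_form n (A(i := (A i)(i := s))) x = quad_form n A x + (s - A i i) * (x i)\<^sup>2"
proof -
  have "quad_form n (A(i := (A i)(i := s))) x = (\<Sum>k<n. \<Sum>j<n. x k * A k j * x j + (if k = i then if j = i then (s - A i i) * (x i)\<^sup>2 else 0 else 0))"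
    unfolding quad_form_def by (intro sum.cong) (auto simp: algebra_simps power2_eq_square)
  also have "(\<Sum>k<n. \<Sum>j<n. (if k = i then if j = i then (s - A i i) * (x i)\<^sup>2 else 0 else 0)) = 
     (\<Sum>k<n. if k = i then (\<Sum>j<n. if j = i then (s - A i i) * (x i)\<^sup>2 else 0) else 0)"
    by (intro sum.cong) auto
  ultimately show ?thesis using i by (simp add: sum.distrib quad_form_def)
qed

text \<open>
  Raising the entry \<open>s\<close> penalizes the square of the \<open>i\<close>-th coordinate, so the \<open>i\<close>-th coordinates of
  minimizers weakly decrease in \<open>s\<close>. Hence the open intervals between the \<open>i\<close>-th coordinates of tied
  minimizers are disjoint for different \<open>s\<close>, and each contains a rational number.
\<close>

lemma countable_ties_in_diagonal_entry:
  assumes i: "i < n"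
  shows "countable {s. A(i := (A i)(i := s)) \<in> tie n i}"
proof -
  define B where "B s = A(i := (A i)(i := s))" for s
  have mono: "y i \<le> x i" if "s < t" "global_minimizer n (B s) x" "global_minimizer n (B t) y" for s t x y
  proof -
    have xy: "x \<in> std_simplex n" "y \<in> std_simplex n" using that by (auto simp: global_minimizer_def)
    have "quad_form n (B s) x \<le> quad_form n (B s) y" "quad_form n (B t) y \<le> quad_form n (B t) x"
      using that xy by (auto simp: global_minimizer_def)
    then have "(t - s) * ((y i)\<^sup>2) \<le> (t - s) * (x i)\<^sup>2"
      unfolding B_def quad_form_change_diagonal[OF i] by (simp add: algebra_simps)
    then have "(y i)\<^sup>2 \<le> (x i)\<^sup>2" using that by simp
    then show ?thesis using xy i by (auto simp: std_simplex_def intro: power2_le_imp_le)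
  qed
  define T where "T = {s. B s \<in> tie n i}"
  have "\<exists>r::rat. \<exists>x y. global_minimizer n (B s) x \<and> global_minimizer n (B s) y \<and> x i < of_rat r \<and> of_rat r < y i" if "s \<in> T" for s
  proof -
    from that obtain x y where xy: "global_minimizer n (B s) x" "global_minimizer n (B s) y" "x i < y i" by (auto simp: T_def tie_def)
    then show ?thesis using of_rat_dense[OF xy(3)] by blast
  qed
  then obtain r where r: "\<And>s. s \<in> T \<Longrightarrow> \<exists>x y. global_minimizer n (B s) x \<and> global_minimizer n (B s) y \<and> x i < real_of_rat (r s) \<and> real_of_rat (r s) < y i"
    by metis
  have "r s \<noteq> r t" if st: "s \<in> T" "t \<in> T" "s < t" for s t
  proof
    assume eq: "r s = r t"
    from r[OF st(1)] obtain x where "global_minimizer n (B s) x" "x i < real_of_rat (r s)" by blast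
    moreover from r[OF st(2)] obtain y where "global_minimizer n (B t) y" "real_of_rat (r t) < y i" by blast
    ultimately show False using mono[OF st(3)] eq by fastforce
  qed
  then have "inj_on r T" by (metis inj_onI linorder_neqE_linordered_idom)
  then have "countable T" by (rule countableI')
  then show ?thesis by (simp add: T_def B_def)
qed

lemma unique_minimizer_iff_no_tie:
  assumes "n \<ge> 1"
  shows "(\<exists>!x. global_minimizer n A x) \<longleftrightarrow> (\<forall>i<n. A \<notin> tie n i)"
proof
  assume "\<exists>!x. global_minimizer n A x"
  then show "\<forall>i<n. A \<notin> tie n i" by (fastforce simp: tie_def)
next
  assume *: "\<forall>i<n. A \<notin> tie n i"
  obtain x where x: "global_minimizer n A x" using global_minimizer_exists[OF assms] by blast
  show "\<exists>!x. global_minimizer n A x"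
  proof (rule ex1I[where a=x], rule x)
    fix y assume y: "global_minimizer n A y"
    show "y = x"
    proof
      fix i show "y i = x i"
      proof (cases "i < n")
        case True then show ?thesis using * x y unfolding tie_def by (metis (mono_tags, lifting) mem_Collect_eq linorder_neqE_linordered_idom)
      next
        case False then show ?thesis using x y by (simp add: global_minimizer_def std_simplex_def)
      qed
    qed
  qed
qed

lemma minimizer_support_size_eq:
  assumes "\<exists>!x. global_minimizer n A x" "global_minimizer n A x"
  shows "minimizer_support_size n A = card (supp n x)"
  using assms the1_equality[of "global_minimizer n A" x] by (simp add: minimizer_support_size_def supp_def)

text \<open>
  Without ties the support consists of those \<open>i\<close> for which no minimizer has a vanishing \<open>i\<close>-th
  coordinate; this describes the size without mentioning the minimizer.
\<close>

lemma borel_measurable_support_size: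
  assumes n: "n \<ge> 1"
  shows "(\<lambda>A. real (minimizer_support_size n A)) \<in> borel_measurable borel"
proof -
  define Z where "Z i = {A. \<exists>x\<in>{x. x i \<le> 0}. global_minimizer n A x}" for i
  have Z: "Z i \<in> sets borel" for i
    unfolding Z_def by (intro borel_closed closed_matrices_with_minimizer_in closed_Collect_le continuous_intros continuous_coordinate)
  have T: "(\<Union>i<n. tie n i) \<in> sets borel" using borel_tie by auto
  have "real (minimizer_support_size n A) = (if A \<in> (\<Union>i<n. tie n i) then 0 else (\<Sum>i<n. indicator (- Z i) A))" for A
  proof (cases "\<exists>!x. global_minimizer n A x")
    case True
    then obtain x where x: "global_minimizer n A x" by blast
    have "A \<in> - Z i \<longleftrightarrow> x i > 0" for i using True x by (auto simp: Z_def not_le)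
    then have "(\<Sum>i<n. indicator (- Z i) A) = (\<Sum>i<n. if x i > 0 then 1 else 0)"
      by (intro sum.cong) (auto simp: indicator_def)
    also have "\<dots> = real (card (supp n x))"
      by (simp add: sum.If_cases supp_def) (simp add: Int_def conj_commute lessThan_def)
    finally show ?thesis using minimizer_support_size_eq[OF True x] True unique_minimizer_iff_no_tie[OF n, of A] by auto
  next
    case False
    then show ?thesis using unique_minimizer_iff_no_tie[OF n, of A] by (auto simp: minimizer_support_size_def)
  qed
  moreover have "(\<lambda>A. if A \<in> (\<Union>i<n. tie n i) then 0 else (\<Sum>i<n. indicator (- Z i) A :: real)) \<in> borel_measurable borel"
    using Z T by (intro measurable_If_set borel_measurable_sum borel_measurable_indicator) auto
  ultimately show ?thesis by simp
qed

lemma global_minimizer_cong: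
  assumes "\<And>i j. i < n \<Longrightarrow> j < n \<Longrightarrow> A i j = B i j"
  shows "global_minimizer n A x \<longleftrightarrow> global_minimizer n B x"
proof -
  have "quad_form n A = quad_form n B" using assms by (auto simp: quad_form_def fun_eq_iff)
  then show ?thesis by (simp add: global_minimizer_def)
qed

lemma minimizer_support_size_cong:
  assumes "\<And>i j. i < n \<Longrightarrow> j < n \<Longrightarrow> A i j = B i j"
  shows "minimizer_support_size n A = minimizer_support_size n B"
proof -
  have "global_minimizer n A = global_minimizer n B" using global_minimizer_cong[of n A B, OF assms] by blast
  then show ?thesis by (simp add: minimizer_support_size_def)
qed

section \<open>The Gaussian tail and its Mills bounds\<close>

definition gauss_tail :: "real \<Rightarrow> real" where
  "gauss_tail t = measure std_normal_distribution {t<..}"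

interpretation std_normal: real_distribution std_normal_distribution
  by (rule real_dist_normal_dist)

lemma emeasure_std_normal_singleton: "emeasure std_normal_distribution {t} = 0"
proof -
  have "emeasure std_normal_distribution {t} = (\<integral>\<^sup>+x. ennreal (std_normal_density x) * indicator {t} x \<partial>lborel)"
    by (simp add: emeasure_density)
  also have "\<dots> = (\<integral>\<^sup>+(x::real). 0 \<partial>lborel)"
  proof (rule nn_integral_cong_AE)
    show "AE x in lborel. ennreal (std_normal_density x) * indicator {t} x = 0"
      using AE_lborel_singleton[of t] by (rule eventually_mono) auto
  qed
  finally show ?thesis by simp
qed

lemma gauss_tail_eq_cdf: "gauss_tail t = 1 - cdf std_normal_distribution t"
proof -
  have "{t<..} = space std_normal_distribution - {..t}" by auto
  then show ?thesis unfolding gauss_tail_def cdf_def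
    by (metis std_normal.prob_compl std_normal.events_eq_borel atMost_borel)
qed

lemma gauss_tail_at_top: "(gauss_tail \<longlongrightarrow> 0) at_top"
proof -
  have "((\<lambda>t. 1 - cdf std_normal_distribution t) \<longlongrightarrow> 1 - 1) at_top"
    by (intro tendsto_diff tendsto_const std_normal.cdf_lim_at_top_prob)
  then show ?thesis by (simp add: gauss_tail_eq_cdf[abs_def])
qed

lemma gauss_tail_nonneg [simp]: "0 \<le> gauss_tail t" by (simp add: gauss_tail_def)
lemma gauss_tail_le_1 [simp]: "gauss_tail t \<le> 1" by (simp add: gauss_tail_def)

lemma gauss_tail_antimono: "s \<le> t \<Longrightarrow> gauss_tail t \<le> gauss_tail s"
  unfolding gauss_tail_def by (intro std_normal.finite_measure_mono) auto

lemma DERIV_std_normal_density: "(std_normal_density has_real_derivative - x * std_normal_density x) (at x)"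
  unfolding std_normal_density_def[abs_def]
  by (auto intro!: derivative_eq_intros simp: field_simps power2_eq_square)

text \<open>
  The density has some antiderivative, and its increments are the probabilities of intervals, so
  the tail agrees with its negative up to a constant.
\<close>

lemma DERIV_gauss_tail: "(gauss_tail has_real_derivative - std_normal_density t) (at t)"
proof -
  have "\<exists>F. \<forall>x::real. - \<infinity> < ereal x \<longrightarrow> ereal x < \<infinity> \<longrightarrow> (F has_vector_derivative std_normal_density x) (at x)"
    by (rule einterval_antiderivative) (auto intro: DERIV_isCont[OF DERIV_std_normal_density])
  then obtain F where F: "\<And>x. (F has_real_derivative std_normal_density x) (at x)"
    by (auto simp: has_real_derivative_iff_has_vector_derivative)
  have diff: "gauss_tail a - gauss_tail b = F b - F a" if "a \<le> b" for a b
  proof -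
    have "gauss_tail a = measure std_normal_distribution ({a<..b} \<union> {b<..})"
      using that by (simp add: gauss_tail_def ivl_disj_un)
    also have "\<dots> = measure std_normal_distribution {a<..b} + gauss_tail b"
      unfolding gauss_tail_def by (rule std_normal.finite_measure_Union) auto
    finally have 1: "gauss_tail a - gauss_tail b = measure std_normal_distribution {a<..b}" by simp
    have "emeasure std_normal_distribution {a<..b} = emeasure std_normal_distribution {a..b}"
    proof (rule emeasure_eq_AE)
      have "AE x in std_normal_distribution. x \<noteq> a"
        by (rule AE_I[of _ _ "{a}"]) (auto simp: emeasure_std_normal_singleton)
      then show "AE x in std_normal_distribution. (x \<in> {a<..b}) = (x \<in> {a..b})" by (auto elim!: eventually_mono)
    qed auto
    also have "\<dots> = (\<integral>\<^sup>+x. ennreal (std_normal_density x) * indicator {a..b} x \<partial>lborel)"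
      by (simp add: emeasure_density)
    also have "\<dots> = ennreal (F b - F a)"
      by (rule nn_integral_FTC_Icc) (use that in \<open>auto intro: F has_field_derivative_at_within\<close>)
    finally have "emeasure std_normal_distribution {a<..b} = ennreal (F b - F a)" .
    moreover have "F a \<le> F b" by (rule DERIV_nonneg_imp_nondecreasing[OF that]) (use F in \<open>auto intro!: exI\<close>)
    ultimately show ?thesis unfolding 1 by (simp add: measure_def)
  qed
  have "gauss_tail t = gauss_tail 0 + F 0 - F t" for t
    using diff[of 0 t] diff[of t 0] by (cases "0 \<le> t") auto
  then have "gauss_tail = (\<lambda>t. gauss_tail 0 + F 0 - F t)" by blast
  moreover have "((\<lambda>t. gauss_tail 0 + F 0 - F t) has_real_derivative - std_normal_density t) (at t)"
    using F by (auto intro!: derivative_eq_intros)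
  ultimately show ?thesis by simp
qed

lemma gauss_tail_pos: "0 < gauss_tail t"
proof (rule ccontr)
  assume "\<not> ?thesis"
  then have *: "gauss_tail t \<le> 0" by simp
  have "gauss_tail (t + 1) < gauss_tail t"
    by (rule DERIV_neg_imp_decreasing) (auto intro!: exI DERIV_gauss_tail normal_density_pos)
  then show False using * gauss_tail_nonneg[of "t + 1"] by linarith
qed

text \<open>
  Both Mills bounds follow from this: the differences of their sides vanish at infinity and have
  simple derivatives.
\<close>

lemma nonneg_if_decreasing_to_zero:
  fixes G :: "real \<Rightarrow> real"
  assumes "\<And>x. t \<le> x \<Longrightarrow> \<exists>y. DERIV G x :> y \<and> y \<le> 0" "(G \<longlongrightarrow> 0) at_top"
  shows "0 \<le> G t"
proof (rule tendsto_upperbound[OF assms(2)])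
  show "\<forall>\<^sub>F x in at_top. G x \<le> G t"
    using eventually_ge_at_top[of t]
    by (rule eventually_mono) (rule DERIV_nonpos_imp_nonincreasing, use assms in auto)
qed simp

lemma gauss_tail_le_Mills:
  assumes "0 < t" shows "gauss_tail t \<le> std_normal_density t / t"
proof -
  have "0 \<le> (\<lambda>t. std_normal_density t / t - gauss_tail t) t"
  proof (rule nonneg_if_decreasing_to_zero[where G = "\<lambda>t. std_normal_density t / t - gauss_tail t"])
    fix x assume "t \<le> x" then have x: "0 < x" using assms by simp
    have "((\<lambda>t. std_normal_density t / t - gauss_tail t) has_real_derivative
      ((- x * std_normal_density x) * x - std_normal_density x * 1) / (x * x) - (- std_normal_density x)) (at x)"
      using x by (intro DERIV_diff DERIV_divide DERIV_std_normal_density DERIV_gauss_tail DERIV_ident) auto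
    moreover have "((- x * std_normal_density x) * x - std_normal_density x * 1) / (x * x) - (- std_normal_density x)
       = - std_normal_density x / (x * x)"
      using x by (simp add: field_simps)
    moreover have "- std_normal_density x / (x * x) \<le> 0" by (simp add: divide_nonpos_nonneg)
    ultimately have "((\<lambda>t. std_normal_density t / t - gauss_tail t) has_real_derivative - std_normal_density x / (x * x)) (at x) \<and> - std_normal_density x / (x * x) \<le> 0" by simp
    then show "\<exists>y. ((\<lambda>t. std_normal_density t / t - gauss_tail t) has_real_derivative y) (at x) \<and> y \<le> 0" by (rule exI)
  next
    have "((\<lambda>t. std_normal_density t / t) \<longlongrightarrow> 0) at_top"
      unfolding std_normal_density_def by real_asymp
    from tendsto_diff[OF this gauss_tail_at_top] show "((\<lambda>t. std_normal_density t / t - gauss_tail t) \<longlongrightarrow> 0) at_top" by simp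
  qed
  then show ?thesis by simp
qed

lemma gauss_tail_ge_Mills:
  "std_normal_density t * (t / (1 + t\<^sup>2)) \<le> gauss_tail t"
proof -
  have "0 \<le> (\<lambda>t. gauss_tail t - std_normal_density t * (t / (1 + t\<^sup>2))) t"
  proof (rule nonneg_if_decreasing_to_zero[where G = "\<lambda>t. gauss_tail t - std_normal_density t * (t / (1 + t\<^sup>2))"])
    fix x :: real
    have p: "1 + x\<^sup>2 > 0" by (simp add: add_pos_nonneg)
    define r where "r = std_normal_density x"
    have "((\<lambda>t. gauss_tail t - std_normal_density t * (t / (1 + t\<^sup>2))) has_real_derivative
      (- std_normal_density x - (- x * std_normal_density x * (x / (1 + x\<^sup>2)) + (1 * (1 + x\<^sup>2) - x * (0 + 2 * x)) / ((1 + x\<^sup>2) * (1 + x\<^sup>2)) * std_normal_density x))) (at x)"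
      using p by (intro DERIV_diff DERIV_mult DERIV_divide DERIV_std_normal_density DERIV_gauss_tail DERIV_ident DERIV_add DERIV_const)
        (auto intro!: derivative_eq_intros)
    then have "((\<lambda>t. gauss_tail t - std_normal_density t * (t / (1 + t\<^sup>2))) has_real_derivative
      (- r - (- x * r * (x / (1 + x\<^sup>2)) + (1 * (1 + x\<^sup>2) - x * (0 + 2 * x)) / ((1 + x\<^sup>2) * (1 + x\<^sup>2)) * r))) (at x)"
      unfolding r_def .
    moreover have "- r - (- x * r * (x / (1 + x\<^sup>2)) + (1 * (1 + x\<^sup>2) - x * (0 + 2 * x)) / ((1 + x\<^sup>2) * (1 + x\<^sup>2)) * r)
        = - 2 * r / ((1 + x\<^sup>2) * (1 + x\<^sup>2))"
      using p by (simp add: divide_simps power2_eq_square) (simp add: algebra_simps)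
    moreover have "- 2 * r / ((1 + x\<^sup>2) * (1 + x\<^sup>2)) \<le> 0" using p by (simp add: divide_nonpos_nonneg r_def)
    ultimately have "((\<lambda>t. gauss_tail t - std_normal_density t * (t / (1 + t\<^sup>2))) has_real_derivative - 2 * r / ((1 + x\<^sup>2) * (1 + x\<^sup>2))) (at x)
      \<and> - 2 * r / ((1 + x\<^sup>2) * (1 + x\<^sup>2)) \<le> 0" by simp
    then show "\<exists>y. ((\<lambda>t. gauss_tail t - std_normal_density t * (t / (1 + t\<^sup>2))) has_real_derivative y) (at x) \<and> y \<le> 0"
      by (rule exI)
  next
    have "((\<lambda>t. std_normal_density t * (t / (1 + t\<^sup>2))) \<longlongrightarrow> 0) at_top"
      unfolding std_normal_density_def by real_asymp
    from tendsto_diff[OF gauss_tail_at_top this] show "((\<lambda>t. gauss_tail t - std_normal_density t * (t / (1 + t\<^sup>2))) \<longlongrightarrow> 0) at_top" by simp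
  qed
  then show ?thesis by simp
qed

lemma gauss_tail_le_exp:
  assumes "1 \<le> t" shows "gauss_tail t \<le> exp (- t\<^sup>2 / 2)"
proof -
  have "1 \<le> sqrt (2 * pi)" using pi_gt3 by (intro real_le_rsqrt) simp
  then have "1 * 1 \<le> sqrt (2 * pi) * t" using assms by (intro mult_mono) auto
  then have "std_normal_density t / t \<le> exp (- t\<^sup>2 / 2)"
    using assms by (simp add: std_normal_density_def divide_le_eq)
  then show ?thesis using gauss_tail_le_Mills[of t] assms by simp
qed

text \<open>
  The exponential factors of the two sides agree, because \<open>exp (- (sqrt 2 t)\<^sup>2 / 2)\<close> is the square of
  \<open>exp (- t\<^sup>2 / 2)\<close>; the Mills bounds provide the remaining factor \<open>sqrt pi * t\<close>, up to a relative
  error of order \<open>1 / t\<^sup>2\<close>.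
\<close>

lemma gauss_tail_sqrt2_upper:
  assumes "1 \<le> t"
  shows "gauss_tail (sqrt 2 * t) \<le> sqrt pi * t * (1 + 1 / t\<^sup>2)\<^sup>2 * (gauss_tail t)\<^sup>2"
proof -
  define E where "E = exp (- t\<^sup>2)"
  have E: "(exp (- t\<^sup>2 / 2))\<^sup>2 = E" unfolding E_def by (simp flip: exp_double)
  have t: "0 < t" using assms by simp
  have "gauss_tail (sqrt 2 * t) \<le> E / (2 * sqrt pi * t)"
    using gauss_tail_le_Mills[of "sqrt 2 * t"] t
    by (simp add: std_normal_density_def power_mult_distrib E_def real_sqrt_mult field_simps)
  also have "E / (2 * sqrt pi * t) = sqrt pi * t * (1 + 1 / t\<^sup>2)\<^sup>2 * (std_normal_density t * (t / (1 + t\<^sup>2)))\<^sup>2"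
  proof -
    have a: "(1 + 1 / t\<^sup>2)\<^sup>2 * (t / (1 + t\<^sup>2))\<^sup>2 = 1 / t\<^sup>2"
    proof -
      have "(1 + 1 / t\<^sup>2) * (t / (1 + t\<^sup>2)) = 1 / t"
        using t by (simp add: divide_simps add_pos_nonneg power2_eq_square) (simp add: add_nonneg_eq_0_iff)
      then show ?thesis by (metis power_mult_distrib power_one_over)
    qed
    have b: "(std_normal_density t)\<^sup>2 = E / (2 * pi)"
      unfolding std_normal_density_def power_mult_distrib E by (simp add: power_divide)
    have "sqrt pi * t * (1 + 1 / t\<^sup>2)\<^sup>2 * (std_normal_density t * (t / (1 + t\<^sup>2)))\<^sup>2
      = sqrt pi * t * (std_normal_density t)\<^sup>2 * ((1 + 1 / t\<^sup>2)\<^sup>2 * (t / (1 + t\<^sup>2))\<^sup>2)"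
      by (simp only: power_mult_distrib mult_ac)
    also have "\<dots> = E * (sqrt pi / pi) / (2 * t)" unfolding a b using t by (simp add: power2_eq_square mult_ac)
    also have "sqrt pi / pi = 1 / sqrt pi" by (simp add: field_simps)
    finally show ?thesis by simp
  qed
  also have "\<dots> \<le> sqrt pi * t * (1 + 1 / t\<^sup>2)\<^sup>2 * (gauss_tail t)\<^sup>2"
    using t gauss_tail_ge_Mills[of t] by (intro mult_left_mono power_mono) auto
  finally show ?thesis .
qed

lemma gauss_tail_sqrt2_lower:
  assumes "1 \<le> t"
  shows "sqrt pi * t * (2 * t\<^sup>2 / (1 + 2 * t\<^sup>2)) * (gauss_tail t)\<^sup>2 \<le> gauss_tail (sqrt 2 * t)"
proof -
  define E where "E = exp (- t\<^sup>2)"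
  have E: "(exp (- t\<^sup>2 / 2))\<^sup>2 = E" unfolding E_def by (simp flip: exp_double)
  have t: "0 < t" using assms by simp
  have "sqrt pi * t * (2 * t\<^sup>2 / (1 + 2 * t\<^sup>2)) * (gauss_tail t)\<^sup>2 \<le>
      sqrt pi * t * (2 * t\<^sup>2 / (1 + 2 * t\<^sup>2)) * (std_normal_density t / t)\<^sup>2"
    using t gauss_tail_le_Mills[of t] by (intro mult_left_mono power_mono) auto
  also have "(std_normal_density t / t)\<^sup>2 = E / (2 * pi) / t\<^sup>2"
    unfolding std_normal_density_def power_mult_distrib power_divide E by simp
  also have "sqrt pi * t * (2 * t\<^sup>2 / (1 + 2 * t\<^sup>2)) * (E / (2 * pi) / t\<^sup>2) = E * (sqrt pi / pi) * t / (1 + 2 * t\<^sup>2)"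
    using t by (simp add: mult_ac)
  also have "sqrt pi / pi = 1 / sqrt pi" by (simp add: field_simps)
  also have "E * (1 / sqrt pi) * t / (1 + 2 * t\<^sup>2) = std_normal_density (sqrt 2 * t) * ((sqrt 2 * t) / (1 + (sqrt 2 * t)\<^sup>2))"
    by (simp add: std_normal_density_def power_mult_distrib E_def real_sqrt_mult)
  also have "\<dots> \<le> gauss_tail (sqrt 2 * t)" by (rule gauss_tail_ge_Mills)
  finally show ?thesis .
qed

lemma exp_le_gauss_tail:
  assumes "1 \<le> t"
  shows "exp (- t\<^sup>2 / 2) \<le> 2 * sqrt (2 * pi) * t * gauss_tail t"
proof -
  have t: "1 \<le> t * t" using mult_mono[OF assms assms] assms by simp
  then have "1 / (2 * t) \<le> t / (1 + t\<^sup>2)" using assms by (simp add: field_simps power2_eq_square)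
  then have "std_normal_density t * (1 / (2 * t)) \<le> std_normal_density t * (t / (1 + t\<^sup>2))"
    by (intro mult_left_mono) auto
  also have "\<dots> \<le> gauss_tail t" by (rule gauss_tail_ge_Mills)
  finally show ?thesis using assms by (simp add: std_normal_density_def field_simps)
qed

lemma has_integral_Beta_nat:
  "((\<lambda>v::real. v ^ k * (1 - v) ^ m) has_integral fact k * fact m / fact (k + m + 1)) {0..1}"
proof -
  have "((\<lambda>t. t powr (real (Suc k) - 1) * (1 - t) powr (real (Suc m) - 1)) has_integral Beta (real (Suc k)) (real (Suc m))) {0..1}"
    by (rule has_integral_Beta_real) auto
  moreover have "Beta (real (Suc k)) (real (Suc m)) = fact k * fact m / fact (k + m + 1)"
    using Gamma_fact[of k, where 'a = real] Gamma_fact[of m, where 'a = real] Gamma_fact[of "k + m + 1", where 'a = real]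
    by (simp add: Beta_def add_ac)
  ultimately have *: "((\<lambda>t. t powr (real (Suc k) - 1) * (1 - t) powr (real (Suc m) - 1)) has_integral fact k * fact m / fact (k + m + 1)) {0..1}"
    by simp
  show ?thesis
    by (rule has_integral_spike_finite[where S = "{0,1}", OF _ _ *]) (auto simp: powr_realpow)
qed

definition incomplete_Beta :: "nat \<Rightarrow> nat \<Rightarrow> real \<Rightarrow> real" where
  "incomplete_Beta k m u = integral {0..u} (\<lambda>v. v ^ k * (1 - v) ^ m)"

lemma incomplete_Beta_1: "incomplete_Beta k m 1 = fact k * fact m / fact (k + m + 1)"
  unfolding incomplete_Beta_def using has_integral_Beta_nat by (rule integral_unique)

lemma incomplete_Beta_split:
  assumes "0 \<le> u" "u \<le> 1"
  shows "incomplete_Beta k m u + integral {u..1} (\<lambda>v. v ^ k * (1 - v) ^ m) = incomplete_Beta k m 1"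
  unfolding incomplete_Beta_def
  by (rule Henstock_Kurzweil_Integration.integral_combine) (use assms in \<open>auto intro!: integrable_continuous_interval continuous_intros\<close>)

lemma incomplete_Beta_le:
  assumes "0 \<le> u" "u \<le> 1"
  shows "incomplete_Beta k m u \<le> fact k * fact m / fact (k + m + 1)"
proof -
  have "0 \<le> integral {u..1} (\<lambda>v. v ^ k * (1 - v) ^ m)"
    using assms by (intro Henstock_Kurzweil_Integration.integral_nonneg integrable_continuous_interval continuous_intros) auto
  then show ?thesis using incomplete_Beta_split[OF assms, of k m] incomplete_Beta_1[of k m] by linarith
qed

lemma incomplete_Beta_ge:
  assumes "0 \<le> u" "u \<le> 1"
  shows "fact k * fact m / fact (k + m + 1) - (1 - u) ^ m \<le> incomplete_Beta k m u"
proof -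
  have "integral {u..1} (\<lambda>v. v ^ k * (1 - v) ^ m) \<le> integral {u..1} (\<lambda>v. (1 - u) ^ m)"
  proof (intro integral_le integrable_continuous_interval continuous_intros)
    fix v assume v: "v \<in> {u..1}"
    have "v ^ k * (1 - v) ^ m \<le> 1 * (1 - u) ^ m"
      using v assms by (intro mult_mono power_mono power_le_one) auto
    then show "v ^ k * (1 - v) ^ m \<le> (1 - u) ^ m" by simp
  qed
  also have "\<dots> \<le> (1 - u) ^ m" using assms by (simp add: mult_left_le_one_le)
  finally show ?thesis using incomplete_Beta_split[OF assms, of k m] incomplete_Beta_1[of k m] by linarith
qed

text \<open>
  This is the substitution \<open>u = gauss_tail t\<close>, carried out with the explicit antiderivative
  \<open>- incomplete_Beta k m (gauss_tail t)\<close>.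
\<close>

lemma nn_integral_gauss_tail_Beta:
  "(\<integral>\<^sup>+t\<in>{a..}. ennreal (std_normal_density t * (gauss_tail t ^ k * (1 - gauss_tail t) ^ m)) \<partial>lborel)
    = ennreal (incomplete_Beta k m (gauss_tail a))"
proof -
  define p where "p v = v ^ k * (1 - v) ^ m" for v :: real
  define u where "u = gauss_tail (a - 1)"
  have gt_less: "gauss_tail t < u" if "a \<le> t" for t
    unfolding u_def
    by (rule DERIV_neg_imp_decreasing) (use that in \<open>auto intro!: exI DERIV_gauss_tail normal_density_pos\<close>)
  have B: "(incomplete_Beta k m has_real_derivative p v) (at v)" if "0 < v" "v < u" for v
  proof -
    have "(incomplete_Beta k m has_real_derivative p v) (at v within {0..u})"
      unfolding incomplete_Beta_def[abs_def] p_def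
      by (rule integral_has_real_derivative) (use that in \<open>auto intro!: continuous_intros\<close>)
    moreover have "at v within {0..u} = at v" by (rule at_within_interior) (use that in auto)
    ultimately show ?thesis by simp
  qed
  have meas: "gauss_tail \<in> borel_measurable borel"
    by (intro borel_measurable_continuous_onI continuous_at_imp_continuous_on ballI DERIV_isCont[OF DERIV_gauss_tail])
  have "(\<integral>\<^sup>+t. ennreal (std_normal_density t * p (gauss_tail t)) * indicator {a..} t \<partial>lborel)
     = ennreal (0 - (- incomplete_Beta k m (gauss_tail a)))"
  proof (rule nn_integral_FTC_atLeast)
    show "(\<lambda>t. std_normal_density t * p (gauss_tail t)) \<in> borel_measurable borel"
      unfolding p_def using meas by measurable
    fix t assume t: "a \<le> t"
    have "((\<lambda>x. - incomplete_Beta k m (gauss_tail x)) has_real_derivative - (p (gauss_tail t) * (- std_normal_density t))) (at t)"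
      by (intro DERIV_minus DERIV_chain2[OF B] DERIV_gauss_tail gauss_tail_pos gt_less t)
    then show "((\<lambda>x. - incomplete_Beta k m (gauss_tail x)) has_real_derivative std_normal_density t * p (gauss_tail t)) (at t)"
      by (simp add: mult.commute)
    show "0 \<le> std_normal_density t * p (gauss_tail t)" by (auto simp: p_def intro!: mult_nonneg_nonneg)
  next
    show "((\<lambda>x. - incomplete_Beta k m (gauss_tail x)) \<longlongrightarrow> 0) at_top"
    proof (rule Lim_null_comparison[OF _ gauss_tail_at_top], rule always_eventually, rule allI)
      fix x
      have "\<bar>incomplete_Beta k m (gauss_tail x)\<bar> \<le> integral {0..gauss_tail x} (\<lambda>v. 1)"
        unfolding incomplete_Beta_def real_norm_def[symmetric]
      proof (rule integral_norm_bound_integral)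
        fix v assume v: "v \<in> {0..gauss_tail x}"
        then have "v \<le> 1" using order_trans[OF _ gauss_tail_le_1, of v x] by simp
        then show "norm (v ^ k * (1 - v) ^ m) \<le> 1"
          using v by (auto simp: abs_mult intro!: mult_le_one power_le_one)
      qed (auto intro!: integrable_continuous_interval continuous_intros)
      then show "norm (- incomplete_Beta k m (gauss_tail x)) \<le> gauss_tail x" by simp
    qed
  qed
  then show ?thesis by (simp add: p_def)
qed

text \<open>
  Diagonal maxima below \<open>t\<close> are negligible once \<open>k gauss_tail t\<close> is large; the Mills bound makes this
  explicit.
\<close>

lemma gauss_tail_compl_power_le:
  "(1 - gauss_tail t) ^ k \<le> exp (- (real k * (exp (- t\<^sup>2 / 2) / sqrt (2 * pi) * (t / (1 + t\<^sup>2)))))"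
proof -
  have "(1 - gauss_tail t) ^ k \<le> exp (- gauss_tail t) ^ k"
    using exp_ge_add_one_self[of "- gauss_tail t"] by (intro power_mono) auto
  also have "\<dots> = exp (- (real k * gauss_tail t))" by (simp add: exp_of_nat_mult[symmetric])
  also have "\<dots> \<le> exp (- (real k * (std_normal_density t * (t / (1 + t\<^sup>2)))))"
  proof -
    have "real k * (std_normal_density t * (t / (1 + t\<^sup>2))) \<le> real k * gauss_tail t"
      by (intro mult_left_mono gauss_tail_ge_Mills) simp
    then show ?thesis by (simp only: exp_le_cancel_iff neg_le_iff_le)
  qed
  finally show ?thesis by (simp add: std_normal_density_def)
qed

lemma fact_3_fact_div:
  assumes "3 \<le> n"
  shows "fact 3 * fact (n - 3) / fact (3 + (n - 3) + 1) = 6 / ((real n + 1) * real n * (real n - 1) * (real n - 2))"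
proof -
  obtain m where n: "n = m + 3" using assms by (metis add.commute le_Suc_ex)
  have "fact (m + 4) = (real m + 4) * (real m + 3) * (real m + 2) * (real m + 1) * fact m"
    by (simp add: numeral_eq_Suc algebra_simps)
  then have e4: "fact (m + 4) = ((real m + 4) * (real m + 3) * (real m + 2) * (real m + 1)) * fact m" by simp
  have e1: "3 + ((m + 3) - 3) + 1 = m + 4" by simp
  have e2: "m + 3 - 3 = m" by simp
  have e3: "fact 3 = (6 :: real)" by (simp add: numeral_eq_Suc)
  have e5: "(real (m + 3) + 1) * real (m + 3) * (real (m + 3) - 1) * (real (m + 3) - 2) = (real m + 4) * (real m + 3) * (real m + 2) * (real m + 1)"
    by (simp add: add.commute)
  show ?thesis unfolding n e1 unfolding e2 e3 e4 e5 by simp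
qed

text \<open>
  The factor \<open>exp (- 3 / 2 * t\<^sup>2)\<close> is the size of the joint density of one diagonal and one
  off-diagonal entry at \<open>t\<close>. Written as a power of the tail, it can be integrated as a Beta integral.
\<close>

lemma exp_le_gauss_tail_cube:
  assumes "1 \<le> t"
  shows "exp (- 3 / 2 * t\<^sup>2) / t ^ 4 \<le> (2 * sqrt (2 * pi)) ^ 3 * gauss_tail t ^ 3 / t"
proof -
  have "exp (- 3 / 2 * t\<^sup>2) = exp (- t\<^sup>2 / 2) ^ 3"
    unfolding exp_of_nat_mult[symmetric] by simp
  also have "\<dots> \<le> (2 * sqrt (2 * pi) * t * gauss_tail t) ^ 3"
    using exp_le_gauss_tail[OF assms] by (rule power_mono) simp
  finally have "exp (- 3 / 2 * t\<^sup>2) / t ^ 4 \<le> (2 * sqrt (2 * pi) * t * gauss_tail t) ^ 3 / t ^ 4"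
    by (rule divide_right_mono) simp
  also have "\<dots> = (2 * sqrt (2 * pi)) ^ 3 * gauss_tail t ^ 3 / t"
    using assms by (simp only: power_mult_distrib) (simp add: power4_eq_xxxx power3_eq_cube)
  finally show ?thesis .
qed

lemma exp_le_inverse:
  fixes s :: real assumes "0 < s" shows "exp (- s) \<le> 1 / s"
proof -
  have "s \<le> exp s" using exp_ge_add_one_self[of s] by linarith
  then show ?thesis using assms by (simp add: exp_minus inverse_eq_divide frac_le)
qed

lemma sum_powers_from_3_le:
  fixes z :: real
  assumes "0 \<le> z" "z \<le> 1 / 2"
  shows "(\<Sum>k=3..n. z ^ k) \<le> 2 * z ^ 3"
proof -
  have "(\<Sum>k=3..n. z ^ k) \<le> (\<Sum>k\<in>(\<lambda>k. k + 3) ` {..<n}. z ^ k)"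
  proof (rule sum_mono2)
    show "{3..n} \<subseteq> (\<lambda>k. k + 3) ` {..<n}"
    proof
      fix k assume "k \<in> {3..n}"
      then have "k = (k - 3) + 3" "k - 3 < n" by auto
      then show "k \<in> (\<lambda>k. k + 3) ` {..<n}" by blast
    qed
  qed (use assms in auto)
  also have "\<dots> = z ^ 3 * (\<Sum>k<n. z ^ k)"
    by (subst sum.reindex) (auto simp: inj_on_def power_add sum_distrib_right mult.commute)
  also have "\<dots> \<le> z ^ 3 * 2"
  proof (intro mult_left_mono)
    have "(\<Sum>k<n. z ^ k) = (1 - z ^ n) / (1 - z)" using assms by (simp add: sum_gp_strict)
    also have "\<dots> \<le> 1 / (1 / 2)" using assms by (intro frac_le) auto
    finally show "(\<Sum>k<n. z ^ k) \<le> 2" by simp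
  qed (use assms in simp)
  finally show ?thesis by simp
qed

lemma nn_integral_shifted_exponential_1:
  assumes x: "0 < x"
  shows "(\<integral>\<^sup>+b\<in>{x..}. ennreal ((b - x) * exp (- (x * (b - x)))) \<partial>lborel) = ennreal (1 / x\<^sup>2)"
proof -
  have "(\<integral>\<^sup>+b\<in>{x..}. ennreal ((b - x) * exp (- (x * (b - x)))) \<partial>lborel)
     = ennreal (0 - (\<lambda>b. - ((b - x) / x + 1 / x\<^sup>2) * exp (- (x * (b - x)))) x)"
  proof (rule nn_integral_FTC_atLeast[where F = "\<lambda>b. - ((b - x) / x + 1 / x\<^sup>2) * exp (- (x * (b - x)))"])
    fix b assume "x \<le> b"
    show "((\<lambda>b. - ((b - x) / x + 1 / x\<^sup>2) * exp (- (x * (b - x)))) has_real_derivative (b - x) * exp (- (x * (b - x)))) (at b)"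
      using x by (auto intro!: derivative_eq_intros simp: field_simps power2_eq_square)
  next
    show "((\<lambda>b. - ((b - x) / x + 1 / x\<^sup>2) * exp (- (x * (b - x)))) \<longlongrightarrow> 0) at_top"
      using x by real_asymp
  qed auto
  then show ?thesis by simp
qed

lemma nn_integral_shifted_exponential_2:
  assumes x: "0 < x"
  shows "(\<integral>\<^sup>+b\<in>{x..}. ennreal ((b - x)\<^sup>2 * exp (- (x * (b - x)))) \<partial>lborel) = ennreal (2 / x ^ 3)"
proof -
  have "(\<integral>\<^sup>+b\<in>{x..}. ennreal ((b - x)\<^sup>2 * exp (- (x * (b - x)))) \<partial>lborel)
     = ennreal (0 - (\<lambda>b. - ((b - x)\<^sup>2 / x + 2 * (b - x) / x\<^sup>2 + 2 / x ^ 3) * exp (- (x * (b - x)))) x)"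
  proof (rule nn_integral_FTC_atLeast[where F = "\<lambda>b. - ((b - x)\<^sup>2 / x + 2 * (b - x) / x\<^sup>2 + 2 / x ^ 3) * exp (- (x * (b - x)))"])
    fix b assume "x \<le> b"
    show "((\<lambda>b. - ((b - x)\<^sup>2 / x + 2 * (b - x) / x\<^sup>2 + 2 / x ^ 3) * exp (- (x * (b - x)))) has_real_derivative (b - x)\<^sup>2 * exp (- (x * (b - x)))) (at b)"
      using x by (auto intro!: derivative_eq_intros simp: field_simps power2_eq_square power3_eq_cube)
  next
    show "((\<lambda>b. - ((b - x)\<^sup>2 / x + 2 * (b - x) / x\<^sup>2 + 2 / x ^ 3) * exp (- (x * (b - x)))) \<longlongrightarrow> 0) at_top"
      using x by real_asymp
  qed auto
  then show ?thesis by simp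
qed

section \<open>Integrals over the position of the largest diagonal entry\<close>

text \<open>
  A Bonferroni type bound: if \<open>m v\<close> is small, then the probability that one of \<open>m\<close> independent
  events of probability \<open>v\<close> occurs is not much smaller than \<open>m v\<close>.
\<close>

lemma one_minus_power_ge:
  fixes v :: real
  assumes "0 \<le> v" "v \<le> 1"
  shows "real m * v * (1 - real m * v) \<le> 1 - (1 - v) ^ m"
proof -
  have "(1 - v) ^ m \<le> exp (- v) ^ m"
    using assms exp_ge_add_one_self[of "- v"] by (intro power_mono) auto
  also have "\<dots> = exp (- (real m * v))" by (simp add: exp_of_nat_mult[symmetric])
  also have "\<dots> \<le> 1 / (1 + real m * v)"
  proof -
    have "1 + real m * v \<le> exp (real m * v)" by (rule exp_ge_add_one_self)
    moreover have "0 < 1 + real m * v" using assms by (simp add: add_pos_nonneg)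
    ultimately show ?thesis by (simp add: exp_minus inverse_eq_divide frac_le)
  qed
  also have "\<dots> \<le> 1 - real m * v * (1 - real m * v)"
  proof -
    define w where "w = real m * v"
    have w: "0 \<le> w" using assms by (simp add: w_def)
    then have "1 \<le> (1 - w * (1 - w)) * (1 + w)" by (simp add: algebra_simps)
    then show ?thesis using w unfolding w_def[symmetric] by (simp add: divide_le_eq)
  qed
  finally show ?thesis by simp
qed

lemma fact_2_fact_div:
  "fact 2 * fact m / fact (2 + m + 1) = (2 :: real) / ((real m + 1) * (real m + 2) * (real m + 3))"
proof -
  have "fact (2 + m + 1) = (real m + 1) * (real m + 2) * (real m + 3) * fact m"
    by (simp add: numeral_eq_Suc algebra_simps)
  then show ?thesis by simp
qed

lemma continuous_gauss_tail: "continuous_on UNIV gauss_tail"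
  by (intro continuous_at_imp_continuous_on ballI DERIV_isCont[OF DERIV_gauss_tail])

lemma borel_measurable_gauss_tail [measurable]: "gauss_tail \<in> borel_measurable borel"
  by (rule borel_measurable_continuous_onI[OF continuous_gauss_tail])

lemma incomplete_Beta_0_0: "0 \<le> u \<Longrightarrow> incomplete_Beta 0 0 u = u"
  by (simp add: incomplete_Beta_def)

lemma nn_integral_gauss_tail:
  "(\<integral>\<^sup>+t\<in>{a..}. ennreal (std_normal_density t) \<partial>lborel) = ennreal (gauss_tail a)"
  using nn_integral_gauss_tail_Beta[of 0 0 a] by (simp add: incomplete_Beta_0_0)

text \<open>
  For \<open>t\<close> up to \<open>t1\<close> the factor \<open>t\<close> in the bound for \<open>gauss_tail (sqrt 2 * t)\<close> is replaced by \<open>t1\<close>, which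
  leaves a Beta integral. Beyond \<open>t1\<close> the density and the off-diagonal tail alone are
  small enough.
\<close>

lemma nn_integral_argmax_below_row_le:
  assumes t: "1 \<le> t0" "t0 \<le> t1"
  shows "(\<integral>\<^sup>+t\<in>{t0..}. ennreal (std_normal_density t * ((1 - gauss_tail t) ^ m * gauss_tail (sqrt 2 * t))) \<partial>lborel)
    \<le> ennreal (sqrt pi * t1 * (1 + 1 / t0\<^sup>2)\<^sup>2 * (2 / ((real m + 1) * (real m + 2) * (real m + 3))) + exp (- 3 / 2 * t1\<^sup>2))"
proof -
  define c where "c = sqrt pi * t1 * (1 + 1 / t0\<^sup>2)\<^sup>2"
  define d where "d = exp (- t1\<^sup>2)"
  define f where "f t = std_normal_density t * (gauss_tail t ^ 2 * (1 - gauss_tail t) ^ m)" for t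
  have c: "0 \<le> c" using t by (simp add: c_def)
  have f: "0 \<le> f t" for t by (auto simp: f_def intro!: mult_nonneg_nonneg)
  have "(\<integral>\<^sup>+t\<in>{t0..}. ennreal (std_normal_density t * ((1 - gauss_tail t) ^ m * gauss_tail (sqrt 2 * t))) \<partial>lborel)
    \<le> (\<integral>\<^sup>+t. ennreal c * (ennreal (f t) * indicator {t0..} t) + ennreal d * (ennreal (std_normal_density t) * indicator {t1..} t) \<partial>lborel)"
  proof (rule nn_integral_mono)
    fix t :: real
    consider "t < t0" | "t0 \<le> t" "t \<le> t1" | "t1 < t" by linarith
    then show "ennreal (std_normal_density t * ((1 - gauss_tail t) ^ m * gauss_tail (sqrt 2 * t))) * indicator {t0..} t
      \<le> ennreal c * (ennreal (f t) * indicator {t0..} t) + ennreal d * (ennreal (std_normal_density t) * indicator {t1..} t)"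
    proof cases
      case 1 then show ?thesis by simp
    next
      case 2
      have "1 / t\<^sup>2 \<le> 1 / t0\<^sup>2" using 2 t by (intro divide_left_mono power_mono mult_pos_pos) auto
      then have "sqrt pi * t * (1 + 1 / t\<^sup>2)\<^sup>2 \<le> c"
        unfolding c_def using 2 t by (intro mult_mono power_mono) (auto intro!: add_nonneg_nonneg)
      then have "gauss_tail (sqrt 2 * t) \<le> c * (gauss_tail t)\<^sup>2"
        using gauss_tail_sqrt2_upper[of t] 2 t by (meson mult_right_mono order_trans zero_le_power2)
      then have "std_normal_density t * ((1 - gauss_tail t) ^ m * gauss_tail (sqrt 2 * t)) \<le>
        std_normal_density t * ((1 - gauss_tail t) ^ m * (c * (gauss_tail t)\<^sup>2))"
        by (intro mult_left_mono) auto
      also have "\<dots> = c * f t" by (simp add: f_def)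
      finally have "ennreal (std_normal_density t * ((1 - gauss_tail t) ^ m * gauss_tail (sqrt 2 * t))) \<le> ennreal c * ennreal (f t)"
        using c f by (simp add: ennreal_mult[symmetric] ennreal_leI)
      then show ?thesis using 2 by (simp add: add_increasing2)
    next
      case 3
      have "gauss_tail (sqrt 2 * t) \<le> gauss_tail (sqrt 2 * t1)" using 3 by (intro gauss_tail_antimono) simp
      also have "\<dots> \<le> exp (- (sqrt 2 * t1)\<^sup>2 / 2)"
      proof (rule gauss_tail_le_exp)
        have "1 * 1 \<le> sqrt 2 * t1" using t by (intro mult_mono) auto
        then show "1 \<le> sqrt 2 * t1" by simp
      qed
      also have "\<dots> = d" by (simp add: d_def power_mult_distrib)
      finally have "(1 - gauss_tail t) ^ m * gauss_tail (sqrt 2 * t) \<le> 1 * d"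
        by (intro mult_mono power_le_one) auto
      then have "std_normal_density t * ((1 - gauss_tail t) ^ m * gauss_tail (sqrt 2 * t)) \<le> std_normal_density t * (1 * d)"
        by (intro mult_left_mono) auto
      then have "ennreal (std_normal_density t * ((1 - gauss_tail t) ^ m * gauss_tail (sqrt 2 * t))) \<le> ennreal d * ennreal (std_normal_density t)"
        by (subst ennreal_mult[symmetric]) (auto simp: d_def mult.commute intro!: ennreal_leI)
      then show ?thesis using 3 t by (simp add: add_increasing)
    qed
  qed
  also have "\<dots> = ennreal c * (\<integral>\<^sup>+t\<in>{t0..}. ennreal (f t) \<partial>lborel) + ennreal d * (\<integral>\<^sup>+t\<in>{t1..}. ennreal (std_normal_density t) \<partial>lborel)"
    unfolding f_def by (subst nn_integral_add) (auto simp: nn_integral_cmult)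
  also have "\<dots> = ennreal c * ennreal (incomplete_Beta 2 m (gauss_tail t0)) + ennreal d * ennreal (gauss_tail t1)"
    unfolding f_def nn_integral_gauss_tail_Beta nn_integral_gauss_tail ..
  also have "\<dots> \<le> ennreal c * ennreal (2 / ((real m + 1) * (real m + 2) * (real m + 3))) + ennreal d * ennreal (exp (- t1\<^sup>2 / 2))"
    using incomplete_Beta_le[of "gauss_tail t0" 2 m] gauss_tail_le_exp[of t1] t unfolding fact_2_fact_div
    by (intro add_mono mult_left_mono ennreal_leI) auto
  also have "\<dots> = ennreal (c * (2 / ((real m + 1) * (real m + 2) * (real m + 3))) + d * exp (- t1\<^sup>2 / 2))"
    using c by (simp add: ennreal_mult[symmetric] ennreal_plus[symmetric] d_def del: ennreal_plus)
  also have "d * exp (- t1\<^sup>2 / 2) = exp (- 3 / 2 * t1\<^sup>2)" by (simp add: d_def exp_add[symmetric])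
  finally show ?thesis by (simp add: c_def)
qed

text \<open>
  Restricting the Beta integral to \<open>t \<ge> t0\<close> loses at most \<open>(1 - gauss_tail t0) ^ m\<close>, and the
  factor \<open>1 - m exp (- t0\<^sup>2)\<close> is the loss in the Bonferroni bound.
\<close>

lemma nn_integral_strict_argmax_below_row_ge:
  assumes t: "1 \<le> t0" and m: "real m * exp (- t0\<^sup>2) \<le> 1"
  shows "ennreal (real m * (1 - real m * exp (- t0\<^sup>2)) * (sqrt pi * t0 * (2 * t0\<^sup>2 / (1 + 2 * t0\<^sup>2)))
        * (2 / ((real m + 1) * (real m + 2) * (real m + 3)) - (1 - gauss_tail t0) ^ m))
    \<le> (\<integral>\<^sup>+t\<in>{t0..}. ennreal (std_normal_density t * ((1 - gauss_tail t) ^ m * (1 - (1 - gauss_tail (sqrt 2 * t)) ^ m))) \<partial>lborel)"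
proof -
  define c where "c = real m * (1 - real m * exp (- t0\<^sup>2)) * (sqrt pi * t0 * (2 * t0\<^sup>2 / (1 + 2 * t0\<^sup>2)))"
  define f where "f t = std_normal_density t * (gauss_tail t ^ 2 * (1 - gauss_tail t) ^ m)" for t
  have c: "0 \<le> c" using t m by (simp add: c_def)
  have f: "0 \<le> f t" for t by (auto simp: f_def intro!: mult_nonneg_nonneg)
  have "ennreal (c * (2 / ((real m + 1) * (real m + 2) * (real m + 3)) - (1 - gauss_tail t0) ^ m)) \<le> ennreal (c * incomplete_Beta 2 m (gauss_tail t0))"
    using incomplete_Beta_ge[of "gauss_tail t0" 2 m] c unfolding fact_2_fact_div
    by (intro ennreal_leI mult_left_mono) auto
  also have "\<dots> = ennreal c * (\<integral>\<^sup>+t\<in>{t0..}. ennreal (f t) \<partial>lborel)"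
    unfolding f_def nn_integral_gauss_tail_Beta using c by (rule ennreal_mult')
  also have "\<dots> = (\<integral>\<^sup>+t. ennreal c * (ennreal (f t) * indicator {t0..} t) \<partial>lborel)"
    unfolding f_def by (subst nn_integral_cmult) auto
  also have "\<dots> \<le> (\<integral>\<^sup>+t\<in>{t0..}. ennreal (std_normal_density t * ((1 - gauss_tail t) ^ m * (1 - (1 - gauss_tail (sqrt 2 * t)) ^ m))) \<partial>lborel)"
  proof (rule nn_integral_mono)
    fix t :: real
    show "ennreal c * (ennreal (f t) * indicator {t0..} t) \<le> ennreal (std_normal_density t * ((1 - gauss_tail t) ^ m * (1 - (1 - gauss_tail (sqrt 2 * t)) ^ m))) * indicator {t0..} t"
    proof (cases "t0 \<le> t")
      case True
      define v where "v = gauss_tail (sqrt 2 * t)"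
      have "v \<le> gauss_tail (sqrt 2 * t0)" unfolding v_def using True by (intro gauss_tail_antimono) simp
      also have "\<dots> \<le> exp (- (sqrt 2 * t0)\<^sup>2 / 2)"
      proof (rule gauss_tail_le_exp)
        have "1 * 1 \<le> sqrt 2 * t0" using t by (intro mult_mono) auto
        then show "1 \<le> sqrt 2 * t0" by simp
      qed
      also have "\<dots> = exp (- t0\<^sup>2)" by (simp add: power_mult_distrib)
      finally have v: "v \<le> exp (- t0\<^sup>2)" .
      have "2 * t0\<^sup>2 / (1 + 2 * t0\<^sup>2) \<le> 2 * t\<^sup>2 / (1 + 2 * t\<^sup>2)"
      proof -
        have sq: "t0\<^sup>2 \<le> t\<^sup>2" using t True by (intro power_mono) auto
        have "x / (1 + x) = 1 - 1 / (1 + x)" if "0 \<le> x" for x :: real using that by (simp add: field_simps)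
        then show ?thesis using sq by (simp add: frac_le add_pos_nonneg)
      qed
      then have "sqrt pi * t0 * (2 * t0\<^sup>2 / (1 + 2 * t0\<^sup>2)) * (gauss_tail t)\<^sup>2 \<le> sqrt pi * t * (2 * t\<^sup>2 / (1 + 2 * t\<^sup>2)) * (gauss_tail t)\<^sup>2"
        using t True by (intro mult_right_mono mult_mono) auto
      also have "\<dots> \<le> v" unfolding v_def by (rule gauss_tail_sqrt2_lower) (use t True in simp)
      finally have vl: "sqrt pi * t0 * (2 * t0\<^sup>2 / (1 + 2 * t0\<^sup>2)) * (gauss_tail t)\<^sup>2 \<le> v" .
      have "c * (gauss_tail t)\<^sup>2 = real m * (1 - real m * exp (- t0\<^sup>2)) * (sqrt pi * t0 * (2 * t0\<^sup>2 / (1 + 2 * t0\<^sup>2)) * (gauss_tail t)\<^sup>2)"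
        by (simp add: c_def)
      also have "\<dots> \<le> real m * (1 - real m * exp (- t0\<^sup>2)) * v"
        using vl m by (intro mult_left_mono) auto
      also have "\<dots> \<le> real m * (1 - real m * v) * v"
        using v by (intro mult_right_mono mult_left_mono) (auto simp: v_def intro!: mult_left_mono)
      also have "\<dots> = real m * v * (1 - real m * v)" by simp
      also have "\<dots> \<le> 1 - (1 - v) ^ m" by (rule one_minus_power_ge) (auto simp: v_def)
      finally have "std_normal_density t * ((1 - gauss_tail t) ^ m * (c * (gauss_tail t)\<^sup>2)) \<le>
          std_normal_density t * ((1 - gauss_tail t) ^ m * (1 - (1 - v) ^ m))"
        by (intro mult_left_mono) auto
      then have "ennreal (c * f t) \<le> ennreal (std_normal_density t * ((1 - gauss_tail t) ^ m * (1 - (1 - v) ^ m)))"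
        by (intro ennreal_leI) (simp add: f_def mult_ac)
      then show ?thesis using True c f by (simp add: ennreal_mult v_def)
    qed simp
  qed
  finally show ?thesis by (simp add: c_def)
qed

section \<open>Conditioning on one of several independent variables\<close>

text \<open>
  Fubini's theorem for one coordinate against all others, in both orders of integration. The
  first order conditions on the coordinate; the second one freezes the others and is suited to
  null sets.
\<close>

lemma (in prob_space) indep_vars_joint_coordinate_rest:
  fixes Z :: "'i \<Rightarrow> 'a \<Rightarrow> real"
  assumes ind: "indep_vars (\<lambda>_. borel) Z I" and l: "l \<in> I"
    and A: "A \<in> sets (borel \<Otimes>\<^sub>M Pi\<^sub>M (I - {l}) (\<lambda>_. borel))"
  defines "Y \<equiv> \<lambda>\<omega>. restrict (\<lambda>i. Z i \<omega>) (I - {l})"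
  shows "emeasure M {\<omega>\<in>space M. (Z l \<omega>, Y \<omega>) \<in> A} =
           (\<integral>\<^sup>+x. emeasure M {\<omega>\<in>space M. (x, Y \<omega>) \<in> A} \<partial>distr M borel (Z l))"
    and "emeasure M {\<omega>\<in>space M. (Z l \<omega>, Y \<omega>) \<in> A} =
           (\<integral>\<^sup>+y. emeasure (distr M borel (Z l)) {x. (x, y) \<in> A} \<partial>distr M (Pi\<^sub>M (I - {l}) (\<lambda>_. borel)) Y)"
proof -
  define L where "L = Pi\<^sub>M {l} (\<lambda>_. borel :: real measure)"
  define N where "N = Pi\<^sub>M (I - {l}) (\<lambda>_. borel :: real measure)"
  define X where "X \<omega> = restrict (\<lambda>i. Z i \<omega>) {l}" for \<omega>
  have "indep_var L X N Y"
    unfolding N_def Y_def L_def X_def[abs_def] by (rule indep_var_restrict[OF ind]) (use l in auto)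
  then have rv [measurable]: "X \<in> measurable M L" "Y \<in> measurable M N"
    and eq: "distr M L X \<Otimes>\<^sub>M distr M N Y = distr M (L \<Otimes>\<^sub>M N) (\<lambda>\<omega>. (X \<omega>, Y \<omega>))"
    by (auto simp: indep_var_distribution_eq)
  have Zl [measurable]: "Z l \<in> borel_measurable M"
    using ind l by (auto simp: indep_vars_def)
  have A [measurable]: "A \<in> sets (borel \<Otimes>\<^sub>M N)" using A by (simp add: N_def)
  have ev [measurable]: "(\<lambda>g. g l) \<in> borel_measurable L" unfolding L_def by measurable
  have Xl [simp]: "X \<omega> l = Z l \<omega>" for \<omega> by (simp add: X_def)
  interpret X: prob_space "distr M L X" by (rule prob_space_distr) simp
  interpret Y: prob_space "distr M N Y" by (rule prob_space_distr) simp
  interpret XY: pair_prob_space "distr M L X" "distr M N Y" ..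
  define A' where "A' = {p \<in> space (L \<Otimes>\<^sub>M N). (fst p l, snd p) \<in> A}"
  have A'm [measurable]: "A' \<in> sets (L \<Otimes>\<^sub>M N)" unfolding A'_def by measurable
  have spX: "X \<omega> \<in> space L" and spY: "Y \<omega> \<in> space N" if "\<omega> \<in> space M" for \<omega>
    using measurable_space[OF rv(1) that] measurable_space[OF rv(2) that] by auto
  have A'': "A' \<in> sets (distr M L X \<Otimes>\<^sub>M distr M N Y)" using A'm by simp
  have 0: "emeasure M {\<omega>\<in>space M. (Z l \<omega>, Y \<omega>) \<in> A} = emeasure (distr M L X \<Otimes>\<^sub>M distr M N Y) A'"
    unfolding eq using spX spY
    by (subst emeasure_distr) (auto simp: A'_def space_pair_measure intro!: arg_cong2[where f=emeasure])
  also have "\<dots> = (\<integral>\<^sup>+g. emeasure (distr M N Y) (Pair g -` A') \<partial>distr M L X)"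
    by (rule Y.emeasure_pair_measure_alt[OF A''])
  also have "\<dots> = (\<integral>\<^sup>+\<omega>. emeasure (distr M N Y) (Pair (X \<omega>) -` A') \<partial>M)"
    by (rule nn_integral_distr) (use Y.measurable_emeasure_Pair[OF A''] in auto)
  also have "\<dots> = (\<integral>\<^sup>+\<omega>. emeasure M {\<omega>'\<in>space M. (Z l \<omega>, Y \<omega>') \<in> A} \<partial>M)"
  proof (rule nn_integral_cong)
    fix \<omega> assume \<omega>: "\<omega> \<in> space M"
    show "emeasure (distr M N Y) (Pair (X \<omega>) -` A') = emeasure M {\<omega>'\<in>space M. (Z l \<omega>, Y \<omega>') \<in> A}"
      using spX[OF \<omega>] spY
      by (subst emeasure_distr) (auto simp: A'_def space_pair_measure intro!: sets_Pair1 arg_cong2[where f=emeasure])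
  qed
  also have "\<dots> = (\<integral>\<^sup>+x. emeasure M {\<omega>\<in>space M. (x, Y \<omega>) \<in> A} \<partial>distr M borel (Z l))"
    by (rule nn_integral_distr[symmetric]) measurable
  finally show "emeasure M {\<omega>\<in>space M. (Z l \<omega>, Y \<omega>) \<in> A} =
           (\<integral>\<^sup>+x. emeasure M {\<omega>\<in>space M. (x, Y \<omega>) \<in> A} \<partial>distr M borel (Z l))" .
  have "emeasure (distr M L X \<Otimes>\<^sub>M distr M N Y) A' =
     (\<integral>\<^sup>+y. emeasure (distr M L X) ((\<lambda>x. (x, y)) -` A') \<partial>distr M N Y)"
    by (rule XY.emeasure_pair_measure_alt2[OF A''])
  also have "\<dots> = (\<integral>\<^sup>+y. emeasure (distr M borel (Z l)) {x. (x, y) \<in> A} \<partial>distr M N Y)"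
  proof (rule nn_integral_cong)
    fix y assume y: "y \<in> space (distr M N Y)"
    have "{x. (x, y) \<in> A} = (\<lambda>x. (x, y)) -` A" by auto
    then have "{x. (x, y) \<in> A} \<in> sets borel" using sets_Pair2[OF A] by simp
    then show "emeasure (distr M L X) ((\<lambda>x. (x, y)) -` A') = emeasure (distr M borel (Z l)) {x. (x, y) \<in> A}"
      using spX y by (subst (1 2) emeasure_distr)
        (auto simp: A'_def space_pair_measure intro!: sets_Pair2 arg_cong2[where f=emeasure])
  qed
  finally show "emeasure M {\<omega>\<in>space M. (Z l \<omega>, Y \<omega>) \<in> A} =
           (\<integral>\<^sup>+y. emeasure (distr M borel (Z l)) {x. (x, y) \<in> A} \<partial>distr M (Pi\<^sub>M (I - {l}) (\<lambda>_. borel)) Y)"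
    unfolding 0 N_def .
qed

lemma (in prob_space) emeasure_condition_on_coordinate:
  fixes Z :: "'i \<Rightarrow> 'a \<Rightarrow> real"
  assumes ind: "indep_vars (\<lambda>_. borel) Z I" and l: "l \<in> I" and dens: "distributed M lborel (Z l) f"
    and P: "Measurable.pred (borel \<Otimes>\<^sub>M Pi\<^sub>M (I - {l}) (\<lambda>_. borel)) (\<lambda>p. P (fst p) (snd p))"
    and P_cong: "\<And>x y y'. (\<And>i. i \<in> I - {l} \<Longrightarrow> y i = y' i) \<Longrightarrow> P x y = P x y'"
  shows "emeasure M {\<omega>\<in>space M. P (Z l \<omega>) (\<lambda>i. Z i \<omega>)} =
           (\<integral>\<^sup>+x. f x * emeasure M {\<omega>\<in>space M. P x (\<lambda>i. Z i \<omega>)} \<partial>lborel)"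
proof -
  define N where "N = Pi\<^sub>M (I - {l}) (\<lambda>_. borel :: real measure)"
  define A where "A = {p \<in> space (borel \<Otimes>\<^sub>M N). P (fst p) (snd p)}"
  have A [measurable]: "A \<in> sets (borel \<Otimes>\<^sub>M N)"
    unfolding A_def N_def using P by (rule predE)
  have Y [measurable]: "(\<lambda>\<omega>. restrict (\<lambda>i. Z i \<omega>) (I - {l})) \<in> measurable M N"
    unfolding N_def using ind by (intro measurable_restrict) (auto simp: indep_vars_def)
  have *: "P x (restrict (\<lambda>i. Z i \<omega>) (I - {l})) = P x (\<lambda>i. Z i \<omega>)" for x \<omega>
    by (rule P_cong) simp
  have mem: "(x, restrict (\<lambda>i. Z i \<omega>) (I - {l})) \<in> A \<longleftrightarrow> P x (\<lambda>i. Z i \<omega>)" if "\<omega> \<in> space M" for x \<omega>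
    using measurable_space[OF Y that] * by (simp add: A_def space_pair_measure)
  have "emeasure M {\<omega>\<in>space M. P (Z l \<omega>) (\<lambda>i. Z i \<omega>)}
      = emeasure M {\<omega>\<in>space M. (Z l \<omega>, restrict (\<lambda>i. Z i \<omega>) (I - {l})) \<in> A}"
    using mem by (intro arg_cong2[where f=emeasure] refl) auto
  also have "\<dots> = (\<integral>\<^sup>+x. emeasure M {\<omega>\<in>space M. (x, restrict (\<lambda>i. Z i \<omega>) (I - {l})) \<in> A} \<partial>distr M borel (Z l))"
    using indep_vars_joint_coordinate_rest(1)[OF ind l] A unfolding N_def by blast
  also have "distr M borel (Z l) = density lborel f"
    using distributed_distr_eq_density[OF dens] by (simp add: distr_cong[of M M borel lborel])
  also have "(\<integral>\<^sup>+x. emeasure M {\<omega>\<in>space M. (x, restrict (\<lambda>i. Z i \<omega>) (I - {l})) \<in> A} \<partial>density lborel f) =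
     (\<integral>\<^sup>+x. f x * emeasure M {\<omega>\<in>space M. (x, restrict (\<lambda>i. Z i \<omega>) (I - {l})) \<in> A} \<partial>lborel)"
  proof (rule nn_integral_density)
    show "f \<in> borel_measurable lborel" using dens by (rule distributed_borel_measurable)
    have "(\<lambda>x. emeasure M {\<omega>\<in>space M. (x, restrict (\<lambda>i. Z i \<omega>) (I - {l})) \<in> A}) \<in> borel_measurable borel"
      by measurable
    then show "(\<lambda>x. emeasure M {\<omega>\<in>space M. (x, restrict (\<lambda>i. Z i \<omega>) (I - {l})) \<in> A}) \<in> borel_measurable lborel" by simp
  qed
  also have "\<dots> = (\<integral>\<^sup>+x. f x * emeasure M {\<omega>\<in>space M. P x (\<lambda>i. Z i \<omega>)} \<partial>lborel)"
    using mem by (intro nn_integral_cong arg_cong2[where f="(*)"] arg_cong2[where f=emeasure] refl) auto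
  finally show ?thesis .
qed

text \<open>
  Events that compare every \<open>Z i\<close> with the same \<open>Z l\<close> become independent once the value of \<open>Z l\<close> is fixed.
\<close>

lemma (in prob_space) emeasure_conditionally_independent:
  fixes Z :: "'i \<Rightarrow> 'a \<Rightarrow> real"
  assumes ind: "indep_vars (\<lambda>_. borel) Z I" and l: "l \<in> I" and dens: "distributed M lborel (Z l) f"
    and J: "J \<subseteq> I - {l}" "finite J"
    and P: "\<And>i. i \<in> J \<Longrightarrow> Measurable.pred (borel \<Otimes>\<^sub>M borel) (\<lambda>p. P i (fst p) (snd p))"
    and B: "B \<in> sets borel"
  shows "emeasure M {\<omega>\<in>space M. Z l \<omega> \<in> B \<and> (\<forall>i\<in>J. P i (Z l \<omega>) (Z i \<omega>))} =
           (\<integral>\<^sup>+x\<in>B. f x * ennreal (\<Prod>i\<in>J. prob {\<omega>\<in>space M. P i x (Z i \<omega>)}) \<partial>lborel)"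
proof -
  have 1: "emeasure M {\<omega>\<in>space M. Z l \<omega> \<in> B \<and> (\<forall>i\<in>J. P i (Z l \<omega>) (Z i \<omega>))} =
      (\<integral>\<^sup>+x. f x * emeasure M {\<omega>\<in>space M. x \<in> B \<and> (\<forall>i\<in>J. P i x (Z i \<omega>))} \<partial>lborel)"
  proof (rule emeasure_condition_on_coordinate[OF ind l dens])
    have "Measurable.pred (borel \<Otimes>\<^sub>M Pi\<^sub>M (I - {l}) (\<lambda>_. borel)) (\<lambda>p. P i (fst p) (snd p i))" if "i \<in> J" for i
    proof -
      have i: "i \<in> I - {l}" using that J by auto
      have "(\<lambda>p. (fst p, snd p i)) \<in> measurable (borel \<Otimes>\<^sub>M Pi\<^sub>M (I - {l}) (\<lambda>_. borel)) (borel \<Otimes>\<^sub>M borel)"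
        using i by measurable
      from measurable_compose[OF this P[OF that]] show ?thesis by simp
    qed
    then show "Measurable.pred (borel \<Otimes>\<^sub>M Pi\<^sub>M (I - {l}) (\<lambda>_. borel)) (\<lambda>p. fst p \<in> B \<and> (\<forall>i\<in>J. P i (fst p) (snd p i)))"
      using B J(2) by (intro pred_intros_logic pred_intros_finite) (auto intro: measurable_compose[OF measurable_fst])
    show "(x \<in> B \<and> (\<forall>i\<in>J. P i x (y i))) = (x \<in> B \<and> (\<forall>i\<in>J. P i x (y' i)))"
      if y: "\<And>i. i \<in> I - {l} \<Longrightarrow> y i = y' i" for x y y'
    proof -
      have "y i = y' i" if "i \<in> J" for i using y that J(1) by blast
      then show ?thesis by simp
    qed
  qed
  have 2: "emeasure M {\<omega>\<in>space M. \<forall>i\<in>J. P i x (Z i \<omega>)} = ennreal (\<Prod>i\<in>J. prob {\<omega>\<in>space M. P i x (Z i \<omega>)})" for x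
  proof (cases "J = {}")
    case True then show ?thesis by (simp add: emeasure_space_1)
  next
    case False
    define A where "A i = {y. P i x y}" for i
    have "prob (\<Inter>i\<in>J. Z i -` A i \<inter> space M) = (\<Prod>i\<in>J. prob (Z i -` A i \<inter> space M))"
    proof (rule indep_varsD[OF ind False J(2)])
      fix i assume "i \<in> J"
      from measurable_compose[OF measurable_Pair1'[of x borel borel] P[OF this]]
      have "Measurable.pred borel (P i x)" by simp
      then show "A i \<in> sets borel" by (simp add: A_def pred_def)
    qed (use J in auto)
    moreover have "(\<Inter>i\<in>J. Z i -` A i \<inter> space M) = {\<omega>\<in>space M. \<forall>i\<in>J. P i x (Z i \<omega>)}"
      using False by (auto simp: A_def)
    moreover have "Z i -` A i \<inter> space M = {\<omega>\<in>space M. P i x (Z i \<omega>)}" for i by (auto simp: A_def)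
    ultimately show ?thesis by (simp add: emeasure_eq_measure)
  qed
  show ?thesis
    unfolding 1 by (intro nn_integral_cong) (auto simp: 2 split: split_indicator)
qed

lemma (in prob_space) prob_normal_half_lines:
  assumes X: "distributed M lborel X (normal_density 0 \<sigma>)" and s: "0 < \<sigma>"
  shows "prob {\<omega>\<in>space M. t < X \<omega>} = gauss_tail (t / \<sigma>)"
    and "prob {\<omega>\<in>space M. t \<le> X \<omega>} = gauss_tail (t / \<sigma>)"
    and "prob {\<omega>\<in>space M. X \<omega> \<le> t} = 1 - gauss_tail (t / \<sigma>)"
    and "prob {\<omega>\<in>space M. X \<omega> < t} = 1 - gauss_tail (t / \<sigma>)"
proof -
  have X' [measurable]: "X \<in> borel_measurable M" using distributed_measurable[OF X] by simp
  have "distributed M lborel (\<lambda>\<omega>. (X \<omega> - 0) / \<sigma>) std_normal_density"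
    using X normal_standard_normal_convert[OF s, of X 0] by simp
  then have D: "distr M borel (\<lambda>\<omega>. X \<omega> / \<sigma>) = std_normal_distribution"
    by (simp add: distributed_def distr_cong[of M M borel lborel])
  have S: "prob {\<omega>\<in>space M. X \<omega> / \<sigma> \<in> A} = measure std_normal_distribution A" if [measurable]: "A \<in> sets borel" for A
  proof -
    have "measure (distr M borel (\<lambda>\<omega>. X \<omega> / \<sigma>)) A = prob ((\<lambda>\<omega>. X \<omega> / \<sigma>) -` A \<inter> space M)"
      by (rule measure_distr) auto
    then show ?thesis unfolding D by (simp add: vimage_def Int_def conj_commute)
  qed
  show 1: "prob {\<omega>\<in>space M. t < X \<omega>} = gauss_tail (t / \<sigma>)"
    using S[of "{t / \<sigma><..}"] s by (simp add: gauss_tail_def divide_less_cancel)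
  have "measure std_normal_distribution {t / \<sigma>..} = measure std_normal_distribution ({t / \<sigma>} \<union> {t / \<sigma><..})"
    by (intro arg_cong2[where f=measure]) auto
  also have "\<dots> = measure std_normal_distribution {t / \<sigma>} + measure std_normal_distribution {t / \<sigma><..}"
    by (rule std_normal.finite_measure_Union) auto
  also have "measure std_normal_distribution {t / \<sigma>} = 0" by (simp add: measure_def emeasure_std_normal_singleton)
  finally show 2: "prob {\<omega>\<in>space M. t \<le> X \<omega>} = gauss_tail (t / \<sigma>)"
    using S[of "{t / \<sigma>..}"] s by (simp add: gauss_tail_def divide_le_cancel)
  have "prob {\<omega>\<in>space M. \<not> t < X \<omega>} = 1 - prob {\<omega>\<in>space M. t < X \<omega>}"
    by (rule prob_neg) measurable
  then show "prob {\<omega>\<in>space M. X \<omega> \<le> t} = 1 - gauss_tail (t / \<sigma>)" using 1 by (simp add: not_less)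
  have "prob {\<omega>\<in>space M. \<not> t \<le> X \<omega>} = 1 - prob {\<omega>\<in>space M. t \<le> X \<omega>}"
    by (rule prob_neg) measurable
  then show "prob {\<omega>\<in>space M. X \<omega> < t} = 1 - gauss_tail (t / \<sigma>)" using 2 by (simp add: not_le)
qed

text \<open>
  On the interval, \<open>x\<^sup>2 \<ge> t\<^sup>2 - 2 t y\<close>, so the density is at most the exponential factor.
\<close>

lemma (in prob_space) prob_std_normal_interval_le:
  assumes X: "distributed M lborel X std_normal_density" and y: "0 \<le> y" "0 \<le> t"
  shows "prob {\<omega>\<in>space M. t - y \<le> X \<omega> \<and> X \<omega> \<le> t} \<le> y * exp (t * y - t\<^sup>2 / 2)"
proof -
  have X' [measurable]: "X \<in> borel_measurable M" using distributed_measurable[OF X] by simp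
  have "ennreal (prob {\<omega>\<in>space M. t - y \<le> X \<omega> \<and> X \<omega> \<le> t}) = emeasure M (X -` {t - y..t} \<inter> space M)"
    by (simp add: emeasure_eq_measure vimage_def Int_def conj_commute)
  also have "\<dots> = (\<integral>\<^sup>+x. ennreal (std_normal_density x) * indicator {t - y..t} x \<partial>lborel)"
    by (rule distributed_emeasure[OF X]) simp
  also have "\<dots> \<le> (\<integral>\<^sup>+x. ennreal (exp (t * y - t\<^sup>2 / 2)) * indicator {t - y..t} x \<partial>lborel)"
  proof (rule nn_integral_mono)
    fix x :: real
    show "ennreal (std_normal_density x) * indicator {t - y..t} x \<le> ennreal (exp (t * y - t\<^sup>2 / 2)) * indicator {t - y..t} x"
    proof (cases "x \<in> {t - y..t}")
      case True
      have "t\<^sup>2 - 2 * t * (t - x) \<le> x\<^sup>2" using zero_le_power2[of "t - x"] by (simp add: power2_eq_square algebra_simps)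
      moreover have "t * (t - x) \<le> t * y" using True y by (intro mult_left_mono) auto
      ultimately have *: "- x\<^sup>2 / 2 \<le> t * y - t\<^sup>2 / 2" by linarith
      have "1 \<le> sqrt (2 * pi)" using pi_gt3 by (intro real_le_rsqrt) simp
      then have "std_normal_density x \<le> exp (- x\<^sup>2 / 2)" unfolding std_normal_density_def by (simp add: divide_le_eq)
      also have "\<dots> \<le> exp (t * y - t\<^sup>2 / 2)" using * by simp
      finally show ?thesis using True by (simp add: ennreal_leI)
    qed simp
  qed
  also have "\<dots> = ennreal (y * exp (t * y - t\<^sup>2 / 2))"
    using y by (subst nn_integral_cmult_indicator) (auto simp: ennreal_mult[symmetric] mult.commute)
  finally show ?thesis using y by (subst (asm) ennreal_le_iff) auto
qed

section \<open>Gaussian orthogonal ensembles and their largest diagonal entry\<close>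

text \<open>
  Independence is available for the entries on and above the diagonal. This function maps an
  unordered pair of indices to the representative there.
\<close>

definition edge :: "nat \<Rightarrow> nat \<Rightarrow> nat \<times> nat" where
  "edge i j = (min i j, max i j)"

lemma edge_commute: "edge i j = edge j i" by (simp add: edge_def min.commute max.commute)

lemma edge_same [simp]: "edge i i = (i, i)" by (simp add: edge_def)

lemma edge_eq_iff: "edge i j = edge k l \<longleftrightarrow> (i = k \<and> j = l) \<or> (i = l \<and> j = k)"
  by (auto simp: edge_def min_def max_def split: if_splits)

lemma fst_edge_eq_snd [simp]: "fst (edge i j) = snd (edge i j) \<longleftrightarrow> i = j"
  by (auto simp: edge_def min_def max_def)

locale GOE_space = prob_space M for M :: "'a measure" +
  fixes n :: nat and Q :: "nat \<Rightarrow> nat \<Rightarrow> 'a \<Rightarrow> real"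
  assumes GOE: "GOE M n Q"
begin

text \<open>
  The sign turns minima into maxima, so that all events concern upper tails.
\<close>

definition Z :: "nat \<times> nat \<Rightarrow> 'a \<Rightarrow> real" where
  "Z p \<omega> = - Q (fst p) (snd p) \<omega>"

definition idx :: "(nat \<times> nat) set" where
  "idx = {(i, j). i \<le> j \<and> j < n}"

lemma edge_in_idx: "i < n \<Longrightarrow> j < n \<Longrightarrow> edge i j \<in> idx"
  by (auto simp: edge_def idx_def)

lemma indep_Z: "indep_vars (\<lambda>_. borel) Z idx"
proof -
  have "indep_vars (\<lambda>_. borel) (\<lambda>p \<omega>. - ((case p of (i, j) \<Rightarrow> Q i j) \<omega>)) idx"
    by (rule indep_vars_compose2[where Y = "\<lambda>_. uminus"]) (use GOE in \<open>auto simp: GOE_def idx_def\<close>)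
  then show ?thesis by (simp add: Z_def[abs_def] case_prod_beta)
qed

lemma distributed_uminus_normal:
  assumes "distributed M lborel X (normal_density 0 \<sigma>)" "0 < \<sigma>"
  shows "distributed M lborel (\<lambda>x. - X x) (normal_density 0 \<sigma>)"
  using normal_density_affine[OF assms, of "-1" 0] by simp

lemma Z_diagonal: "i < n \<Longrightarrow> distributed M lborel (Z (i, i)) std_normal_density"
  using GOE distributed_uminus_normal[of "Q i i" 1] by (simp add: GOE_def Z_def[abs_def])

lemma Z_off_diagonal:
  assumes "i < n" "j < n" "i \<noteq> j"
  shows "distributed M lborel (Z (edge i j)) (normal_density 0 (sqrt (1 / 2)))"
proof -
  have "min i j < max i j" "max i j < n" using assms by auto
  then have "distributed M lborel (Q (min i j) (max i j)) (normal_density 0 (sqrt (1 / 2)))"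
    using GOE unfolding GOE_def by blast
  from distributed_uminus_normal[OF this] show ?thesis by (simp add: Z_def[abs_def] edge_def)
qed

lemma Q_eq_Z:
  assumes "i < n" "j < n" "\<omega> \<in> space M"
  shows "Q i j \<omega> = - Z (edge i j) \<omega>"
proof (cases "i \<le> j")
  case True then show ?thesis by (simp add: Z_def edge_def)
next
  case False
  then have "edge i j = (j, i)" by (simp add: edge_def)
  then show ?thesis using GOE assms by (auto simp: GOE_def Z_def)
qed

lemma Z_measurable: "p \<in> idx \<Longrightarrow> Z p \<in> borel_measurable M"
  using indep_Z by (auto simp: indep_vars_def)

lemma Z_edge_measurable [measurable (raw)]: "i < n \<Longrightarrow> j < n \<Longrightarrow> Z (edge i j) \<in> borel_measurable M"
  by (intro Z_measurable edge_in_idx)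

lemma Z_diagonal_measurable [measurable (raw)]: "i < n \<Longrightarrow> Z (i, i) \<in> borel_measurable M"
  using Z_edge_measurable[of i i] by simp

lemma prob_Z_diagonal:
  assumes "i < n"
  shows "prob {\<omega>\<in>space M. t \<le> Z (i, i) \<omega>} = gauss_tail t"
    "prob {\<omega>\<in>space M. Z (i, i) \<omega> \<le> t} = 1 - gauss_tail t" "prob {\<omega>\<in>space M. Z (i, i) \<omega> < t} = 1 - gauss_tail t"
  using prob_normal_half_lines[OF Z_diagonal[OF assms], of t] by simp_all

lemma prob_Z_off_diagonal:
  assumes "i < n" "j < n" "i \<noteq> j"
  shows "prob {\<omega>\<in>space M. t \<le> Z (edge i j) \<omega>} = gauss_tail (sqrt 2 * t)"
    "prob {\<omega>\<in>space M. Z (edge i j) \<omega> \<le> t} = 1 - gauss_tail (sqrt 2 * t)"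
proof -
  have "t / sqrt (1 / 2) = sqrt 2 * t" by (simp add: real_sqrt_divide)
  then show "prob {\<omega>\<in>space M. t \<le> Z (edge i j) \<omega>} = gauss_tail (sqrt 2 * t)"
    "prob {\<omega>\<in>space M. Z (edge i j) \<omega> \<le> t} = 1 - gauss_tail (sqrt 2 * t)"
    using prob_normal_half_lines[OF Z_off_diagonal[OF assms], of t] by simp_all
qed

definition diag :: "nat set \<Rightarrow> (nat \<times> nat) set" where
  "diag S = (\<lambda>p. (p, p)) ` S"

lemma finite_diag [simp]: "finite S \<Longrightarrow> finite (diag S)" by (simp add: diag_def)

lemma ball_diag [simp]: "(\<forall>i\<in>diag S. P i) \<longleftrightarrow> (\<forall>p\<in>S. P (p, p))" by (auto simp: diag_def)

lemma prod_diag: "(\<Prod>i\<in>diag S. f i) = (\<Prod>p\<in>S. f (p, p))"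
  unfolding diag_def by (subst prod.reindex) (auto simp: inj_on_def)

lemma diag_idx: "S \<subseteq> {..<n} \<Longrightarrow> diag S \<subseteq> idx" by (auto simp: diag_def idx_def)

lemma edge_in_diag: "edge i j \<in> diag S \<longleftrightarrow> i = j \<and> i \<in> S"
  by (auto simp: diag_def edge_def min_def max_def split: if_splits)

definition no_large_diagonal :: "real \<Rightarrow> 'a set" where
  "no_large_diagonal t = {\<omega>\<in>space M. \<forall>l<n. Z (l, l) \<omega> < t}"

lemma prob_no_large_diagonal:
  assumes "1 \<le> n"
  shows "prob (no_large_diagonal t) = (1 - gauss_tail t) ^ n"
proof -
  have ne: "diag {..<n} \<noteq> {}" using assms by (auto simp: diag_def lessThan_empty_iff)
  have "prob (\<Inter>i\<in>diag {..<n}. Z i -` {..<t} \<inter> space M) = (\<Prod>i\<in>diag {..<n}. prob (Z i -` {..<t} \<inter> space M))"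
    by (rule indep_varsD[OF indep_Z ne]) (auto simp: diag_def idx_def)
  moreover have "(\<Inter>i\<in>diag {..<n}. Z i -` {..<t} \<inter> space M) = no_large_diagonal t"
    using ne by (auto simp: no_large_diagonal_def diag_def)
  moreover have "prob (Z (p, p) -` {..<t} \<inter> space M) = 1 - gauss_tail t" if "p < n" for p
    using prob_Z_diagonal(3)[OF that, of t] by (simp add: vimage_def Int_def conj_commute)
  ultimately show ?thesis by (simp add: prod_diag)
qed

text \<open>
  For upper bounds, hence with ties.
\<close>

definition argmax_below_row :: "real \<Rightarrow> nat \<Rightarrow> nat \<Rightarrow> 'a set" where
  "argmax_below_row t l j = {\<omega>\<in>space M. t \<le> Z (l, l) \<omega> \<and> (\<forall>p\<in>{..<n} - {l}. Z (p, p) \<omega> \<le> Z (l, l) \<omega>) \<and> Z (l, l) \<omega> \<le> Z (edge l j) \<omega>}"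

lemma emeasure_argmax_below_row:
  assumes lj: "l < n" "j < n" "l \<noteq> j"
  shows "emeasure M (argmax_below_row t0 l j) =
    (\<integral>\<^sup>+t\<in>{t0..}. ennreal (std_normal_density t * ((1 - gauss_tail t) ^ (n - 1) * gauss_tail (sqrt 2 * t))) \<partial>lborel)"
proof -
  define J where "J = insert (edge l j) (diag ({..<n} - {l}))"
  define P where "P i x z \<longleftrightarrow> (if fst i = snd i then z \<le> x else x \<le> z)" for i :: "nat \<times> nat" and x z :: real
  have J: "J \<subseteq> idx - {(l, l)}" "finite J"
    using edge_in_idx[of l j] diag_idx[of "{..<n} - {l}"] lj by (auto simp: J_def diag_def edge_def)
  have prod: "(\<Prod>i\<in>J. prob {\<omega>\<in>space M. P i x (Z i \<omega>)}) = (1 - gauss_tail x) ^ (n - 1) * gauss_tail (sqrt 2 * x)" for x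
    unfolding J_def using lj
    by (subst prod.insert) (auto simp: edge_in_diag prod_diag P_def prob_Z_diagonal prob_Z_off_diagonal)
  have "emeasure M (argmax_below_row t0 l j) = emeasure M {\<omega>\<in>space M. Z (l, l) \<omega> \<in> {t0..} \<and> (\<forall>i\<in>J. P i (Z (l, l) \<omega>) (Z i \<omega>))}"
    using lj by (intro arg_cong2[where f=emeasure]) (auto simp: argmax_below_row_def J_def P_def)
  also have "\<dots> = (\<integral>\<^sup>+x\<in>{t0..}. ennreal (std_normal_density x) * ennreal (\<Prod>i\<in>J. prob {\<omega>\<in>space M. P i x (Z i \<omega>)}) \<partial>lborel)"
  proof (rule emeasure_conditionally_independent[OF indep_Z _ _ J])
    show "Measurable.pred (borel \<Otimes>\<^sub>M borel) (\<lambda>p. P i (fst p) (snd p))" for i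
      unfolding P_def by measurable
  qed (use lj in \<open>auto intro: Z_diagonal simp: idx_def\<close>)
  finally show ?thesis unfolding prod by (simp add: ennreal_mult)
qed

text \<open>
  For lower bounds. Strictness of the diagonal comparison makes the events for different \<open>l\<close>
  disjoint.
\<close>

definition strict_argmax_below_row :: "real \<Rightarrow> nat \<Rightarrow> 'a set" where
  "strict_argmax_below_row t l = {\<omega>\<in>space M. t \<le> Z (l, l) \<omega> \<and> (\<forall>p\<in>{..<n} - {l}. Z (p, p) \<omega> < Z (l, l) \<omega>)
     \<and> (\<exists>j\<in>{..<n} - {l}. Z (l, l) \<omega> < Z (edge l j) \<omega>)}"

lemma sets_strict_argmax_below_row [measurable]: "l < n \<Longrightarrow> strict_argmax_below_row t l \<in> sets M"
  unfolding strict_argmax_below_row_def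
  by (intro sets.sets_Collect_conj sets.sets_Collect_finite_All sets.sets_Collect_finite_Ex
      borel_measurable_less borel_measurable_le Z_diagonal_measurable Z_edge_measurable measurable_const) auto

lemma emeasure_strict_argmax_below_row:
  assumes l: "l < n"
  shows "emeasure M (strict_argmax_below_row t0 l) =
    (\<integral>\<^sup>+t\<in>{t0..}. ennreal (std_normal_density t * ((1 - gauss_tail t) ^ (n - 1) * (1 - (1 - gauss_tail (sqrt 2 * t)) ^ (n - 1)))) \<partial>lborel)"
    (is "_ = ?I")
proof -
  define D where "D = diag ({..<n} - {l})"
  define E where "E = edge l ` ({..<n} - {l})"
  define P where "P i x z \<longleftrightarrow> (if fst i = snd i then z < x else z \<le> x)" for i :: "nat \<times> nat" and x z :: real
  define G where "G = {\<omega>\<in>space M. Z (l, l) \<omega> \<in> {t0..} \<and> (\<forall>i\<in>D. P i (Z (l, l) \<omega>) (Z i \<omega>))}"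
  define H where "H = {\<omega>\<in>space M. Z (l, l) \<omega> \<in> {t0..} \<and> (\<forall>i\<in>D \<union> E. P i (Z (l, l) \<omega>) (Z i \<omega>))}"
  have D: "D \<subseteq> idx - {(l, l)}" "finite D"
    using diag_idx[of "{..<n} - {l}"] l by (auto simp: D_def diag_def)
  have E: "E \<subseteq> idx - {(l, l)}" "finite E"
    using edge_in_idx[of l] l by (auto simp: E_def edge_def)
  have DE: "D \<inter> E = {}" by (auto simp: D_def E_def edge_in_diag)
  have Pm: "Measurable.pred (borel \<Otimes>\<^sub>M borel) (\<lambda>p. P i (fst p) (snd p))" for i
    unfolding P_def by measurable
  have pD: "(\<Prod>i\<in>D. prob {\<omega>\<in>space M. P i x (Z i \<omega>)}) = (1 - gauss_tail x) ^ (n - 1)" for x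
    using l by (simp add: D_def prod_diag P_def prob_Z_diagonal)
  have pE: "(\<Prod>i\<in>E. prob {\<omega>\<in>space M. P i x (Z i \<omega>)}) = (1 - gauss_tail (sqrt 2 * x)) ^ (n - 1)" for x
  proof -
    have "inj_on (edge l) ({..<n} - {l})" by (auto simp: inj_on_def edge_eq_iff)
    then show ?thesis unfolding E_def using l
      by (subst prod.reindex) (auto simp: P_def prob_Z_off_diagonal)
  qed
  have G: "emeasure M G = (\<integral>\<^sup>+x\<in>{t0..}. ennreal (std_normal_density x * (1 - gauss_tail x) ^ (n - 1)) \<partial>lborel)"
    unfolding G_def
    by (subst emeasure_conditionally_independent[OF indep_Z _ _ D, of _ P])
      (use l in \<open>auto intro: Z_diagonal Pm simp: idx_def pD ennreal_mult\<close>)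
  have H: "emeasure M H = (\<integral>\<^sup>+x\<in>{t0..}. ennreal (std_normal_density x * ((1 - gauss_tail x) ^ (n - 1) * (1 - gauss_tail (sqrt 2 * x)) ^ (n - 1))) \<partial>lborel)"
    unfolding H_def
    by (subst emeasure_conditionally_independent[OF indep_Z _ _ , of _ _ "D \<union> E" P])
      (use l D E in \<open>auto intro: Z_diagonal Pm simp: idx_def pD pE prod.union_disjoint[OF D(2) E(2) DE] ennreal_mult\<close>)
  have Hm: "H \<in> sets M"
  proof -
    have "{\<omega>\<in>space M. P i (Z (l, l) \<omega>) (Z i \<omega>)} \<in> sets M" if "i \<in> D \<union> E" for i
    proof -
      have "Z i \<in> borel_measurable M" using that D E by (intro Z_measurable) auto
      then show ?thesis unfolding P_def using l by measurable
    qed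
    then have "{\<omega>\<in>space M. \<forall>i\<in>D \<union> E. P i (Z (l, l) \<omega>) (Z i \<omega>)} \<in> sets M"
      using D E by (intro sets.sets_Collect_finite_All) auto
    moreover have "{\<omega>\<in>space M. Z (l, l) \<omega> \<in> {t0..}} \<in> sets M" using l by measurable
    ultimately have "{\<omega>\<in>space M. Z (l, l) \<omega> \<in> {t0..}} \<inter> {\<omega>\<in>space M. \<forall>i\<in>D \<union> E. P i (Z (l, l) \<omega>) (Z i \<omega>)} \<in> sets M" by blast
    also have "{\<omega>\<in>space M. Z (l, l) \<omega> \<in> {t0..}} \<inter> {\<omega>\<in>space M. \<forall>i\<in>D \<union> E. P i (Z (l, l) \<omega>) (Z i \<omega>)} = H"
      by (auto simp: H_def)
    finally show ?thesis .
  qed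
  \<comment> \<open>Given \<open>Z (l, l)\<close>, the existence of a large entry in the row is the complement of an
    event in product form.\<close>
  have "G = H \<union> strict_argmax_below_row t0 l"
  proof -
    have "(\<forall>i\<in>D. P i (Z (l, l) \<omega>) (Z i \<omega>)) \<longleftrightarrow> (\<forall>p\<in>{..<n} - {l}. Z (p, p) \<omega> < Z (l, l) \<omega>)" for \<omega>
      by (simp add: D_def P_def)
    moreover have "(\<forall>i\<in>E. P i (Z (l, l) \<omega>) (Z i \<omega>)) \<longleftrightarrow> \<not> (\<exists>j\<in>{..<n} - {l}. Z (l, l) \<omega> < Z (edge l j) \<omega>)" for \<omega>
      by (auto simp: E_def P_def not_less)
    ultimately show ?thesis unfolding G_def H_def strict_argmax_below_row_def ball_Un by auto
  qed
  moreover have "H \<inter> strict_argmax_below_row t0 l = {}"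
    by (auto simp: H_def strict_argmax_below_row_def E_def P_def ball_Un) (metis DiffI lessThan_iff not_less singletonD)
  ultimately have "emeasure M G = emeasure M H + emeasure M (strict_argmax_below_row t0 l)"
    using l Hm by (simp add: plus_emeasure)
  moreover have "emeasure M G = emeasure M H + ?I"
    unfolding G H
  proof (subst nn_integral_add[symmetric])
    show "(\<integral>\<^sup>+x\<in>{t0..}. ennreal (std_normal_density x * (1 - gauss_tail x) ^ (n - 1)) \<partial>lborel) =
      (\<integral>\<^sup>+x. ennreal (std_normal_density x * ((1 - gauss_tail x) ^ (n - 1) * (1 - gauss_tail (sqrt 2 * x)) ^ (n - 1))) * indicator {t0..} x
       + ennreal (std_normal_density x * ((1 - gauss_tail x) ^ (n - 1) * (1 - (1 - gauss_tail (sqrt 2 * x)) ^ (n - 1)))) * indicator {t0..} x \<partial>lborel)"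
    proof (rule nn_integral_cong)
      fix x :: real
      have "ennreal (r * (p * q)) + ennreal (r * (p * (1 - q))) = ennreal (r * p)"
        if "0 \<le> r" "0 \<le> p" "0 \<le> q" "q \<le> 1" for r p q :: real
      proof -
        have "r * (p * q) + r * (p * (1 - q)) = r * p" by (simp add: algebra_simps)
        moreover have "0 \<le> r * (p * q)" "0 \<le> r * (p * (1 - q))" using that by (auto intro!: mult_nonneg_nonneg)
        ultimately show ?thesis by (metis ennreal_plus)
      qed
      then have "ennreal (std_normal_density x * ((1 - gauss_tail x) ^ (n - 1) * (1 - gauss_tail (sqrt 2 * x)) ^ (n - 1)))
       + ennreal (std_normal_density x * ((1 - gauss_tail x) ^ (n - 1) * (1 - (1 - gauss_tail (sqrt 2 * x)) ^ (n - 1))))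
       = ennreal (std_normal_density x * (1 - gauss_tail x) ^ (n - 1))"
        by (simp add: power_le_one)
      then show "ennreal (std_normal_density x * (1 - gauss_tail x) ^ (n - 1)) * indicator {t0..} x =
       ennreal (std_normal_density x * ((1 - gauss_tail x) ^ (n - 1) * (1 - gauss_tail (sqrt 2 * x)) ^ (n - 1))) * indicator {t0..} x
       + ennreal (std_normal_density x * ((1 - gauss_tail x) ^ (n - 1) * (1 - (1 - gauss_tail (sqrt 2 * x)) ^ (n - 1)))) * indicator {t0..} x"
        by (simp split: split_indicator)
    qed
  qed measurable
  ultimately have "emeasure M H + emeasure M (strict_argmax_below_row t0 l) = emeasure M H + ?I" by simp
  then show ?thesis unfolding ennreal_add_left_cancel by simp
qed

end

section \<open>Supports with at least three points\<close>

context GOE_space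
begin

definition heavy_column :: "real \<Rightarrow> 'a set" where
  "heavy_column t = {\<omega>\<in>space M. \<exists>S\<in>{S. S \<subseteq> {..<n} \<and> 3 \<le> card S}. \<exists>j\<in>S. real (card S) * t \<le> (\<Sum>i\<in>S. Z (edge i j) \<omega>)}"

text \<open>
  One diagonal entry of variance \<open>1\<close> and \<open>card S - 1\<close> entries of variance \<open>1 / 2\<close>.
\<close>

lemma distributed_column_sum:
  assumes S: "S \<subseteq> {..<n}" "j \<in> S"
  shows "distributed M lborel (\<lambda>\<omega>. \<Sum>i\<in>S. Z (edge i j) \<omega>) (normal_density 0 (sqrt ((real (card S) + 1) / 2)))"
proof -
  have fin: "finite S" using S finite_subset by blast
  define \<sigma> where "\<sigma> p = (if fst p = snd p then 1 else sqrt (1 / 2))" for p :: "nat \<times> nat"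
  define E where "E = (\<lambda>i. edge i j) ` S"
  have inj: "inj_on (\<lambda>i. edge i j) S" by (auto simp: inj_on_def edge_eq_iff)
  have E: "E \<subseteq> idx" using S by (auto simp: E_def intro!: edge_in_idx)
  have "distributed M lborel (\<lambda>\<omega>. \<Sum>p\<in>E. Z p \<omega>) (normal_density (\<Sum>p\<in>E. 0) (sqrt (\<Sum>p\<in>E. (\<sigma> p)\<^sup>2)))"
  proof (rule sum_indep_normal)
    show "finite E" "E \<noteq> {}" using fin S by (auto simp: E_def)
    show "indep_vars (\<lambda>i. borel) Z E" using indep_Z E by (rule indep_vars_subset)
    show "0 < \<sigma> p" for p by (simp add: \<sigma>_def)
    fix p assume "p \<in> E"
    then obtain i where i: "i \<in> S" "p = edge i j" by (auto simp: E_def)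
    show "distributed M lborel (Z p) (normal_density 0 (\<sigma> p))"
      using Z_diagonal[of i] Z_off_diagonal[of i j] S i by (cases "i = j") (auto simp: \<sigma>_def)
  qed
  moreover have "(\<Sum>p\<in>E. Z p \<omega>) = (\<Sum>i\<in>S. Z (edge i j) \<omega>)" for \<omega>
    unfolding E_def by (subst sum.reindex[OF inj]) simp
  moreover have "(\<Sum>p\<in>E. (\<sigma> p)\<^sup>2) = (real (card S) + 1) / 2"
  proof -
    have "(\<Sum>p\<in>E. (\<sigma> p)\<^sup>2) = (\<Sum>i\<in>S. (\<sigma> (edge i j))\<^sup>2)"
      unfolding E_def by (subst sum.reindex[OF inj]) simp
    also have "\<dots> = (\<Sum>i\<in>S. 1 / 2 + (if i = j then 1 / 2 else 0))"
      by (intro sum.cong) (auto simp: \<sigma>_def real_sqrt_divide power_divide)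
    also have "\<dots> = (\<Sum>i\<in>S. 1 / 2) + (\<Sum>i\<in>S. if i = j then 1 / 2 else 0)"
      by (rule sum.distrib)
    also have "\<dots> = (real (card S) + 1) / 2"
      using S fin by (simp add: add_divide_distrib)
    finally show ?thesis .
  qed
  ultimately show ?thesis by simp
qed

text \<open>
  With \<open>k = card S\<close> the exponent is \<open>- k\<^sup>2 t\<^sup>2 / (k + 1)\<close>, and \<open>k / (k + 1) \<ge> 3 / 4\<close>. For \<open>k = 2\<close> the same
  estimate summed over all edges would only give about \<open>n\<close> to the power \<open>- 2 / 3\<close>, which exceeds
  the main term; therefore edges are treated separately.
\<close>

lemma prob_column_sum_le:
  assumes S: "S \<subseteq> {..<n}" "j \<in> S" "3 \<le> card S" and t: "1 \<le> t"
  shows "prob {\<omega>\<in>space M. real (card S) * t \<le> (\<Sum>i\<in>S. Z (edge i j) \<omega>)} \<le> exp (- 3 / 4 * t\<^sup>2) ^ card S"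
proof -
  define k where "k = real (card S)"
  define s where "s = sqrt ((k + 1) / 2)"
  have k: "3 \<le> k" using S by (simp add: k_def)
  have s: "0 < s" "s\<^sup>2 = (k + 1) / 2" using k by (auto simp: s_def)
  have "s \<le> k"
  proof (rule power2_le_imp_le)
    have "k * 1 \<le> k * k" using k by (intro mult_left_mono) auto
    then have "k + 1 \<le> 2 * (k * k)" using k by linarith
    then show "s\<^sup>2 \<le> k\<^sup>2" unfolding s by (simp add: power2_eq_square)
  qed (use k in auto)
  then have 1: "1 \<le> k * t / s" using t s k mult_mono[of s k 1 t] by (simp add: field_simps)
  have "prob {\<omega>\<in>space M. k * t \<le> (\<Sum>i\<in>S. Z (edge i j) \<omega>)} = gauss_tail (k * t / s)"
    by (rule prob_normal_half_lines(2)) (use distributed_column_sum[OF S(1,2)] s in \<open>simp_all add: s_def k_def\<close>)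
  also have "\<dots> \<le> exp (- (k * t / s)\<^sup>2 / 2)" by (rule gauss_tail_le_exp[OF 1])
  also have "- (k * t / s)\<^sup>2 / 2 = - (k / (k + 1) * (k * t\<^sup>2))"
    unfolding power_divide s(2) power_mult_distrib using k by (simp add: power2_eq_square field_simps)
  also have "\<dots> \<le> - (3 / 4 * (k * t\<^sup>2))"
  proof -
    have "3 / 4 \<le> k / (k + 1)" using k by (simp add: field_simps)
    then have "3 / 4 * (k * t\<^sup>2) \<le> k / (k + 1) * (k * t\<^sup>2)" using k by (intro mult_right_mono) auto
    then show ?thesis by simp
  qed
  finally have "prob {\<omega>\<in>space M. k * t \<le> (\<Sum>i\<in>S. Z (edge i j) \<omega>)} \<le> exp (- (3 / 4 * (k * t\<^sup>2)))" by simp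
  also have "\<dots> = exp (- 3 / 4 * t\<^sup>2) ^ card S"
    unfolding k_def exp_of_nat_mult[symmetric] by (simp add: mult_ac)
  finally show ?thesis by (simp add: k_def)
qed

lemma sets_column_sum: "S \<subseteq> {..<n} \<Longrightarrow> j \<in> S \<Longrightarrow> {\<omega>\<in>space M. c \<le> (\<Sum>i\<in>S. Z (edge i j) \<omega>)} \<in> sets M"
  by (intro borel_measurable_le borel_measurable_sum Z_edge_measurable borel_measurable_const) auto

lemma sets_heavy_column [measurable]: "heavy_column t \<in> sets M"
  unfolding heavy_column_def
  by (intro sets.sets_Collect_finite_Ex sets_column_sum) (auto intro: finite_subset)

text \<open>
  There are \<open>k (n choose k) \<le> n\<^sup>k\<close> pairs of a set of size \<open>k\<close> and a column in it, which leaves a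
  geometric series.
\<close>

lemma prob_heavy_column_le:
  assumes t: "1 \<le> t" and z: "real n * exp (- 3 / 4 * t\<^sup>2) \<le> 1 / 2"
  shows "prob (heavy_column t) \<le> 2 * (real n * exp (- 3 / 4 * t\<^sup>2)) ^ 3"
proof -
  define w where "w = exp (- 3 / 4 * t\<^sup>2)"
  define F where "F k = {S. S \<subseteq> {..<n} \<and> card S = k}" for k
  define C where "C S j = {\<omega>\<in>space M. real (card S) * t \<le> (\<Sum>i\<in>S. Z (edge i j) \<omega>)}" for S j
  have finF: "finite (F k)" for k unfolding F_def by (rule finite_subset[of _ "Pow {..<n}"]) auto
  have Cm: "C S j \<in> sets M" if "S \<in> F k" "j \<in> S" for S j k
    unfolding C_def using that by (intro sets_column_sum) (auto simp: F_def)
  have fin: "finite S" if "S \<in> F k" for S k using that by (auto simp: F_def intro: finite_subset)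
  have UCm: "(\<Union>j\<in>S. C S j) \<in> sets M" if "S \<in> F k" for S k
    using Cm that fin by (intro sets.finite_UN) auto
  have card_bound: "card S \<le> n" if "S \<subseteq> {..<n}" for S using card_mono[OF _ that] by simp
  have "heavy_column t \<subseteq> (\<Union>k\<in>{3..n}. \<Union>S\<in>F k. \<Union>j\<in>S. C S j)"
  proof
    fix \<omega> assume "\<omega> \<in> heavy_column t"
    then obtain S j where S: "S \<subseteq> {..<n}" "3 \<le> card S" "j \<in> S" "\<omega> \<in> C S j"
      by (auto simp: heavy_column_def C_def)
    then have "card S \<in> {3..n}" "S \<in> F (card S)" using card_bound by (auto simp: F_def)
    then show "\<omega> \<in> (\<Union>k\<in>{3..n}. \<Union>S\<in>F k. \<Union>j\<in>S. C S j)" using S by blast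
  qed
  moreover have "(\<Union>k\<in>{3..n}. \<Union>S\<in>F k. \<Union>j\<in>S. C S j) \<in> sets M"
    by (rule sets.finite_UN, simp, rule sets.finite_UN[OF finF UCm])
  ultimately have "prob (heavy_column t) \<le> prob (\<Union>k\<in>{3..n}. \<Union>S\<in>F k. \<Union>j\<in>S. C S j)"
    by (rule finite_measure_mono)
  also have "\<dots> \<le> (\<Sum>k=3..n. prob (\<Union>S\<in>F k. \<Union>j\<in>S. C S j))"
    using UCm finF by (intro finite_measure_subadditive_finite) auto
  also have "\<dots> \<le> (\<Sum>k=3..n. (real n * w) ^ k)"
  proof (rule sum_mono)
    fix k assume k: "k \<in> {3..n}"
    have "prob (\<Union>S\<in>F k. \<Union>j\<in>S. C S j) \<le> (\<Sum>S\<in>F k. prob (\<Union>j\<in>S. C S j))"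
      using UCm finF by (intro finite_measure_subadditive_finite) auto
    also have "\<dots> \<le> (\<Sum>S\<in>F k. real k * w ^ k)"
    proof (rule sum_mono)
      fix S assume S: "S \<in> F k"
      have "prob (\<Union>j\<in>S. C S j) \<le> (\<Sum>j\<in>S. prob (C S j))"
        using Cm[OF S] fin[OF S] by (intro finite_measure_subadditive_finite) auto
      also have "\<dots> \<le> (\<Sum>j\<in>S. w ^ k)"
        using S k t prob_column_sum_le[of S] by (intro sum_mono) (auto simp: F_def C_def w_def)
      finally show "prob (\<Union>j\<in>S. C S j) \<le> real k * w ^ k" using S by (simp add: F_def)
    qed
    also have "\<dots> = real (k * (n choose k)) * w ^ k"
      using n_subsets[of "{..<n}" k] by (simp add: F_def)
    also have "\<dots> \<le> real (n ^ k) * w ^ k"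
    proof (intro mult_right_mono of_nat_mono)
      have "k * (n choose k) = n * ((n - 1) choose (k - 1))"
        using k by (intro times_binomial_minus1_eq) simp
      also have "\<dots> \<le> n * (n - 1) ^ (k - 1)"
        using k by (intro mult_left_mono binomial_le_pow) auto
      also have "\<dots> \<le> n * n ^ (k - 1)" by (intro mult_left_mono power_mono) auto
      also have "\<dots> = n ^ k" using k by (simp add: power_eq_if)
      finally show "k * (n choose k) \<le> n ^ k" .
    qed (simp add: w_def)
    finally show "prob (\<Union>S\<in>F k. \<Union>j\<in>S. C S j) \<le> (real n * w) ^ k" by (simp add: power_mult_distrib)
  qed
  also have "\<dots> \<le> 2 * (real n * w) ^ 3"
    using z by (intro sum_powers_from_3_le) (auto simp: w_def)
  finally show ?thesis by (simp add: w_def)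
qed

end

section \<open>Edges away from the largest diagonal entry\<close>

text \<open>
  The conclusion of \<open>edge_minimum_below\<close> with reversed signs: \<open>a\<close> and \<open>c\<close> are the diagonal entries
  and \<open>b\<close> the off-diagonal entry of an edge whose minimum is at most \<open>- x\<close>.
\<close>

definition stray :: "real \<Rightarrow> real \<Rightarrow> real \<Rightarrow> real \<Rightarrow> bool" where
  "stray x a b c \<longleftrightarrow> a \<le> x \<and> x \<le> b \<and> x - a \<le> b - x \<and> (c \<le> x / 2 \<longrightarrow> x - a \<le> 2 * (b - x)\<^sup>2 / x)"

text \<open>
  The Beta integral of \<open>u\<^sup>3 (1 - u)\<^bsup>n - 3\<^esup>\<close> multiplied by the constant and the factor \<open>1 / t\<close> that
  remain from the bound for fixed values of the largest diagonal entry.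
\<close>

definition stray_bound :: "nat \<Rightarrow> real \<Rightarrow> real" where
  "stray_bound n t = 12 * (2 * sqrt (2 * pi)) ^ 3 / t * (6 / ((real n + 1) * real n * (real n - 1) * (real n - 2)))"

context GOE_space
begin

text \<open>
  Given the off-diagonal entry \<open>b = x + h\<close>, the diagonal entry lies in an interval of length
  \<open>y b \<le> h\<close> below \<open>x\<close>. The densities contribute \<open>exp (- (x + h)\<^sup>2)\<close> and at most \<open>exp (x h - x\<^sup>2 / 2)\<close>;
  the product is at most \<open>exp (- 3 / 2 x\<^sup>2 - x h)\<close>, so \<open>h\<close> is effectively exponential with rate \<open>x\<close>. The
  conditions \<open>R\<close> on further entries are independent of this.
\<close>

lemma emeasure_near_vertex_and_edge:
  fixes y :: "real \<Rightarrow> real" and R :: "nat \<times> nat \<Rightarrow> real \<Rightarrow> bool"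
  assumes ij: "i < n" "j < n" "i \<noteq> j" and x: "0 < x"
    and J: "finite J" "J \<subseteq> idx - {edge i j, (i, i)}"
    and R: "\<And>e. e \<in> J \<Longrightarrow> Measurable.pred borel (R e)"
    and y [measurable]: "y \<in> borel_measurable borel" and y_le: "\<And>b. x \<le> b \<Longrightarrow> 0 \<le> y b \<and> y b \<le> b - x"
  shows "emeasure M {\<omega>\<in>space M. x \<le> Z (edge i j) \<omega> \<and> x - y (Z (edge i j) \<omega>) \<le> Z (i, i) \<omega> \<and> Z (i, i) \<omega> \<le> x \<and> (\<forall>e\<in>J. R e (Z e \<omega>))}
    \<le> ennreal ((\<Prod>e\<in>J. prob {\<omega>\<in>space M. R e (Z e \<omega>)}) * exp (- 3 / 2 * x\<^sup>2)) * (\<integral>\<^sup>+b\<in>{x..}. ennreal (y b * exp (- (x * (b - x)))) \<partial>lborel)"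
proof -
  define P where "P e b z \<longleftrightarrow> (if e = (i, i) then x - y b \<le> z \<and> z \<le> x else R e z)" for e b z
  define K where "K = (\<Prod>e\<in>J. prob {\<omega>\<in>space M. R e (Z e \<omega>)})"
  have K: "0 \<le> K" unfolding K_def by (intro prod_nonneg) simp
  define I where "I = insert (i, i) J"
  have I: "I \<subseteq> idx - {edge i j}" "finite I"
    using J ij by (auto simp: I_def idx_def edge_def)
  have inot: "(i, i) \<notin> J" using J by auto
  have "{\<omega>\<in>space M. x \<le> Z (edge i j) \<omega> \<and> x - y (Z (edge i j) \<omega>) \<le> Z (i, i) \<omega> \<and> Z (i, i) \<omega> \<le> x \<and> (\<forall>e\<in>J. R e (Z e \<omega>))}
     = {\<omega>\<in>space M. Z (edge i j) \<omega> \<in> {x..} \<and> (\<forall>e\<in>I. P e (Z (edge i j) \<omega>) (Z e \<omega>))}"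
    using inot by (auto simp: I_def P_def)
  then have "emeasure M {\<omega>\<in>space M. x \<le> Z (edge i j) \<omega> \<and> x - y (Z (edge i j) \<omega>) \<le> Z (i, i) \<omega> \<and> Z (i, i) \<omega> \<le> x \<and> (\<forall>e\<in>J. R e (Z e \<omega>))}
    = emeasure M {\<omega>\<in>space M. Z (edge i j) \<omega> \<in> {x..} \<and> (\<forall>e\<in>I. P e (Z (edge i j) \<omega>) (Z e \<omega>))}"
    by simp
  also have "\<dots> = (\<integral>\<^sup>+b\<in>{x..}. ennreal (normal_density 0 (sqrt (1 / 2)) b) * ennreal (\<Prod>e\<in>I. prob {\<omega>\<in>space M. P e b (Z e \<omega>)}) \<partial>lborel)"
  proof (rule emeasure_conditionally_independent[OF indep_Z _ _ I])
    show "Measurable.pred (borel \<Otimes>\<^sub>M borel) (\<lambda>p. P e (fst p) (snd p))" if "e \<in> I" for e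
    proof (cases "e = (i, i)")
      case True then show ?thesis unfolding P_def by simp measurable
    next
      case False
      then have "e \<in> J" using that by (simp add: I_def)
      from measurable_compose[OF measurable_snd R[OF this]] False show ?thesis by (simp add: P_def)
    qed
  qed (use ij in \<open>auto intro: Z_off_diagonal edge_in_idx\<close>)
  also have "\<dots> \<le> (\<integral>\<^sup>+b. ennreal (K * exp (- 3 / 2 * x\<^sup>2)) * (ennreal (y b * exp (- (x * (b - x)))) * indicator {x..} b) \<partial>lborel)"
  proof (rule nn_integral_mono)
    fix b
    show "ennreal (normal_density 0 (sqrt (1 / 2)) b) * ennreal (\<Prod>e\<in>I. prob {\<omega>\<in>space M. P e b (Z e \<omega>)}) * indicator {x..} b
      \<le> ennreal (K * exp (- 3 / 2 * x\<^sup>2)) * (ennreal (y b * exp (- (x * (b - x)))) * indicator {x..} b)"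
    proof (cases "x \<le> b")
      case True
      note yb = y_le[OF True]
      have "(\<Prod>e\<in>I. prob {\<omega>\<in>space M. P e b (Z e \<omega>)}) = prob {\<omega>\<in>space M. x - y b \<le> Z (i, i) \<omega> \<and> Z (i, i) \<omega> \<le> x} * K"
      proof -
        have "{\<omega>\<in>space M. P e b (Z e \<omega>)} = {\<omega>\<in>space M. R e (Z e \<omega>)}" if "e \<in> J" for e
          using that inot by (auto simp: P_def)
        then show ?thesis
          unfolding I_def K_def using J inot by (subst prod.insert) (simp_all add: P_def)
      qed
      also have "\<dots> \<le> (y b * exp (x * y b - x\<^sup>2 / 2)) * K"
        using prob_std_normal_interval_le[OF Z_diagonal[OF ij(1)], of "y b" x] yb x K by (intro mult_right_mono) auto
      also have "\<dots> \<le> (y b * exp (x * (b - x) - x\<^sup>2 / 2)) * K"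
        using yb x K by (intro mult_right_mono mult_left_mono) auto
      finally have 1: "(\<Prod>e\<in>I. prob {\<omega>\<in>space M. P e b (Z e \<omega>)}) \<le> (y b * exp (x * (b - x) - x\<^sup>2 / 2)) * K" .
      have "1 \<le> sqrt pi" using pi_gt3 by (intro real_le_rsqrt) simp
      then have "normal_density 0 (sqrt (1 / 2)) b \<le> exp (- b\<^sup>2)"
        by (simp add: normal_density_def divide_le_eq power_divide real_sqrt_divide)
      also have "\<dots> \<le> exp (- x\<^sup>2 - 2 * (x * (b - x)))"
        using zero_le_power2[of "b - x"] by (simp add: power2_eq_square algebra_simps)
      finally have 2: "normal_density 0 (sqrt (1 / 2)) b \<le> exp (- x\<^sup>2 - 2 * (x * (b - x)))" .
      have "normal_density 0 (sqrt (1 / 2)) b * (\<Prod>e\<in>I. prob {\<omega>\<in>space M. P e b (Z e \<omega>)})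
        \<le> exp (- x\<^sup>2 - 2 * (x * (b - x))) * ((y b * exp (x * (b - x) - x\<^sup>2 / 2)) * K)"
        by (intro mult_mono 1 2 prod_nonneg) auto
      also have "\<dots> = K * exp (- 3 / 2 * x\<^sup>2) * (y b * exp (- (x * (b - x))))"
      proof -
        have "exp (- x\<^sup>2 - 2 * (x * (b - x))) * exp (x * (b - x) - x\<^sup>2 / 2) = exp (- 3 / 2 * x\<^sup>2) * exp (- (x * (b - x)))"
          unfolding exp_add[symmetric] by simp
        then show ?thesis by simp
      qed
      finally show ?thesis using True K yb
        by (simp add: ennreal_mult[symmetric] prod_nonneg ennreal_leI)
    qed simp
  qed
  also have "\<dots> = ennreal (K * exp (- 3 / 2 * x\<^sup>2)) * (\<integral>\<^sup>+b\<in>{x..}. ennreal (y b * exp (- (x * (b - x)))) \<partial>lborel)"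
    by (rule nn_integral_cmult) measurable
  finally show ?thesis by (simp add: K_def)
qed

definition stray_edge :: "real \<Rightarrow> nat \<Rightarrow> nat \<Rightarrow> nat \<Rightarrow> 'a set" where
  "stray_edge t l i j = {\<omega>\<in>space M. t \<le> Z (l, l) \<omega> \<and> (\<forall>p\<in>{..<n} - {l, i, j}. Z (p, p) \<omega> \<le> Z (l, l) \<omega>)
     \<and> stray (Z (l, l) \<omega>) (Z (i, i) \<omega>) (Z (edge i j) \<omega>) (Z (j, j) \<omega>)}"

text \<open>
  If the second diagonal entry is at least \<open>x / 2\<close>, then this alone has probability at most
  \<open>8 / x\<^sup>2\<close>, and the linear bound on the gap suffices. Otherwise the quadratic bound on the
  gap gives two additional powers of \<open>1 / x\<close>. Either way the power \<open>x\<^sup>4\<close> appears in the denominator, whereas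
  the linear bound alone would only give \<open>x\<^sup>2\<close> and thus the order of the main term.
\<close>

lemma stray_slice:
  assumes ij: "i < n" "j < n" "i \<noteq> j" and l: "l < n" "l \<noteq> i" "l \<noteq> j" and x: "2 \<le> x"
  shows "emeasure M {\<omega>\<in>space M. (\<forall>p\<in>{..<n} - {l, i, j}. Z (p, p) \<omega> \<le> x) \<and> stray x (Z (i, i) \<omega>) (Z (edge i j) \<omega>) (Z (j, j) \<omega>)}
    \<le> ennreal ((1 - gauss_tail x) ^ (n - 3) * (12 * exp (- 3 / 2 * x\<^sup>2) / x ^ 4))"
proof -
  define S where "S = {..<n} - {l, i, j}"
  define K where "K = (1 - gauss_tail x) ^ (n - 3)"
  define y where "y b = min (b - x) (2 * (b - x)\<^sup>2 / x)" for b
  have K: "0 \<le> K" by (simp add: K_def)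
  have cardS: "card S = n - 3"
    using ij l by (simp add: S_def card_Diff_subset)
  have pK: "(\<Prod>e\<in>diag S. prob {\<omega>\<in>space M. Z e \<omega> \<le> x}) = K"
    unfolding prod_diag K_def cardS[symmetric] by (simp add: S_def prob_Z_diagonal)
  have Sd: "diag S \<subseteq> idx - {edge i j, (i, i), (j, j)}" "finite (diag S)"
    using ij by (auto simp: S_def diag_def idx_def edge_def min_def max_def)
  define R where "R e z \<longleftrightarrow> (if e = (j, j) then x / 2 \<le> z else z \<le> x)" for e :: "nat \<times> nat" and z
  define E1 where "E1 = {\<omega>\<in>space M. x \<le> Z (edge i j) \<omega> \<and> x - (Z (edge i j) \<omega> - x) \<le> Z (i, i) \<omega> \<and> Z (i, i) \<omega> \<le> x \<and> (\<forall>e\<in>insert (j, j) (diag S). R e (Z e \<omega>))}"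
  define E2 where "E2 = {\<omega>\<in>space M. x \<le> Z (edge i j) \<omega> \<and> x - y (Z (edge i j) \<omega>) \<le> Z (i, i) \<omega> \<and> Z (i, i) \<omega> \<le> x \<and> (\<forall>e\<in>diag S. Z e \<omega> \<le> x)}"
  have "emeasure M E1 \<le> ennreal ((\<Prod>e\<in>insert (j, j) (diag S). prob {\<omega>\<in>space M. R e (Z e \<omega>)}) * exp (- 3 / 2 * x\<^sup>2))
      * (\<integral>\<^sup>+b\<in>{x..}. ennreal ((b - x) * exp (- (x * (b - x)))) \<partial>lborel)"
    unfolding E1_def
  proof (rule emeasure_near_vertex_and_edge[OF ij])
    show "Measurable.pred borel (R e)" for e unfolding R_def by measurable
    show "insert (j, j) (diag S) \<subseteq> idx - {edge i j, (i, i)}"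
      using Sd ij by (auto simp: idx_def edge_def)
  qed (use x Sd in auto)
  also have "(\<Prod>e\<in>insert (j, j) (diag S). prob {\<omega>\<in>space M. R e (Z e \<omega>)}) = gauss_tail (x / 2) * K"
  proof -
    have jS: "(j, j) \<notin> diag S" using Sd by blast
    then have "{\<omega>\<in>space M. R e (Z e \<omega>)} = {\<omega>\<in>space M. Z e \<omega> \<le> x}" if "e \<in> diag S" for e
      using that by (auto simp: R_def)
    moreover have "prob {\<omega>\<in>space M. R (j, j) (Z (j, j) \<omega>)} = gauss_tail (x / 2)"
      using prob_Z_diagonal(1)[OF ij(2), of "x / 2"] by (simp only: R_def if_True refl)
    ultimately show ?thesis
      unfolding pK[symmetric] using Sd(2) jS by (subst prod.insert) simp_all
  qed
  finally have e1: "emeasure M E1 \<le> ennreal (K * (gauss_tail (x / 2) * exp (- 3 / 2 * x\<^sup>2) / x\<^sup>2))"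
    using x K by (subst (asm) nn_integral_shifted_exponential_1) (auto simp: ennreal_mult[symmetric] mult_ac)
  have g: "gauss_tail (x / 2) \<le> 8 / x\<^sup>2"
  proof -
    have "gauss_tail (x / 2) \<le> exp (- (x / 2)\<^sup>2 / 2)" using x by (intro gauss_tail_le_exp) simp
    also have "\<dots> = exp (- (x\<^sup>2 / 8))" by (simp add: power_divide)
    also have "\<dots> \<le> 1 / (x\<^sup>2 / 8)" using x by (intro exp_le_inverse) simp
    finally show ?thesis by simp
  qed
  have "K * (gauss_tail (x / 2) * exp (- 3 / 2 * x\<^sup>2) / x\<^sup>2) \<le> K * ((8 / x\<^sup>2) * exp (- 3 / 2 * x\<^sup>2) / x\<^sup>2)"
    using g K by (intro mult_left_mono divide_right_mono mult_right_mono) auto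
  then have e1': "emeasure M E1 \<le> ennreal (K * (8 * exp (- 3 / 2 * x\<^sup>2) / x ^ 4))"
  proof -
    have "K * ((8 / x\<^sup>2) * exp (- 3 / 2 * x\<^sup>2) / x\<^sup>2) = K * (8 * exp (- 3 / 2 * x\<^sup>2) / x ^ 4)"
      by (simp add: power2_eq_square power4_eq_xxxx mult_ac)
    then show ?thesis
      using order_trans[OF e1 ennreal_leI[OF \<open>K * (gauss_tail (x / 2) * exp (- 3 / 2 * x\<^sup>2) / x\<^sup>2) \<le> _\<close>]] by simp
  qed
  have "emeasure M E2 \<le> ennreal ((\<Prod>e\<in>diag S. prob {\<omega>\<in>space M. Z e \<omega> \<le> x}) * exp (- 3 / 2 * x\<^sup>2))
      * (\<integral>\<^sup>+b\<in>{x..}. ennreal (y b * exp (- (x * (b - x)))) \<partial>lborel)"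
    unfolding E2_def
    by (rule emeasure_near_vertex_and_edge[OF ij]) (use x Sd in \<open>auto simp: y_def\<close>)
  moreover have "(\<integral>\<^sup>+b\<in>{x..}. ennreal (y b * exp (- (x * (b - x)))) \<partial>lborel) \<le> ennreal (4 / x ^ 4)"
  proof -
    have "(\<integral>\<^sup>+b\<in>{x..}. ennreal (y b * exp (- (x * (b - x)))) \<partial>lborel)
       \<le> (\<integral>\<^sup>+b. ennreal (2 / x) * (ennreal ((b - x)\<^sup>2 * exp (- (x * (b - x)))) * indicator {x..} b) \<partial>lborel)"
    proof (rule nn_integral_mono)
      fix b
      have "y b * exp (- (x * (b - x))) \<le> (2 / x) * ((b - x)\<^sup>2 * exp (- (x * (b - x))))"
        unfolding y_def mult.assoc[symmetric] by (intro mult_right_mono) auto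
      then show "ennreal (y b * exp (- (x * (b - x)))) * indicator {x..} b \<le> ennreal (2 / x) * (ennreal ((b - x)\<^sup>2 * exp (- (x * (b - x)))) * indicator {x..} b)"
        using x by (simp add: ennreal_mult[symmetric] ennreal_leI split: split_indicator)
    qed
    also have "\<dots> = ennreal (2 / x) * (\<integral>\<^sup>+b\<in>{x..}. ennreal ((b - x)\<^sup>2 * exp (- (x * (b - x)))) \<partial>lborel)"
      by (rule nn_integral_cmult) measurable
    also have "(\<integral>\<^sup>+b\<in>{x..}. ennreal ((b - x)\<^sup>2 * exp (- (x * (b - x)))) \<partial>lborel) = ennreal (2 / x ^ 3)"
      using x by (intro nn_integral_shifted_exponential_2) simp
    also have "ennreal (2 / x) * ennreal (2 / x ^ 3) = ennreal (4 / x ^ 4)"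
      using x by (simp add: ennreal_mult[symmetric] power4_eq_xxxx power3_eq_cube)
    finally show ?thesis .
  qed
  ultimately have "emeasure M E2 \<le> ennreal (K * exp (- 3 / 2 * x\<^sup>2)) * ennreal (4 / x ^ 4)"
    unfolding pK by (rule order_trans[OF _ mult_left_mono]) simp
  then have e2: "emeasure M E2 \<le> ennreal (K * (4 * exp (- 3 / 2 * x\<^sup>2) / x ^ 4))"
    using x K by (simp add: ennreal_mult[symmetric] mult_ac)
  have E: "E1 \<in> sets M" "E2 \<in> sets M"
  proof -
    have Zm: "Z e \<in> borel_measurable M" if "e \<in> insert (j, j) (insert (i, i) (insert (edge i j) (diag S)))" for e
      using that Sd ij by (intro Z_measurable) (auto simp: idx_def edge_def)
    have [measurable]: "y \<in> borel_measurable borel" unfolding y_def by measurable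
    have Zij [measurable]: "Z (edge i j) \<in> borel_measurable M" "Z (i, i) \<in> borel_measurable M" using Zm by auto
    have R: "{\<omega>\<in>space M. R e (Z e \<omega>)} \<in> sets M" if "e \<in> insert (j, j) (diag S)" for e
    proof -
      have [measurable]: "Z e \<in> borel_measurable M" by (intro Zm) (use that in auto)
      show ?thesis unfolding R_def by measurable
    qed
    have R2: "{\<omega>\<in>space M. Z e \<omega> \<le> x} \<in> sets M" if "e \<in> diag S" for e
    proof -
      have [measurable]: "Z e \<in> borel_measurable M" by (intro Zm) (use that in auto)
      show ?thesis by measurable
    qed
    have [measurable]: "Measurable.pred M (\<lambda>\<omega>. \<forall>e\<in>insert (j, j) (diag S). R e (Z e \<omega>))"
      unfolding pred_def by (intro sets.sets_Collect_finite_All R) (use Sd in auto)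
    show "E1 \<in> sets M" unfolding E1_def by measurable
    have [measurable]: "Measurable.pred M (\<lambda>\<omega>. \<forall>e\<in>diag S. Z e \<omega> \<le> x)"
      unfolding pred_def by (intro sets.sets_Collect_finite_All R2) (use Sd in auto)
    show "E2 \<in> sets M" unfolding E2_def by measurable
  qed
  have "{\<omega>\<in>space M. (\<forall>p\<in>{..<n} - {l, i, j}. Z (p, p) \<omega> \<le> x) \<and> stray x (Z (i, i) \<omega>) (Z (edge i j) \<omega>) (Z (j, j) \<omega>)} \<subseteq> E1 \<union> E2"
  proof
    fix \<omega> assume "\<omega> \<in> {\<omega>\<in>space M. (\<forall>p\<in>{..<n} - {l, i, j}. Z (p, p) \<omega> \<le> x) \<and> stray x (Z (i, i) \<omega>) (Z (edge i j) \<omega>) (Z (j, j) \<omega>)}"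
    then have \<omega>: "\<omega> \<in> space M" "\<forall>p\<in>S. Z (p, p) \<omega> \<le> x" and st: "stray x (Z (i, i) \<omega>) (Z (edge i j) \<omega>) (Z (j, j) \<omega>)"
      by (auto simp: S_def)
    have "j \<notin> S" by (simp add: S_def)
    show "\<omega> \<in> E1 \<union> E2"
    proof (cases "x / 2 \<le> Z (j, j) \<omega>")
      case True
      then have "\<omega> \<in> E1" using \<omega> st \<open>j \<notin> S\<close> by (auto simp: E1_def R_def stray_def)
      then show ?thesis ..
    next
      case False
      then have "\<omega> \<in> E2" using \<omega> st by (auto simp: E2_def y_def stray_def min_def)
      then show ?thesis ..
    qed
  qed
  then have "emeasure M {\<omega>\<in>space M. (\<forall>p\<in>{..<n} - {l, i, j}. Z (p, p) \<omega> \<le> x) \<and> stray x (Z (i, i) \<omega>) (Z (edge i j) \<omega>) (Z (j, j) \<omega>)} \<le> emeasure M (E1 \<union> E2)"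
    using E by (intro emeasure_mono) auto
  also have "\<dots> \<le> emeasure M E1 + emeasure M E2" using E by (intro emeasure_subadditive) auto
  also have "\<dots> \<le> ennreal (K * (8 * exp (- 3 / 2 * x\<^sup>2) / x ^ 4)) + ennreal (K * (4 * exp (- 3 / 2 * x\<^sup>2) / x ^ 4))"
    by (intro add_mono e1' e2)
  also have "\<dots> = ennreal (K * (8 * exp (- 3 / 2 * x\<^sup>2) / x ^ 4) + K * (4 * exp (- 3 / 2 * x\<^sup>2) / x ^ 4))"
    using K by (intro ennreal_plus[symmetric]) auto
  also have "K * (8 * exp (- 3 / 2 * x\<^sup>2) / x ^ 4) + K * (4 * exp (- 3 / 2 * x\<^sup>2) / x ^ 4) = K * (12 * exp (- 3 / 2 * x\<^sup>2) / x ^ 4)"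
    by (simp add: field_simps)
  finally show ?thesis by (simp add: K_def)
qed

lemma sets_argmax_below_row [measurable]: "l < n \<Longrightarrow> j < n \<Longrightarrow> argmax_below_row t l j \<in> sets M"
  unfolding argmax_below_row_def
  by (intro sets.sets_Collect_conj sets.sets_Collect_finite_All
      borel_measurable_less borel_measurable_le Z_diagonal_measurable Z_edge_measurable measurable_const) auto

lemma sets_stray_edge [measurable]:
  assumes [simp]: "l < n" "i < n" "j < n" shows "stray_edge t l i j \<in> sets M"
proof -
  have [measurable]: "Z (l, l) \<in> borel_measurable M" "Z (i, i) \<in> borel_measurable M" "Z (j, j) \<in> borel_measurable M"
    "Z (edge i j) \<in> borel_measurable M"
    by (auto intro!: Z_diagonal_measurable Z_edge_measurable)
  have "{\<omega>\<in>space M. stray (Z (l, l) \<omega>) (Z (i, i) \<omega>) (Z (edge i j) \<omega>) (Z (j, j) \<omega>)} \<in> sets M"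
    unfolding stray_def by measurable
  then show ?thesis unfolding stray_edge_def
    by (intro sets.sets_Collect_conj sets.sets_Collect_finite_All
      borel_measurable_less borel_measurable_le Z_diagonal_measurable Z_edge_measurable measurable_const) auto
qed

lemma prob_stray_edge_le:
  assumes ij: "i < n" "j < n" "i \<noteq> j" and l: "l < n" "l \<noteq> i" "l \<noteq> j" and t: "2 \<le> t"
  shows "prob (stray_edge t l i j) \<le> stray_bound n t"
proof -
  have "card {l, i, j} \<le> card {..<n}" using ij l by (intro card_mono) auto
  then have n: "3 \<le> n" using ij l by simp
  define C where "C = 12 * (2 * sqrt (2 * pi)) ^ 3 / t"
  have C: "0 \<le> C" using t by (simp add: C_def)
  define P where "P x y \<longleftrightarrow> t \<le> x \<and> (\<forall>p\<in>{..<n} - {l, i, j}. y (p, p) \<le> x) \<and> stray x (y (i, i)) (y (edge i j)) (y (j, j))" for x and y :: "nat \<times> nat \<Rightarrow> real"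
  define f where "f x = std_normal_density x * (gauss_tail x ^ 3 * (1 - gauss_tail x) ^ (n - 3))" for x
  have f: "0 \<le> f x" for x by (auto simp: f_def intro!: mult_nonneg_nonneg)
  have other: "(p, p) \<in> idx - {(l, l)}" if "p < n" "p \<noteq> l" for p using that by (auto simp: idx_def)
  have e: "edge i j \<in> idx - {(l, l)}" using ij l edge_in_idx[of i j] by (auto simp: edge_def)
  have "emeasure M (stray_edge t l i j) = emeasure M {\<omega>\<in>space M. P (Z (l, l) \<omega>) (\<lambda>i. Z i \<omega>)}"
    by (simp add: stray_edge_def P_def)
  also have "\<dots> = (\<integral>\<^sup>+x. ennreal (std_normal_density x) * emeasure M {\<omega>\<in>space M. P x (\<lambda>i. Z i \<omega>)} \<partial>lborel)"
  proof (rule emeasure_condition_on_coordinate[OF indep_Z _ Z_diagonal[OF l(1)]])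
    have c [measurable]: "(\<lambda>p. snd p e) \<in> borel_measurable (borel \<Otimes>\<^sub>M Pi\<^sub>M (idx - {(l, l)}) (\<lambda>_. borel :: real measure))"
      if "e \<in> idx - {(l, l)}" for e :: "nat \<times> nat"
      using that by measurable
    note [measurable] = c[OF other[OF ij(1) l(2)[symmetric]]] c[OF other[OF ij(2) l(3)[symmetric]]] c[OF e]
    have "Measurable.pred (borel \<Otimes>\<^sub>M Pi\<^sub>M (idx - {(l, l)}) (\<lambda>_. borel :: real measure)) (\<lambda>p. snd p (q, q) \<le> fst p)"
      if "q \<in> {..<n} - {l, i, j}" for q
    proof -
      have [measurable]: "(\<lambda>p. snd p (q, q)) \<in> borel_measurable (borel \<Otimes>\<^sub>M Pi\<^sub>M (idx - {(l, l)}) (\<lambda>_. borel :: real measure))"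
        by (rule c[OF other]) (use that in auto)
      show ?thesis by measurable
    qed
    then have [measurable]: "Measurable.pred (borel \<Otimes>\<^sub>M Pi\<^sub>M (idx - {(l, l)}) (\<lambda>_. borel :: real measure)) (\<lambda>p. \<forall>q\<in>{..<n} - {l, i, j}. snd p (q, q) \<le> fst p)"
      by (intro pred_intros_finite) auto
    show "Measurable.pred (borel \<Otimes>\<^sub>M Pi\<^sub>M (idx - {(l, l)}) (\<lambda>_. borel :: real measure)) (\<lambda>p. P (fst p) (snd p))"
      unfolding P_def stray_def by measurable
    show "P x y = P x y'" if y: "\<And>k. k \<in> idx - {(l, l)} \<Longrightarrow> y k = y' k" for x y y'
    proof -
      have "y (i, i) = y' (i, i)" "y (j, j) = y' (j, j)" "y (edge i j) = y' (edge i j)"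
        using y other ij l e by auto
      moreover have "(\<forall>p\<in>{..<n} - {l, i, j}. y (p, p) \<le> x) = (\<forall>p\<in>{..<n} - {l, i, j}. y' (p, p) \<le> x)"
        using y other by (intro ball_cong) auto
      ultimately show ?thesis unfolding P_def by simp
    qed
  qed (use l in \<open>simp add: idx_def\<close>)
  also have "\<dots> \<le> (\<integral>\<^sup>+x. ennreal C * (ennreal (f x) * indicator {t..} x) \<partial>lborel)"
  proof (rule nn_integral_mono)
    fix x
    show "ennreal (std_normal_density x) * emeasure M {\<omega>\<in>space M. P x (\<lambda>i. Z i \<omega>)} \<le> ennreal C * (ennreal (f x) * indicator {t..} x)"
    proof (cases "t \<le> x")
      case True
      have "exp (- 3 / 2 * x\<^sup>2) / x ^ 4 \<le> (2 * sqrt (2 * pi)) ^ 3 * gauss_tail x ^ 3 / x"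
        using True t by (intro exp_le_gauss_tail_cube) simp
      also have "\<dots> \<le> (2 * sqrt (2 * pi)) ^ 3 * gauss_tail x ^ 3 / t"
        using True t by (intro divide_left_mono mult_nonneg_nonneg) auto
      finally have "12 * exp (- 3 / 2 * x\<^sup>2) / x ^ 4 \<le> C * gauss_tail x ^ 3" by (simp add: C_def)
      then have "(1 - gauss_tail x) ^ (n - 3) * (12 * exp (- 3 / 2 * x\<^sup>2) / x ^ 4) \<le> (1 - gauss_tail x) ^ (n - 3) * (C * gauss_tail x ^ 3)"
        by (intro mult_left_mono) auto
      then have "emeasure M {\<omega>\<in>space M. P x (\<lambda>i. Z i \<omega>)} \<le> ennreal ((1 - gauss_tail x) ^ (n - 3) * (C * gauss_tail x ^ 3))"
        using order_trans[OF stray_slice[OF ij l, of x] ennreal_leI] True t by (simp add: P_def)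
      then have "ennreal (std_normal_density x) * emeasure M {\<omega>\<in>space M. P x (\<lambda>i. Z i \<omega>)} \<le>
         ennreal (std_normal_density x) * ennreal ((1 - gauss_tail x) ^ (n - 3) * (C * gauss_tail x ^ 3))"
        by (rule mult_left_mono) simp
      also have "\<dots> = ennreal C * ennreal (f x)"
      proof -
        have "std_normal_density x * ((1 - gauss_tail x) ^ (n - 3) * (C * gauss_tail x ^ 3)) = C * f x" by (simp add: f_def mult_ac)
        then show ?thesis using C f by (simp add: ennreal_mult[symmetric])
      qed
      finally show ?thesis using True by simp
    next
      case False then show ?thesis by (simp add: P_def)
    qed
  qed
  also have "\<dots> = ennreal C * (\<integral>\<^sup>+x\<in>{t..}. ennreal (f x) \<partial>lborel)"
    unfolding f_def by (rule nn_integral_cmult) measurable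
  also have "\<dots> = ennreal (C * incomplete_Beta 3 (n - 3) (gauss_tail t))"
    unfolding f_def nn_integral_gauss_tail_Beta using C by (rule ennreal_mult'[symmetric])
  also have "\<dots> \<le> ennreal (C * (fact 3 * fact (n - 3) / fact (3 + (n - 3) + 1)))"
    using C by (intro ennreal_leI mult_left_mono incomplete_Beta_le) auto
  also have "C * (fact 3 * fact (n - 3) / fact (3 + (n - 3) + 1)) = stray_bound n t"
    unfolding fact_3_fact_div[OF n] by (simp add: stray_bound_def C_def)
  finally have "ennreal (prob (stray_edge t l i j)) \<le> ennreal (stray_bound n t)" by (simp add: emeasure_eq_measure)
  moreover have "0 \<le> stray_bound n t" using n t by (simp add: stray_bound_def)
  ultimately show ?thesis by simp
qed

end

section \<open>Almost sure uniqueness\<close>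

context GOE_space
begin

text \<open>
  Outside the range of indices the entries of \<open>Q\<close> are arbitrary functions; setting them to \<open>0\<close> makes the
  matrix a random variable.
\<close>

definition mat :: "'a \<Rightarrow> nat \<Rightarrow> nat \<Rightarrow> real" where
  "mat \<omega> a b = (if a < n \<and> b < n then - Z (edge a b) \<omega> else 0)"

lemma mat_eq: "\<omega> \<in> space M \<Longrightarrow> a < n \<Longrightarrow> b < n \<Longrightarrow> mat \<omega> a b = Q a b \<omega>"
  by (simp add: mat_def Q_eq_Z)

lemma mat_sym: "mat \<omega> a b = mat \<omega> b a"
  by (simp add: mat_def edge_commute)

lemma mat_measurable [measurable]: "mat \<in> borel_measurable M"
proof (intro measurable_coordinatewise_then_product)
  fix a b
  show "(\<lambda>\<omega>. mat \<omega> a b) \<in> borel_measurable M"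
    by (cases "a < n \<and> b < n") (auto simp: mat_def intro!: borel_measurable_uminus Z_edge_measurable)
qed

text \<open>
  With all other entries frozen, ties in the \<open>i\<close>-th coordinate need \<open>Q i i\<close> to lie in a countable set.
\<close>

lemma emeasure_tie_eq_0:
  assumes i: "i < n"
  shows "emeasure M {\<omega>\<in>space M. mat \<omega> \<in> tie n i} = 0"
proof -
  define N where "N = Pi\<^sub>M (idx - {(i, i)}) (\<lambda>_. borel :: real measure)"
  define B where "B p a b = (if a < n \<and> b < n then - (if edge a b = (i, i) then fst p else snd p (edge a b)) else 0)"
    for p :: "real \<times> (nat \<times> nat \<Rightarrow> real)" and a b
  define A where "A = {p \<in> space (borel \<Otimes>\<^sub>M N). B p \<in> tie n i}"
  have Bm: "B \<in> borel_measurable (borel \<Otimes>\<^sub>M N)"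
  proof (intro measurable_coordinatewise_then_product)
    fix a b
    show "(\<lambda>p. B p a b) \<in> borel_measurable (borel \<Otimes>\<^sub>M N)"
    proof (cases "a < n \<and> b < n \<and> edge a b \<noteq> (i, i)")
      case True
      then have "edge a b \<in> idx - {(i, i)}" using edge_in_idx by auto
      then have "(\<lambda>p. - snd p (edge a b)) \<in> borel_measurable (borel \<Otimes>\<^sub>M N)" unfolding N_def by measurable
      then show ?thesis using True by (simp add: B_def)
    next
      case False
      then show ?thesis by (cases "a < n \<and> b < n") (auto simp: B_def)
    qed
  qed
  have A: "A \<in> sets (borel \<Otimes>\<^sub>M N)"
    unfolding A_def using measurable_sets[OF Bm borel_tie[of n i]] by (simp add: vimage_def Int_def conj_commute)
  define Y where "Y \<omega> = restrict (\<lambda>k. Z k \<omega>) (idx - {(i, i)})" for \<omega>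
  have Zm [measurable]: "Z (i, i) \<in> borel_measurable M" using i by (rule Z_diagonal_measurable)
  have Ym: "Y \<in> measurable M N"
    unfolding N_def Y_def[abs_def] by (intro measurable_restrict Z_measurable) auto
  have BY: "B (Z (i, i) \<omega>, Y \<omega>) = mat \<omega>" for \<omega>
  proof (intro ext)
    fix a b
    have "edge a b \<in> idx" if "a < n" "b < n" using that by (rule edge_in_idx)
    then show "B (Z (i, i) \<omega>, Y \<omega>) a b = mat \<omega> a b" by (auto simp: B_def Y_def mat_def)
  qed
  have "{\<omega>\<in>space M. mat \<omega> \<in> tie n i} = {\<omega>\<in>space M. (Z (i, i) \<omega>, Y \<omega>) \<in> A}"
    using measurable_space[OF Ym] BY by (auto simp: A_def space_pair_measure)
  then have "emeasure M {\<omega>\<in>space M. mat \<omega> \<in> tie n i}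
     = (\<integral>\<^sup>+y. emeasure (distr M borel (Z (i, i))) {x. (x, y) \<in> A} \<partial>distr M N Y)"
    using indep_vars_joint_coordinate_rest(2)[OF indep_Z _ A[unfolded N_def]] i
    by (simp add: idx_def Y_def[abs_def] N_def)
  also have "\<dots> = (\<integral>\<^sup>+y. 0 \<partial>distr M N Y)"
  proof (rule nn_integral_cong)
    fix y assume "y \<in> space (distr M N Y)"
    define D where "D = B (0, y)"
    have BD: "B (x, y) = D(i := (D i)(i := - x))" for x
    proof (intro ext)
      fix a b
      have "edge a b = (i, i) \<longleftrightarrow> a = i \<and> b = i" using edge_eq_iff[of a b i i] by simp
      then show "B (x, y) a b = (D(i := (D i)(i := - x))) a b" using i by (cases "a = i \<and> b = i") (auto simp: D_def B_def)
    qed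
    then have "{x. (x, y) \<in> A} \<subseteq> uminus ` {s. D(i := (D i)(i := s)) \<in> tie n i}"
    proof (intro subsetI)
      fix x assume "x \<in> {x. (x, y) \<in> A}"
      then have "B (x, y) \<in> tie n i" by (simp add: A_def)
      then have "- x \<in> {s. D(i := (D i)(i := s)) \<in> tie n i}" unfolding BD by simp
      then show "x \<in> uminus ` {s. D(i := (D i)(i := s)) \<in> tie n i}" by (rule rev_image_eqI) simp
    qed
    then have c: "countable {x. (x, y) \<in> A}"
      by (rule countable_subset) (intro countable_image countable_ties_in_diagonal_entry i)
    then have 0: "{x. (x, y) \<in> A} \<in> null_sets lborel" by (rule countable_imp_null_set_lborel)
    have "distr M borel (Z (i, i)) = density lborel std_normal_density"
      using distributed_distr_eq_density[OF Z_diagonal[OF i]] by (simp add: distr_cong[of M M borel lborel])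
    then have "{x. (x, y) \<in> A} \<in> null_sets (distr M borel (Z (i, i)))"
      using null_setsD2[OF 0] AE_not_in[OF 0] by (auto simp: null_sets_density_iff elim!: eventually_mono)
    then show "emeasure (distr M borel (Z (i, i))) {x. (x, y) \<in> A} = 0" by (rule null_setsD1)
  qed
  finally show ?thesis by simp
qed

lemma AE_unique_minimizer:
  assumes n: "1 \<le> n"
  shows "AE \<omega> in M. \<exists>!x. global_minimizer n (mat \<omega>) x"
proof -
  have "AE \<omega> in M. mat \<omega> \<notin> tie n i" if "i \<in> {..<n}" for i
  proof (rule AE_I[where N = "{\<omega>\<in>space M. mat \<omega> \<in> tie n i}"])
    show "{\<omega>\<in>space M. mat \<omega> \<in> tie n i} \<in> sets M"
      using measurable_sets[OF mat_measurable borel_tie[of n i]] by (simp add: vimage_def Int_def conj_commute)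
  qed (use that emeasure_tie_eq_0 in auto)
  then have "AE \<omega> in M. \<forall>i\<in>{..<n}. mat \<omega> \<notin> tie n i" by (intro AE_finite_allI) auto
  then show ?thesis by (rule eventually_mono) (simp add: unique_minimizer_iff_no_tie[OF n])
qed

abbreviation kappa :: "'a \<Rightarrow> nat" where
  "kappa \<omega> \<equiv> minimizer_support_size n (mat \<omega>)"

lemma kappa_measurable: "1 \<le> n \<Longrightarrow> (\<lambda>\<omega>. real (kappa \<omega>)) \<in> borel_measurable M"
  using measurable_compose[OF mat_measurable borel_measurable_support_size] .

end

section \<open>Bounds for the law of the support size\<close>

context GOE_space
begin

lemma support_ge_3_imp_heavy_column:
  assumes \<omega>: "\<omega> \<in> space M" and x: "global_minimizer n (mat \<omega>) x" and card: "3 \<le> card (supp n x)"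
    and l: "l < n" "t \<le> Z (l, l) \<omega>"
  shows "\<omega> \<in> heavy_column t"
proof -
  define q where "q = quad_form n (mat \<omega>) x"
  have q: "q \<le> - t" using minimizer_value_le_diagonal[OF x l(1)] l by (simp add: q_def mat_def)
  have supp: "supp n x \<subseteq> {..<n}" by (auto simp: supp_def)
  obtain j where j: "j \<in> supp n x" "(\<Sum>i\<in>supp n x. mat \<omega> i j) \<le> real (card (supp n x)) * q"
    using minimizer_small_column_sum[OF mat_sym x] by (auto simp: q_def)
  have "(\<Sum>i\<in>supp n x. mat \<omega> i j) = - (\<Sum>i\<in>supp n x. Z (edge i j) \<omega>)"
    using j supp by (simp add: sum_negf[symmetric]) (intro sum.cong, auto simp: mat_def)
  moreover have "real (card (supp n x)) * q \<le> real (card (supp n x)) * (- t)"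
    using q by (intro mult_left_mono) auto
  ultimately have "real (card (supp n x)) * t \<le> (\<Sum>i\<in>supp n x. Z (edge i j) \<omega>)" using j by simp
  then show ?thesis using \<omega> supp card j by (auto simp: heavy_column_def)
qed

text \<open>
  The deterministic core of the upper bound. For a support \<open>{i, j}\<close> with \<open>Z (i, i)\<close> the larger
  diagonal entry, the edge lemma applies with \<open>m\<close> the negative of the largest diagonal entry. If
  this maximum is attained on the edge, then only the conclusion for the off-diagonal entry is of interest.
\<close>

lemma support_large_imp:
  assumes n: "1 \<le> n" and \<omega>: "\<omega> \<in> space M" and k: "1 < kappa \<omega>" and t: "0 < t"
  shows "\<omega> \<in> no_large_diagonal t \<union> heavy_column t
    \<union> (\<Union>(l, j)\<in>{(l, j). l < n \<and> j < n \<and> l \<noteq> j}. argmax_below_row t l j)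
    \<union> (\<Union>(l, i, j)\<in>{(l, i, j). l < n \<and> i < n \<and> j < n \<and> l \<noteq> i \<and> l \<noteq> j \<and> i \<noteq> j}. stray_edge t l i j)"
proof (cases "\<omega> \<in> no_large_diagonal t")
  case False
  define A where "A = mat \<omega>"
  have AZ: "A a b = - Z (edge a b) \<omega>" if "a < n" "b < n" for a b using that by (simp add: A_def mat_def)
  have sym: "A a b = A b a" for a b by (simp add: A_def mat_sym)
  from k have "\<exists>!x. global_minimizer n A x" by (auto simp: minimizer_support_size_def A_def split: if_splits)
  then obtain x where x: "global_minimizer n A x" and card: "1 < card (supp n x)"
    using minimizer_support_size_eq[of n A] k by (auto simp: A_def)
  define q where "q = quad_form n A x"
  obtain l where l: "l < n" "\<And>p. p < n \<Longrightarrow> Z (p, p) \<omega> \<le> Z (l, l) \<omega>"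
  proof -
    have fin: "finite ((\<lambda>p. Z (p, p) \<omega>) ` {..<n})" "(\<lambda>p. Z (p, p) \<omega>) ` {..<n} \<noteq> {}" using n by (auto simp: lessThan_empty_iff)
    from Max_in[OF this] obtain l where "l < n" "Max ((\<lambda>p. Z (p, p) \<omega>) ` {..<n}) = Z (l, l) \<omega>" by auto
    then show ?thesis using that[of l] Max_ge[OF fin(1)] by auto
  qed
  define m where "m = Z (l, l) \<omega>"
  have m: "t \<le> m" using False \<omega> l unfolding no_large_diagonal_def m_def by force
  have q: "q \<le> - m" using minimizer_value_le_diagonal[OF x l(1)] AZ l by (simp add: q_def m_def)
  have dm: "- m \<le> A p p" if "p < n" for p using l(2)[OF that] AZ[OF that that] by (simp add: m_def)
  have supp: "supp n x \<subseteq> {..<n}" by (auto simp: supp_def)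
  show ?thesis
  proof (cases "3 \<le> card (supp n x)")
    case True
    have "\<omega> \<in> heavy_column t"
      using support_ge_3_imp_heavy_column[OF \<omega> x[unfolded A_def] True l(1)] m by (simp add: m_def)
    then show ?thesis by blast
  next
    case False
    then have "card (supp n x) = 2" using card by simp
    then obtain i j where ij: "supp n x = {i, j}" "i \<noteq> j" "A i i \<le> A j j"
      by (metis card_2_iff insert_commute linear)
    then have ijn: "i < n" "j < n" using supp by auto
    obtain y z where yz: "0 < y" "0 < z" "y + z = 1" "A i i * y + A i j * z = q" "A i j * y + A j j * z = q"
      using minimizer_on_edge[OF sym x ij(1,2)] unfolding q_def by blast
    have b: "A i j \<le> - m" "A i i - (- m) \<le> - m - A i j" "- m / 2 \<le> A j j \<Longrightarrow> A i i - (- m) \<le> 2 * (- m - A i j)\<^sup>2 / (- (- m))"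
      using edge_minimum_below[OF yz(1,2,3,4,5) q dm[OF ijn(1)] ij(3)] m t by auto
    show ?thesis
    proof (cases "l = i \<or> l = j")
      case True
      then obtain p where p: "p < n" "l \<noteq> p" "edge l p = edge i j" using ijn ij(2) edge_commute by metis
      have "\<omega> \<in> argmax_below_row t l p"
        using \<omega> m l b(1) p AZ[OF ijn] unfolding argmax_below_row_def by (auto simp: m_def)
      then show ?thesis using p l by blast
    next
      case False
      have "stray m (Z (i, i) \<omega>) (Z (edge i j) \<omega>) (Z (j, j) \<omega>)"
        unfolding stray_def using b dm[OF ijn(1)] AZ[OF ijn] AZ[OF ijn(1,1)] AZ[OF ijn(2,2)] by (auto simp: power2_commute)
      then have "\<omega> \<in> stray_edge t l i j"
        using \<omega> m l by (auto simp: stray_edge_def m_def)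
      then show ?thesis using False ijn ij l by blast
    qed
  qed
qed simp

lemma strict_argmax_imp_support_2:
  assumes \<omega>: "\<omega> \<in> space M" and ex1: "\<exists>!x. global_minimizer n (mat \<omega>) x"
    and l: "l < n" "\<omega> \<in> strict_argmax_below_row t l" and no: "\<omega> \<notin> heavy_column t"
  shows "kappa \<omega> = 2"
proof -
  define A where "A = mat \<omega>"
  have AZ: "A a b = - Z (edge a b) \<omega>" if "a < n" "b < n" for a b using that by (simp add: A_def mat_def)
  have sym: "A a b = A b a" for a b by (simp add: A_def mat_sym)
  obtain x where x: "global_minimizer n A x" using ex1 by (auto simp: A_def)
  have k: "kappa \<omega> = card (supp n x)" using minimizer_support_size_eq[of n A x] ex1 x by (simp add: A_def)
  have lp: "t \<le> Z (l, l) \<omega>" "\<And>p. p < n \<Longrightarrow> p \<noteq> l \<Longrightarrow> Z (p, p) \<omega> < Z (l, l) \<omega>"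
    using l by (auto simp: strict_argmax_below_row_def)
  obtain j where j: "j < n" "Z (l, l) \<omega> < Z (edge l j) \<omega>" using l by (auto simp: strict_argmax_below_row_def)
  have "card (supp n x) > 1"
    by (rule minimizer_not_vertex[OF sym x l(1) _ j(1)]) (use AZ lp l j in auto)
  moreover have "\<not> 3 \<le> card (supp n x)"
    using support_ge_3_imp_heavy_column[OF \<omega> x[unfolded A_def] _ l(1) lp(1)] no by blast
  ultimately show ?thesis using k by simp
qed

text \<open>
  The union bound over the four kinds of events, with \<open>n (n - 1)\<close> pairs and at most \<open>n\<^sup>3\<close> triples.
\<close>

lemma prob_support_large_le:
  assumes n: "3 \<le> n" and t: "2 \<le> t0" "t0 \<le> t1" and z: "real n * exp (- 3 / 4 * t0\<^sup>2) \<le> 1 / 2"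
  shows "prob {\<omega>\<in>space M. 1 < kappa \<omega>} \<le> (1 - gauss_tail t0) ^ n + 2 * (real n * exp (- 3 / 4 * t0\<^sup>2)) ^ 3
    + real n * (real n - 1) * (sqrt pi * t1 * (1 + 1 / t0\<^sup>2)\<^sup>2 * (2 / (real n * (real n + 1) * (real n + 2))) + exp (- 3 / 2 * t1\<^sup>2))
    + real n ^ 3 * stray_bound n t0"
proof -
  define P where "P = {(l, j). l < n \<and> j < n \<and> l \<noteq> j}"
  define T where "T = {(l, i, j). l < n \<and> i < n \<and> j < n \<and> l \<noteq> i \<and> l \<noteq> j \<and> i \<noteq> j}"
  define W where "W = sqrt pi * t1 * (1 + 1 / t0\<^sup>2)\<^sup>2 * (2 / (real n * (real n + 1) * (real n + 2))) + exp (- 3 / 2 * t1\<^sup>2)"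
  define A where "A = (\<lambda>(l, j). argmax_below_row t0 l j)"
  define B where "B = (\<lambda>(l, i, j). stray_edge t0 l i j)"
  have "P = Sigma {..<n} (\<lambda>l. {..<n} - {l})" by (auto simp: P_def)
  then have P: "finite P" "card P = n * (n - 1)" by auto
  have Tsub: "T \<subseteq> {..<n} \<times> {..<n} \<times> {..<n}" by (auto simp: T_def)
  have T: "finite T" "card T \<le> n ^ 3"
    using finite_subset[OF Tsub] card_mono[OF _ Tsub] by (auto simp: power3_eq_cube)
  have Am: "A p \<in> sets M" if "p \<in> P" for p using that by (auto simp: A_def P_def)
  have Bm: "B p \<in> sets M" if "p \<in> T" for p using that by (auto simp: B_def T_def)
  have UA: "\<Union> (A ` P) \<in> sets M" by (rule sets.finite_UN[OF P(1) Am])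
  have UB: "\<Union> (B ` T) \<in> sets M" by (rule sets.finite_UN[OF T(1) Bm])
  have G: "no_large_diagonal t0 \<in> sets M"
  proof -
    have "no_large_diagonal t0 = {\<omega>\<in>space M. \<forall>l\<in>{..<n}. Z (l, l) \<omega> < t0}" by (auto simp: no_large_diagonal_def)
    also have "\<dots> \<in> sets M"
      by (intro sets.sets_Collect_finite_All borel_measurable_less Z_diagonal_measurable borel_measurable_const) auto
    finally show ?thesis .
  qed
  have W: "prob (A p) \<le> W" if pP: "p \<in> P" for p
  proof -
    obtain l j where p: "p = (l, j)" "l < n" "j < n" "l \<noteq> j" using pP by (auto simp: P_def)
    have "ennreal (prob (A p)) \<le> ennreal (sqrt pi * t1 * (1 + 1 / t0\<^sup>2)\<^sup>2 * (2 / ((real (n - 1) + 1) * (real (n - 1) + 2) * (real (n - 1) + 3))) + exp (- 3 / 2 * t1\<^sup>2))"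
      unfolding p A_def using nn_integral_argmax_below_row_le[of t0 t1 "n - 1"] emeasure_argmax_below_row[OF p(2-4), of t0] t
      by (simp add: emeasure_eq_measure)
    also have "(real (n - 1) + 1) * (real (n - 1) + 2) * (real (n - 1) + 3) = real n * (real n + 1) * (real n + 2)"
      using n by (simp add: of_nat_diff add.commute)
    finally have "ennreal (prob (A p)) \<le> ennreal W" by (simp only: W_def)
    moreover have "0 \<le> W" using t by (simp add: W_def)
    ultimately show ?thesis by simp
  qed
  have S: "prob (B p) \<le> stray_bound n t0" if "p \<in> T" for p
    using that t by (auto simp: B_def T_def intro!: prob_stray_edge_le)
  have "{\<omega>\<in>space M. 1 < kappa \<omega>} \<subseteq> no_large_diagonal t0 \<union> heavy_column t0 \<union> \<Union> (A ` P) \<union> \<Union> (B ` T)"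
    using support_large_imp[of _ t0] n t unfolding A_def B_def P_def T_def by fastforce
  then have "prob {\<omega>\<in>space M. 1 < kappa \<omega>} \<le> prob (no_large_diagonal t0 \<union> heavy_column t0 \<union> \<Union> (A ` P) \<union> \<Union> (B ` T))"
    using G UA UB by (intro finite_measure_mono sets.Un sets_heavy_column) auto
  also have "\<dots> \<le> prob (no_large_diagonal t0 \<union> heavy_column t0 \<union> \<Union> (A ` P)) + prob (\<Union> (B ` T))"
    using G UA UB by (intro measure_Un_le sets.Un sets_heavy_column) auto
  also have "prob (no_large_diagonal t0 \<union> heavy_column t0 \<union> \<Union> (A ` P)) \<le> prob (no_large_diagonal t0 \<union> heavy_column t0) + prob (\<Union> (A ` P))"
    using G UA UB by (intro measure_Un_le sets.Un sets_heavy_column) auto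
  also have "prob (no_large_diagonal t0 \<union> heavy_column t0) \<le> prob (no_large_diagonal t0) + prob (heavy_column t0)"
    using G by (intro measure_Un_le sets_heavy_column) auto
  also have "prob (\<Union> (A ` P)) \<le> real n * (real n - 1) * W"
  proof -
    have "prob (\<Union> (A ` P)) \<le> (\<Sum>p\<in>P. prob (A p))" using P Am by (intro finite_measure_subadditive_finite) auto
    also have "\<dots> \<le> (\<Sum>p\<in>P. W)" by (intro sum_mono W)
    also have "\<dots> = real n * (real n - 1) * W" using P n by (simp add: of_nat_diff)
    finally show ?thesis .
  qed
  also have "prob (\<Union> (B ` T)) \<le> real n ^ 3 * stray_bound n t0"
  proof -
    have "prob (\<Union> (B ` T)) \<le> (\<Sum>p\<in>T. prob (B p))" using T Bm by (intro finite_measure_subadditive_finite) auto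
    also have "\<dots> \<le> (\<Sum>p\<in>T. stray_bound n t0)" by (intro sum_mono S)
    also have "\<dots> = real (card T) * stray_bound n t0" by simp
    also have "\<dots> \<le> real (n ^ 3) * stray_bound n t0"
      using T n t by (intro mult_right_mono of_nat_mono) (auto simp: stray_bound_def)
    finally show ?thesis by simp
  qed
  also have "prob (no_large_diagonal t0) = (1 - gauss_tail t0) ^ n" using n by (intro prob_no_large_diagonal) simp
  also have "prob (heavy_column t0) \<le> 2 * (real n * exp (- 3 / 4 * t0\<^sup>2)) ^ 3"
    using t z by (intro prob_heavy_column_le) auto
  finally show ?thesis by (simp add: W_def)
qed

text \<open>
  The events for different \<open>l\<close> are disjoint, so no second order correction arises between rows.
\<close>

lemma prob_support_eq_2_ge:
  assumes n: "1 \<le> n" and t: "1 \<le> t0" and v: "(real n - 1) * exp (- t0\<^sup>2) \<le> 1" and z: "real n * exp (- 3 / 4 * t0\<^sup>2) \<le> 1 / 2"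
  shows "real n * ((real n - 1) * (1 - (real n - 1) * exp (- t0\<^sup>2)) * (sqrt pi * t0 * (2 * t0\<^sup>2 / (1 + 2 * t0\<^sup>2)))
        * (2 / (real n * (real n + 1) * (real n + 2)) - (1 - gauss_tail t0) ^ (n - 1))) - 2 * (real n * exp (- 3 / 4 * t0\<^sup>2)) ^ 3
     \<le> prob {\<omega>\<in>space M. kappa \<omega> = 2}"
proof -
  define W where "W = (real n - 1) * (1 - (real n - 1) * exp (- t0\<^sup>2)) * (sqrt pi * t0 * (2 * t0\<^sup>2 / (1 + 2 * t0\<^sup>2)))
        * (2 / (real n * (real n + 1) * (real n + 2)) - (1 - gauss_tail t0) ^ (n - 1))"
  have n1: "real (n - 1) = real n - 1" using n by simp
  define A where "A = strict_argmax_below_row t0"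
  have Am: "A l \<in> sets M" if "l \<in> {..<n}" for l using that by (auto simp: A_def)
  have W: "W \<le> prob (A l)" if "l \<in> {..<n}" for l
  proof -
    have "ennreal (real (n - 1) * (1 - real (n - 1) * exp (- t0\<^sup>2)) * (sqrt pi * t0 * (2 * t0\<^sup>2 / (1 + 2 * t0\<^sup>2)))
        * (2 / ((real (n - 1) + 1) * (real (n - 1) + 2) * (real (n - 1) + 3)) - (1 - gauss_tail t0) ^ (n - 1))) \<le> ennreal (prob (A l))"
      using nn_integral_strict_argmax_below_row_ge[OF t, of "n - 1"] emeasure_strict_argmax_below_row[of l t0] that v
      by (simp only: n1 A_def emeasure_eq_measure lessThan_iff)
    also have "(real (n - 1) + 1) * (real (n - 1) + 2) * (real (n - 1) + 3) = real n * (real n + 1) * (real n + 2)"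
      unfolding n1 by (simp add: add.commute)
    finally have "ennreal W \<le> ennreal (prob (A l))" by (simp only: n1 W_def)
    then show ?thesis by (simp add: ennreal_le_iff)
  qed
  have disj: "disjoint_family_on A {..<n}"
    unfolding disjoint_family_on_def
  proof (intro ballI impI)
    fix l k assume lk: "l \<in> {..<n}" "k \<in> {..<n}" "l \<noteq> k"
    have False if "\<omega> \<in> A l" "\<omega> \<in> A k" for \<omega>
    proof -
      have "Z (k, k) \<omega> < Z (l, l) \<omega>" using that(1) lk by (auto simp: A_def strict_argmax_below_row_def)
      moreover have "Z (l, l) \<omega> < Z (k, k) \<omega>" using that(2) lk by (auto simp: A_def strict_argmax_below_row_def)
      ultimately show False by simp
    qed
    then show "A l \<inter> A k = {}" by blast
  qed
  have UA: "\<Union> (A ` {..<n}) \<in> sets M" by (rule sets.finite_UN[OF _ Am]) auto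
  have K: "{\<omega>\<in>space M. kappa \<omega> = 2} \<in> sets M"
  proof -
    note [measurable] = kappa_measurable[OF n]
    have "{\<omega>\<in>space M. real (kappa \<omega>) = 2} \<in> sets M" by measurable
    then show ?thesis by simp
  qed
  have "real n * W = (\<Sum>l<n. W)" by simp
  also have "\<dots> \<le> (\<Sum>l<n. prob (A l))" by (intro sum_mono W)
  also have "\<dots> = prob (\<Union> (A ` {..<n}))"
    using Am disj by (intro finite_measure_finite_Union[symmetric]) auto
  also have "\<dots> \<le> prob ({\<omega>\<in>space M. kappa \<omega> = 2} \<union> heavy_column t0)"
  proof (rule finite_measure_mono_AE)
    show "AE \<omega> in M. \<omega> \<in> \<Union> (A ` {..<n}) \<longrightarrow> \<omega> \<in> {\<omega>\<in>space M. kappa \<omega> = 2} \<union> heavy_column t0"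
      using AE_unique_minimizer[OF n] AE_space
    proof eventually_elim
      case (elim \<omega>)
      then show ?case using strict_argmax_imp_support_2[of \<omega> _ t0] by (auto simp: A_def)
    qed
  qed (use K in auto)
  also have "\<dots> \<le> prob {\<omega>\<in>space M. kappa \<omega> = 2} + prob (heavy_column t0)"
    using K by (intro measure_Un_le) auto
  also have "prob (heavy_column t0) \<le> 2 * (real n * exp (- 3 / 4 * t0\<^sup>2)) ^ 3"
    using t z by (intro prob_heavy_column_le) auto
  finally show ?thesis by (simp add: W_def)
qed

end

section \<open>Asymptotics\<close>

text \<open>
  Squares of the levels that enclose the largest diagonal entry. The lower one is small enough for
  \<open>n gauss_tail t0\<close> to grow like a power of \<open>ln n\<close> greater than one. The upper one only has to make
  \<open>exp (- 3 / 2 t1\<^sup>2)\<close> smaller than \<open>n\<close> to the power \<open>- 3\<close>. Both are asymptotic to \<open>2 ln n\<close>, so replacing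
  \<open>t\<close> by either of them does not change the constant.
\<close>

definition low_level_sq :: "real \<Rightarrow> real" where "low_level_sq x = 2 * ln x - 4 * ln (ln x)"
definition high_level_sq :: "real \<Rightarrow> real" where "high_level_sq x = 2 * ln x + 2 * ln (ln x)"

text \<open>
  The terms of the probability bounds at these two levels are functions of a real variable \<open>x\<close> in
  the place of \<open>n\<close>, so that their limits are instances of multiseries expansion.
\<close>

definition no_large_bound :: "real \<Rightarrow> real" where
  "no_large_bound x = exp (- ((x - 1) * (exp (- low_level_sq x / 2) / sqrt (2 * pi) * (sqrt (low_level_sq x) / (1 + low_level_sq x)))))"

definition heavy_bound :: "real \<Rightarrow> real" where
  "heavy_bound x = 2 * (x * exp (- 3 / 4 * low_level_sq x)) ^ 3"

definition support_upper_bound :: "real \<Rightarrow> real" where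
  "support_upper_bound x = no_large_bound x + heavy_bound x
     + x * (x - 1) * (sqrt pi * sqrt (high_level_sq x) * (1 + 1 / low_level_sq x)\<^sup>2 * (2 / (x * (x + 1) * (x + 2))) + exp (- 3 / 2 * high_level_sq x))
     + x ^ 3 * (12 * (2 * sqrt (2 * pi)) ^ 3 / sqrt (low_level_sq x) * (6 / ((x + 1) * x * (x - 1) * (x - 2))))"

definition support_lower_bound :: "real \<Rightarrow> real" where
  "support_lower_bound x = x * ((x - 1) * (1 - (x - 1) * exp (- low_level_sq x))
       * (sqrt pi * sqrt (low_level_sq x) * (2 * low_level_sq x / (1 + 2 * low_level_sq x))) * (2 / (x * (x + 1) * (x + 2)) - no_large_bound x))
     - heavy_bound x"

lemma no_large_bound_lim: "((\<lambda>x. x / sqrt (ln x) * no_large_bound x) \<longlongrightarrow> 0) at_top"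
  unfolding no_large_bound_def low_level_sq_def by real_asymp

lemma heavy_bound_lim: "((\<lambda>x. x / sqrt (ln x) * heavy_bound x) \<longlongrightarrow> 0) at_top"
  unfolding heavy_bound_def low_level_sq_def by real_asymp

lemma support_upper_bound_lim: "((\<lambda>x. x / sqrt (ln x) * support_upper_bound x) \<longlongrightarrow> 2 * sqrt (2 * pi)) at_top"
proof -
  have a: "((\<lambda>x. x / sqrt (ln x) * (x * (x - 1) * (sqrt (high_level_sq x) * (1 + 1 / low_level_sq x)\<^sup>2 * (2 / (x * (x + 1) * (x + 2)))))) \<longlongrightarrow> 2 * sqrt 2) at_top"
    unfolding low_level_sq_def high_level_sq_def by real_asymp (simp add: powr_half_sqrt)
  have b: "((\<lambda>x. x / sqrt (ln x) * (x * (x - 1) * exp (- 3 / 2 * high_level_sq x))) \<longlongrightarrow> 0) at_top"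
    unfolding high_level_sq_def by real_asymp
  have c: "((\<lambda>x. x / sqrt (ln x) * (x ^ 3 * (1 / sqrt (low_level_sq x) * (6 / ((x + 1) * x * (x - 1) * (x - 2)))))) \<longlongrightarrow> 0) at_top"
    unfolding low_level_sq_def by real_asymp
  have "((\<lambda>x. x / sqrt (ln x) * no_large_bound x + x / sqrt (ln x) * heavy_bound x
     + sqrt pi * (x / sqrt (ln x) * (x * (x - 1) * (sqrt (high_level_sq x) * (1 + 1 / low_level_sq x)\<^sup>2 * (2 / (x * (x + 1) * (x + 2))))))
     + x / sqrt (ln x) * (x * (x - 1) * exp (- 3 / 2 * high_level_sq x))
     + 12 * (2 * sqrt (2 * pi)) ^ 3 * (x / sqrt (ln x) * (x ^ 3 * (1 / sqrt (low_level_sq x) * (6 / ((x + 1) * x * (x - 1) * (x - 2)))))))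
     \<longlongrightarrow> 0 + 0 + sqrt pi * (2 * sqrt 2) + 0 + 12 * (2 * sqrt (2 * pi)) ^ 3 * 0) at_top"
    by (intro tendsto_add tendsto_mult_left no_large_bound_lim heavy_bound_lim a b c)
  moreover have "0 + 0 + sqrt pi * (2 * sqrt 2) + 0 + 12 * (2 * sqrt (2 * pi)) ^ 3 * 0 = 2 * sqrt (2 * pi)"
    by (simp add: real_sqrt_mult)
  moreover have "x / sqrt (ln x) * support_upper_bound x = x / sqrt (ln x) * no_large_bound x + x / sqrt (ln x) * heavy_bound x
     + sqrt pi * (x / sqrt (ln x) * (x * (x - 1) * (sqrt (high_level_sq x) * (1 + 1 / low_level_sq x)\<^sup>2 * (2 / (x * (x + 1) * (x + 2))))))
     + x / sqrt (ln x) * (x * (x - 1) * exp (- 3 / 2 * high_level_sq x))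
     + 12 * (2 * sqrt (2 * pi)) ^ 3 * (x / sqrt (ln x) * (x ^ 3 * (1 / sqrt (low_level_sq x) * (6 / ((x + 1) * x * (x - 1) * (x - 2))))))" for x
  proof -
    have "p * (r + h + y * (sqrt pi * s * w * v + e) + z * (12 * C / u * d)) =
        p * r + p * h + sqrt pi * (p * (y * (s * w * v))) + p * (y * e) + 12 * C * (p * (z * (1 / u * d)))"
      for p r h y s w v e z C u d :: real by (simp add: algebra_simps)
    then show ?thesis unfolding support_upper_bound_def by blast
  qed
  ultimately show ?thesis by (simp only:)
qed

lemma support_lower_bound_lim: "((\<lambda>x. x / sqrt (ln x) * support_lower_bound x) \<longlongrightarrow> 2 * sqrt (2 * pi)) at_top"
proof -
  define g where "g x = x / sqrt (ln x) * (x * ((x - 1) * (1 - (x - 1) * exp (- low_level_sq x)) * (sqrt (low_level_sq x) * (2 * low_level_sq x / (1 + 2 * low_level_sq x)))))" for x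
  have a: "((\<lambda>x. g x * (2 / (x * (x + 1) * (x + 2)))) \<longlongrightarrow> 2 * sqrt 2) at_top"
    unfolding low_level_sq_def g_def by real_asymp (simp add: powr_half_sqrt)
  have b: "((\<lambda>x. g x * no_large_bound x) \<longlongrightarrow> 0) at_top"
    unfolding low_level_sq_def g_def no_large_bound_def by real_asymp
  have "((\<lambda>x. sqrt pi * (g x * (2 / (x * (x + 1) * (x + 2)))) - sqrt pi * (g x * no_large_bound x) - x / sqrt (ln x) * heavy_bound x)
     \<longlongrightarrow> sqrt pi * (2 * sqrt 2) - sqrt pi * 0 - 0) at_top"
    by (intro tendsto_diff tendsto_mult_left heavy_bound_lim a b)
  moreover have "sqrt pi * (2 * sqrt 2) - sqrt pi * 0 - 0 = 2 * sqrt (2 * pi)"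
    by (simp add: real_sqrt_mult)
  moreover have "x / sqrt (ln x) * support_lower_bound x = sqrt pi * (g x * (2 / (x * (x + 1) * (x + 2)))) - sqrt pi * (g x * no_large_bound x) - x / sqrt (ln x) * heavy_bound x" for x
  proof -
    have "p * (x * (q * (sqrt pi * s * w) * (c - d)) - h) = sqrt pi * ((p * (x * (q * (s * w)))) * c) - sqrt pi * ((p * (x * (q * (s * w)))) * d) - p * h"
      for p q s w c d h :: real by (simp add: algebra_simps)
    then show ?thesis unfolding support_lower_bound_def g_def by blast
  qed
  ultimately show ?thesis by (simp only:)
qed

context GOE_space
begin

lemma prob_support_bounds:
  assumes n: "3 \<le> n" and t: "4 \<le> low_level_sq (real n)" "low_level_sq (real n) \<le> high_level_sq (real n)"
    and v: "(real n - 1) * exp (- low_level_sq (real n)) \<le> 1" and z: "real n * exp (- 3 / 4 * low_level_sq (real n)) \<le> 1 / 2"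
  shows "support_lower_bound (real n) \<le> prob {\<omega>\<in>space M. kappa \<omega> = 2}"
    and "prob {\<omega>\<in>space M. kappa \<omega> = 2} \<le> prob {\<omega>\<in>space M. 1 < kappa \<omega>}"
    and "prob {\<omega>\<in>space M. 1 < kappa \<omega>} \<le> support_upper_bound (real n)"
proof -
  define t0 t1 where "t0 = sqrt (low_level_sq (real n))" and "t1 = sqrt (high_level_sq (real n))"
  have sq: "t0\<^sup>2 = low_level_sq (real n)" "t1\<^sup>2 = high_level_sq (real n)" using t by (auto simp: t0_def t1_def)
  have t0: "2 \<le> t0" unfolding t0_def using t by (intro real_le_rsqrt) simp
  have t01: "t0 \<le> t1" unfolding t0_def t1_def using t by simp
  have r: "(1 - gauss_tail t0) ^ (n - 1) \<le> no_large_bound (real n)"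
    using gauss_tail_compl_power_le[of t0 "n - 1"] n unfolding sq no_large_bound_def t0_def[symmetric]
    by (simp add: of_nat_diff)
  have "(1 - gauss_tail t0) ^ n \<le> (1 - gauss_tail t0) ^ (n - 1)" by (intro power_decreasing) auto
  with r have r': "(1 - gauss_tail t0) ^ n \<le> no_large_bound (real n)" by simp
  show "prob {\<omega>\<in>space M. 1 < kappa \<omega>} \<le> support_upper_bound (real n)"
    using prob_support_large_le[OF n t0 t01] z r' unfolding sq
    by (simp add: support_upper_bound_def heavy_bound_def stray_bound_def t0_def t1_def)
  have "(real n - 1) * (1 - (real n - 1) * exp (- t0\<^sup>2)) * (sqrt pi * t0 * (2 * t0\<^sup>2 / (1 + 2 * t0\<^sup>2))) * (2 / (real n * (real n + 1) * (real n + 2)) - no_large_bound (real n))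
    \<le> (real n - 1) * (1 - (real n - 1) * exp (- t0\<^sup>2)) * (sqrt pi * t0 * (2 * t0\<^sup>2 / (1 + 2 * t0\<^sup>2))) * (2 / (real n * (real n + 1) * (real n + 2)) - (1 - gauss_tail t0) ^ (n - 1))"
  proof (rule mult_left_mono)
    show "0 \<le> (real n - 1) * (1 - (real n - 1) * exp (- t0\<^sup>2)) * (sqrt pi * t0 * (2 * t0\<^sup>2 / (1 + 2 * t0\<^sup>2)))"
      using n v t0 unfolding sq(1)[symmetric] by (intro mult_nonneg_nonneg divide_nonneg_nonneg add_nonneg_nonneg) auto
  qed (use r in simp)
  then have "real n * ((real n - 1) * (1 - (real n - 1) * exp (- t0\<^sup>2)) * (sqrt pi * t0 * (2 * t0\<^sup>2 / (1 + 2 * t0\<^sup>2))) * (2 / (real n * (real n + 1) * (real n + 2)) - no_large_bound (real n)))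
    \<le> real n * ((real n - 1) * (1 - (real n - 1) * exp (- t0\<^sup>2)) * (sqrt pi * t0 * (2 * t0\<^sup>2 / (1 + 2 * t0\<^sup>2))) * (2 / (real n * (real n + 1) * (real n + 2)) - (1 - gauss_tail t0) ^ (n - 1)))"
    by (rule mult_left_mono) simp
  moreover have "support_lower_bound (real n) = real n * ((real n - 1) * (1 - (real n - 1) * exp (- t0\<^sup>2)) * (sqrt pi * t0 * (2 * t0\<^sup>2 / (1 + 2 * t0\<^sup>2))) * (2 / (real n * (real n + 1) * (real n + 2)) - no_large_bound (real n))) - 2 * (real n * exp (- 3 / 4 * t0\<^sup>2)) ^ 3"
    unfolding sq unfolding support_lower_bound_def heavy_bound_def t0_def ..
  moreover have "real n * ((real n - 1) * (1 - (real n - 1) * exp (- t0\<^sup>2)) * (sqrt pi * t0 * (2 * t0\<^sup>2 / (1 + 2 * t0\<^sup>2)))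
        * (2 / (real n * (real n + 1) * (real n + 2)) - (1 - gauss_tail t0) ^ (n - 1))) - 2 * (real n * exp (- 3 / 4 * t0\<^sup>2)) ^ 3
     \<le> prob {\<omega>\<in>space M. kappa \<omega> = 2}"
  proof (rule prob_support_eq_2_ge)
    show "1 \<le> n" using n by simp
    show "1 \<le> t0" using t0 by simp
    show "(real n - 1) * exp (- t0\<^sup>2) \<le> 1" "real n * exp (- 3 / 4 * t0\<^sup>2) \<le> 1 / 2"
      unfolding sq by (rule v, rule z)
  qed
  ultimately show "support_lower_bound (real n) \<le> prob {\<omega>\<in>space M. kappa \<omega> = 2}" by linarith
  have "1 \<le> n" using n by simp
  note [measurable] = kappa_measurable[OF this]
  have "{\<omega>\<in>space M. 1 < real (kappa \<omega>)} \<in> sets M" by measurable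
  then show "prob {\<omega>\<in>space M. kappa \<omega> = 2} \<le> prob {\<omega>\<in>space M. 1 < kappa \<omega>}"
    by (intro finite_measure_mono) auto
qed

lemma kappa_eq: "\<omega> \<in> space M \<Longrightarrow> minimizer_support_size n (\<lambda>i j. Q i j \<omega>) = kappa \<omega>"
  by (rule minimizer_support_size_cong) (simp add: mat_eq)

lemma AE_unique_minimizer_Q:
  assumes "1 \<le> n" shows "AE \<omega> in M. \<exists>!x. global_minimizer n (\<lambda>i j. Q i j \<omega>) x"
  using AE_unique_minimizer[OF assms] AE_space
proof eventually_elim
  case (elim \<omega>)
  have "global_minimizer n (\<lambda>i j. Q i j \<omega>) = global_minimizer n (mat \<omega>)"
    using global_minimizer_cong[of n "\<lambda>i j. Q i j \<omega>" "mat \<omega>"] mat_eq elim by (auto simp: fun_eq_iff)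
  then show ?case using elim by simp
qed

end

theorem corollary10p3:
  fixes M :: "nat \<Rightarrow> 'a measure"
    and Q :: "nat \<Rightarrow> nat \<Rightarrow> nat \<Rightarrow> 'a \<Rightarrow> real"
    and \<kappa> :: "nat \<Rightarrow> 'a \<Rightarrow> nat"
  assumes goe: "\<And>n. n \<ge> 1 \<Longrightarrow> GOE (M n) n (Q n)"
    and kappa: "\<And>n \<omega>. \<kappa> n \<omega> = minimizer_support_size n (\<lambda>i j. Q n i j \<omega>)"
  shows "(\<forall>n\<ge>1. AE \<omega> in M n. \<exists>!x. global_minimizer n (\<lambda>i j. Q n i j \<omega>) x) \<and>
    (\<lambda>n. real n / sqrt (ln (real n)) * \<P>(\<omega> in M n. \<kappa> n \<omega> > 1)) \<longlonglongrightarrow> 2 * sqrt (2 * pi) \<and>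
    (\<lambda>n. real n / sqrt (ln (real n)) * \<P>(\<omega> in M n. \<kappa> n \<omega> = 2)) \<longlonglongrightarrow> 2 * sqrt (2 * pi)"
proof (intro conjI)
  have space: "GOE_space (M n) n (Q n)" if "n \<ge> 1" for n
    using goe[OF that] by (auto simp: GOE_space_def GOE_space_axioms_def GOE_def)
  show "\<forall>n\<ge>1. AE \<omega> in M n. \<exists>!x. global_minimizer n (\<lambda>i j. Q n i j \<omega>) x"
    using GOE_space.AE_unique_minimizer_Q[OF space] by blast
  define f where "f x = x / sqrt (ln x)" for x :: real
  have ev: "\<forall>\<^sub>F n in sequentially. support_lower_bound (real n) \<le> \<P>(\<omega> in M n. \<kappa> n \<omega> = 2)
      \<and> \<P>(\<omega> in M n. \<kappa> n \<omega> = 2) \<le> \<P>(\<omega> in M n. \<kappa> n \<omega> > 1) \<and> \<P>(\<omega> in M n. \<kappa> n \<omega> > 1) \<le> support_upper_bound (real n) \<and> 0 \<le> f (real n)"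
  proof -
    have "\<forall>\<^sub>F x in at_top. 4 \<le> low_level_sq x" "\<forall>\<^sub>F x in at_top. low_level_sq x \<le> high_level_sq x"
      "\<forall>\<^sub>F x in at_top. (x - 1) * exp (- low_level_sq x) \<le> 1" "\<forall>\<^sub>F x in at_top. x * exp (- 3 / 4 * low_level_sq x) \<le> 1 / 2"
      unfolding low_level_sq_def high_level_sq_def by real_asymp+
    then have "\<forall>\<^sub>F x in at_top. 3 \<le> x \<and> 4 \<le> low_level_sq x \<and> low_level_sq x \<le> high_level_sq x
      \<and> (x - 1) * exp (- low_level_sq x) \<le> 1 \<and> x * exp (- 3 / 4 * low_level_sq x) \<le> 1 / 2"
      using eventually_ge_at_top[of 3] by eventually_elim auto
    then have "\<forall>\<^sub>F n in sequentially. 3 \<le> real n \<and> 4 \<le> low_level_sq (real n) \<and> low_level_sq (real n) \<le> high_level_sq (real n)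
      \<and> (real n - 1) * exp (- low_level_sq (real n)) \<le> 1 \<and> real n * exp (- 3 / 4 * low_level_sq (real n)) \<le> 1 / 2"
      by (rule eventually_compose_filterlim[OF _ filterlim_real_sequentially])
    then show ?thesis
    proof eventually_elim
      case (elim n)
      then have n: "3 \<le> n" "1 \<le> n" by auto
      interpret GOE_space "M n" n "Q n" by (rule space[OF n(2)])
      have "{\<omega>\<in>space (M n). \<kappa> n \<omega> = 2} = {\<omega>\<in>space (M n). kappa \<omega> = 2}"
        "{\<omega>\<in>space (M n). \<kappa> n \<omega> > 1} = {\<omega>\<in>space (M n). 1 < kappa \<omega>}"
        using kappa_eq by (auto simp: \<open>\<And>n \<omega>. \<kappa> n \<omega> = _ n \<omega>\<close>)
      then show ?case using prob_support_bounds[OF n(1)] elim n by (simp add: f_def)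
    qed
  qed
  have lim: "(\<lambda>n. f (real n) * support_lower_bound (real n)) \<longlonglongrightarrow> 2 * sqrt (2 * pi)"
    "(\<lambda>n. f (real n) * support_upper_bound (real n)) \<longlonglongrightarrow> 2 * sqrt (2 * pi)"
    using filterlim_compose[OF support_lower_bound_lim filterlim_real_sequentially]
      filterlim_compose[OF support_upper_bound_lim filterlim_real_sequentially] by (simp_all add: f_def)
  have "(\<lambda>n. f (real n) * \<P>(\<omega> in M n. \<kappa> n \<omega> > 1)) \<longlonglongrightarrow> 2 * sqrt (2 * pi)"
    by (rule tendsto_sandwich[OF _ _ lim]; use ev in eventually_elim) (auto intro!: mult_left_mono)
  then show "(\<lambda>n. real n / sqrt (ln (real n)) * \<P>(\<omega> in M n. \<kappa> n \<omega> > 1)) \<longlonglongrightarrow> 2 * sqrt (2 * pi)" by (simp add: f_def)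
  have "(\<lambda>n. f (real n) * \<P>(\<omega> in M n. \<kappa> n \<omega> = 2)) \<longlonglongrightarrow> 2 * sqrt (2 * pi)"
    by (rule tendsto_sandwich[OF _ _ lim]; use ev in eventually_elim) (auto intro!: mult_left_mono)
  then show "(\<lambda>n. real n / sqrt (ln (real n)) * \<P>(\<omega> in M n. \<kappa> n \<omega> = 2)) \<longlonglongrightarrow> 2 * sqrt (2 * pi)" by (simp add: f_def)
qed

end
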